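(* Let $\psi:S^2\to \mathrm{U}(3)$ be a minimal immersion with constant curvature and uniton number $1$. Then $\psi$ is unitarily congruent to one of the following minimal immersions: (1) $\pi_{V_0^2}-\pi_{V_0^2}^\perp$; (2) $\pi_{V_0^2\oplus V_1^2}-\pi_{V_0^2\oplus V_1^2}^\perp$; (3) $\pi_{V_0^1\oplus\mathbb{C}}-\pi_{V_0^1\oplus\mathbb{C}}^\perp$, where $V_0^1,V_1^1$ are regarded as line subbundles of $S^2\times\mathbb{C}^2\subset S^2\times\mathbb{C}^3$ and $\mathbb{C}\cong(V_0^1\oplus V_1^1)^\perp\subset\mathbb{C}^3$.
   Context: Metrics: $\mathrm{U}(n)$ carries the bi-invariant metric $h_n(\xi,\eta)=\frac18\mathrm{tr}(\xi\eta^* )$, $\xi,\eta\in\mathfrak{u}(n)$. "Constant curvature" means that the induced metric on $S^2$ has constant Gaussian curvature. $S^2$ is the Riemann sphere with local complex coordinate $z$; every nonconstant harmonic map $S^2\to \mathrm{U}(n)$ is a branched minimal immersion. Uniton number: for smooth $\psi:S^2\to \mathrm{U}(n)$ write $\frac12\psi^{-1}d\psi=A^\psi_z dz+A^\psi_{\bar z}d\bar z$. If $\psi$ is harmonic, an extended solution of $\psi$ is a smooth map $\Psi:S^2\to\Omega \mathrm{U}(n)=\{\gamma:S^1\to \mathrm{U}(n)\text{ smooth}:\gamma(1)=I_n\}$ with $\Psi^{-1}d\Psi=(1-\lambda^{-1})A^\psi_zdz+(1-\lambda)A^\psi_{\bar z}d\bar z$ for all $\lambda\in S^1$; it is unique up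 to left multiplication by a constant loop, and $\psi=\Psi_{-1}$ up to left multiplication by a constant element of $\mathrm{U}(n)$ (here $\Psi_\lambda(z)=\Psi(z)(\lambda)$). The uniton number of $\psi$ is the smallest $r\ge0$ for which $\psi$ has a polynomial extended solution $\Psi=\sum_{i=0}^r\lambda^iA_i$ with $A_i:S^2\to\mathfrak{u}(n)\otimes\mathbb{C}$ smooth. Veronese sequence: $V_0^n:S^2\to\mathbb{C}P^n$ is spanned by $f(z)=\big(\sqrt{\tbinom{n}{k}}\,z^k\big)_{k=0}^n$, and $V_i^n$ is the orthogonal complement of $\mathrm{span}\{f,\dots,\partial_z^{i-1}f\}$ in $\mathrm{span}\{f,\dots,\partial_z^if\}$ (extended to all of $S^2$), $0\le i\le n$. Maps into Grassmannians are identified with subbundles of trivial bundles; for a subbundle $Y$ of $S^2\times\mathbb{C}^3$, $\pi_Y$ and $\pi_Y^\perp$ are the orthogonal projections onto $Y$ and $Y^\perp$. Unitary congruence: $\psi,\tilde\psi:S^2\to \mathrm{U}(n)$ are unitarily congruent if $\tilde\psi=A\,(\psi\circ g)\,B$ for some constants $A,B\in \mathrm{U}(n)$ and some biholomorphism $g$ of $S^2$ (choice of complex coordinate). *)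

theory Defs
  imports "HOL-Analysis.Analysis"
begin

datatype riemann_sphere = Fin complex | Infty

definition chart_infty :: "complex \<Rightarrow> riemann_sphere" where
  "chart_infty w = (if w = 0 then Infty else Fin (1 / w))"

definition charts :: "(complex \<Rightarrow> riemann_sphere) set" where
  "charts = {Fin, chart_infty}"

text \<open>Openness of the coordinate domain is what makes the map continuous.\<close>

definition sphere_holomorphic :: "(riemann_sphere \<Rightarrow> riemann_sphere) \<Rightarrow> bool" where
  "sphere_holomorphic g \<longleftrightarrow>
    (\<forall>c\<in>charts. \<forall>d\<in>charts.
       open {z. g (c z) \<in> range d} \<and>
       (\<lambda>z. inv d (g (c z))) holomorphic_on {z. g (c z) \<in> range d})"

definition sphere_biholomorphism :: "(riemann_sphere \<Rightarrow> riemann_sphere) \<Rightarrow> bool" where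
  "sphere_biholomorphism g \<longleftrightarrow> bij g \<and> sphere_holomorphic g \<and> sphere_holomorphic (inv g)"

primrec C_diff :: "nat \<Rightarrow> ('a::real_normed_vector \<Rightarrow> 'b::real_normed_vector) \<Rightarrow> bool" where
  "C_diff 0 f \<longleftrightarrow> continuous_on UNIV f"
| "C_diff (Suc k) f \<longleftrightarrow>
    (\<forall>x. f differentiable (at x)) \<and> (\<forall>v. C_diff k (\<lambda>x. frechet_derivative f (at x) v))"

definition smooth :: "('a::real_normed_vector \<Rightarrow> 'b::real_normed_vector) \<Rightarrow> bool" where
  "smooth f \<longleftrightarrow> (\<forall>k. C_diff k f)"

definition sphere_smooth :: "(riemann_sphere \<Rightarrow> 'b::real_normed_vector) \<Rightarrow> bool" where
  "sphere_smooth f \<longleftrightarrow> (\<forall>c\<in>charts. smooth (f \<circ> c))"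

type_synonym 'n cmat = "complex ^ 'n ^ 'n"

definition ctranspose :: "'n cmat \<Rightarrow> 'n::finite cmat" where
  "ctranspose A = (\<chi> i j. cnj (A $ j $ i))"

definition cscale :: "complex \<Rightarrow> 'n cmat \<Rightarrow> 'n::finite cmat" where
  "cscale c A = (\<chi> i j. c * A $ i $ j)"

definition unitary_group :: "'n::finite cmat set" where
  "unitary_group = {A. A ** ctranspose A = mat 1 \<and> ctranspose A ** A = mat 1}"

definition unitary_algebra :: "'n::finite cmat set" where
  "unitary_algebra = {\<xi>. ctranspose \<xi> = - \<xi>}"

text \<open>On the Lie algebra the trace below is already real.\<close>

definition h_metric :: "'n::finite cmat \<Rightarrow> 'n cmat \<Rightarrow> real" where
  "h_metric \<xi> \<eta> = Re (trace (\<xi> ** ctranspose \<eta>)) / 8"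

definition smooth_to_U :: "(riemann_sphere \<Rightarrow> 'n::finite cmat) \<Rightarrow> bool" where
  "smooth_to_U \<psi> \<longleftrightarrow> sphere_smooth \<psi> \<and> range \<psi> \<subseteq> unitary_group"

text \<open>Index 1 stands for \<open>x\<close> and index 2 for \<open>y\<close>.\<close>

definition coord_dir :: "2 \<Rightarrow> complex" where
  "coord_dir i = (if i = 1 then 1 else \<i>)"

definition partial :: "2 \<Rightarrow> (complex \<Rightarrow> 'b::real_normed_vector) \<Rightarrow> complex \<Rightarrow> 'b" where
  "partial i F z = frechet_derivative F (at z) (coord_dir i)"

definition d_z :: "(complex \<Rightarrow> 'n::finite cmat) \<Rightarrow> complex \<Rightarrow> 'n cmat" where
  "d_z F z = cscale (1/2) (partial 1 F z - cscale \<i> (partial 2 F z))"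

definition d_zbar :: "(complex \<Rightarrow> 'n::finite cmat) \<Rightarrow> complex \<Rightarrow> 'n cmat" where
  "d_zbar F z = cscale (1/2) (partial 1 F z + cscale \<i> (partial 2 F z))"

text \<open>Tangent vectors of the unitary group are translated to the Lie algebra from the left:
  \<open>mc F i\<close> is the translate of the \<open>i\<close>-th partial derivative of \<open>F\<close>. In this
  trivialization the Levi-Civita connection of a bi-invariant metric is
  $\nabla_X \eta = d\eta(X) + \frac12 [F^{-1} dF(X), \eta]$.\<close>

definition mc :: "(complex \<Rightarrow> 'n::finite cmat) \<Rightarrow> 2 \<Rightarrow> complex \<Rightarrow> 'n cmat" where
  "mc F i z = matrix_inv (F z) ** partial i F z"

definition cov_deriv ::
    "(complex \<Rightarrow> 'n::finite cmat) \<Rightarrow> 2 \<Rightarrow> (complex \<Rightarrow> 'n cmat) \<Rightarrow> complex \<Rightarrow> 'n cmat" where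
  "cov_deriv F i \<eta> z = partial i \<eta> z + (1/2) *\<^sub>R (mc F i z ** \<eta> z - \<eta> z ** mc F i z)"

definition induced_metric :: "(complex \<Rightarrow> 'n::finite cmat) \<Rightarrow> complex \<Rightarrow> real^2^2" where
  "induced_metric F z = (\<chi> i j. h_metric (mc F i z) (mc F j z))"

text \<open>Vanishing of the mean curvature vector, the $g$-trace of the normal part of
  $\nabla dF$ (tangential parts of $\nabla dF$ are invisible to normal vectors \<open>\<nu>\<close>).\<close>

definition zero_mean_curvature :: "(complex \<Rightarrow> 'n::finite cmat) \<Rightarrow> complex \<Rightarrow> bool" where
  "zero_mean_curvature F z \<longleftrightarrow>
    (\<forall>\<nu>\<in>unitary_algebra. (\<forall>k. h_metric (mc F k z) \<nu> = 0) \<longrightarrow>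
       h_metric (\<Sum>i\<in>UNIV. \<Sum>j\<in>UNIV.
          matrix_inv (induced_metric F z) $ i $ j *\<^sub>R cov_deriv F i (mc F j) z) \<nu> = 0)"

definition christoffel :: "(complex \<Rightarrow> real^2^2) \<Rightarrow> 2 \<Rightarrow> 2 \<Rightarrow> 2 \<Rightarrow> complex \<Rightarrow> real" where
  "christoffel g k i j z =
    (1/2) * (\<Sum>l\<in>UNIV. matrix_inv (g z) $ k $ l *
      (partial i (\<lambda>u. g u $ j $ l) z + partial j (\<lambda>u. g u $ i $ l) z
        - partial l (\<lambda>u. g u $ i $ j) z))"

text \<open>$R(\partial_i, \partial_j) \partial_k = \sum_l R^l_{ijk} \partial_l$, with
  $R(X,Y) = [\nabla_X, \nabla_Y] - \nabla_{[X,Y]}$.\<close>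

definition riemann :: "(complex \<Rightarrow> real^2^2) \<Rightarrow> 2 \<Rightarrow> 2 \<Rightarrow> 2 \<Rightarrow> 2 \<Rightarrow> complex \<Rightarrow> real" where
  "riemann g l i j k z =
    partial i (christoffel g l j k) z - partial j (christoffel g l i k) z
    + (\<Sum>m\<in>UNIV. christoffel g l i m z * christoffel g m j k z
                - christoffel g l j m z * christoffel g m i k z)"

definition gauss_curvature :: "(complex \<Rightarrow> real^2^2) \<Rightarrow> complex \<Rightarrow> real" where
  "gauss_curvature g z = (\<Sum>l\<in>UNIV. g z $ 1 $ l * riemann g l 1 2 2 z) / det (g z)"

definition immersion :: "(riemann_sphere \<Rightarrow> 'n::finite cmat) \<Rightarrow> bool" where
  "immersion \<psi> \<longleftrightarrow> smooth_to_U \<psi> \<and>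
    (\<forall>c\<in>charts. \<forall>z. inj (frechet_derivative (\<psi> \<circ> c) (at z)))"

definition minimal_immersion :: "(riemann_sphere \<Rightarrow> 'n::finite cmat) \<Rightarrow> bool" where
  "minimal_immersion \<psi> \<longleftrightarrow> immersion \<psi> \<and>
    (\<forall>c\<in>charts. \<forall>z. zero_mean_curvature (\<psi> \<circ> c) z)"

definition constant_curvature :: "(riemann_sphere \<Rightarrow> 'n::finite cmat) \<Rightarrow> bool" where
  "constant_curvature \<psi> \<longleftrightarrow>
    (\<exists>K. \<forall>c\<in>charts. \<forall>z. gauss_curvature (induced_metric (\<psi> \<circ> c)) z = K)"

text \<open>By conformal invariance in dimension two, the tension field may be computed with the flat
  metric of a complex coordinate.\<close>

definition harmonic :: "(riemann_sphere \<Rightarrow> 'n::finite cmat) \<Rightarrow> bool" where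
  "harmonic \<psi> \<longleftrightarrow> smooth_to_U \<psi> \<and>
    (\<forall>c\<in>charts. \<forall>z. (\<Sum>i\<in>UNIV. cov_deriv (\<psi> \<circ> c) i (mc (\<psi> \<circ> c) i) z) = 0)"

definition A_z :: "(complex \<Rightarrow> 'n::finite cmat) \<Rightarrow> complex \<Rightarrow> 'n cmat" where
  "A_z F z = cscale (1/2) (matrix_inv (F z) ** d_z F z)"

definition A_zbar :: "(complex \<Rightarrow> 'n::finite cmat) \<Rightarrow> complex \<Rightarrow> 'n cmat" where
  "A_zbar F z = cscale (1/2) (matrix_inv (F z) ** d_zbar F z)"

text \<open>A map into the loop group is a function of a point and of the loop parameter \<open>\<zeta>\<close> with
  \<open>norm \<zeta> = 1\<close>; its values at other \<open>\<zeta>\<close> are irrelevant. It is smooth when it is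
  jointly smooth in the point and in \<open>t\<close>, where \<open>\<zeta> = cis t\<close>.\<close>

definition smooth_to_loops :: "(riemann_sphere \<Rightarrow> complex \<Rightarrow> 'n::finite cmat) \<Rightarrow> bool" where
  "smooth_to_loops \<Psi> \<longleftrightarrow>
    (\<forall>p \<zeta>. norm \<zeta> = 1 \<longrightarrow> \<Psi> p \<zeta> \<in> unitary_group) \<and>
    (\<forall>p. \<Psi> p 1 = mat 1) \<and>
    (\<forall>c\<in>charts. smooth (\<lambda>(t, z). \<Psi> (c z) (cis t)))"

definition extended_solution ::
    "(riemann_sphere \<Rightarrow> 'n::finite cmat) \<Rightarrow> (riemann_sphere \<Rightarrow> complex \<Rightarrow> 'n cmat) \<Rightarrow> bool" where
  "extended_solution \<psi> \<Psi> \<longleftrightarrow> smooth_to_loops \<Psi> \<and>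
    (\<forall>c\<in>charts. \<forall>z \<zeta>. norm \<zeta> = 1 \<longrightarrow>
       matrix_inv (\<Psi> (c z) \<zeta>) ** d_z (\<lambda>u. \<Psi> (c u) \<zeta>) z
         = cscale (1 - inverse \<zeta>) (A_z (\<psi> \<circ> c) z) \<and>
       matrix_inv (\<Psi> (c z) \<zeta>) ** d_zbar (\<lambda>u. \<Psi> (c u) \<zeta>) z
         = cscale (1 - \<zeta>) (A_zbar (\<psi> \<circ> c) z))"

definition polynomial_extended_solution :: "(riemann_sphere \<Rightarrow> 'n::finite cmat) \<Rightarrow> nat \<Rightarrow> bool" where
  "polynomial_extended_solution \<psi> r \<longleftrightarrow>
    (\<exists>\<Psi> A. extended_solution \<psi> \<Psi> \<and>
       (\<forall>i\<le>r. sphere_smooth (A i)) \<and>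
       (\<forall>p \<zeta>. norm \<zeta> = 1 \<longrightarrow> \<Psi> p \<zeta> = (\<Sum>i\<le>r. cscale (\<zeta> ^ i) (A i p))))"

definition has_uniton_number :: "(riemann_sphere \<Rightarrow> 'n::finite cmat) \<Rightarrow> nat \<Rightarrow> bool" where
  "has_uniton_number \<psi> r \<longleftrightarrow> harmonic \<psi> \<and> polynomial_extended_solution \<psi> r \<and>
    (\<forall>s<r. \<not> polynomial_extended_solution \<psi> s)"

definition unitarily_congruent ::
    "(riemann_sphere \<Rightarrow> 'n::finite cmat) \<Rightarrow> (riemann_sphere \<Rightarrow> 'n cmat) \<Rightarrow> bool" where
  "unitarily_congruent \<psi> \<phi> \<longleftrightarrow>
    (\<exists>A\<in>unitary_group. \<exists>B\<in>unitary_group. \<exists>g. sphere_biholomorphism g \<and>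
       (\<forall>p. \<phi> p = A ** \<psi> (g p) ** B))"

definition hinner :: "complex^'n::finite \<Rightarrow> complex^'n \<Rightarrow> complex" where
  "hinner x y = (\<Sum>i\<in>UNIV. x $ i * cnj (y $ i))"

definition hperp :: "(complex^'n::finite) set \<Rightarrow> (complex^'n) set" where
  "hperp W = {x. \<forall>y\<in>W. hinner x y = 0}"

definition orth_proj :: "(complex^'n::finite) set \<Rightarrow> 'n cmat" where
  "orth_proj W = (THE P. \<forall>x. P *v x \<in> W \<and> x - P *v x \<in> hperp W)"

type_synonym 'n subbundle = "riemann_sphere \<Rightarrow> (complex^'n) set"

definition bundle_sum :: "'n::finite subbundle \<Rightarrow> 'n subbundle \<Rightarrow> 'n subbundle" where
  "bundle_sum X Y p = {x + y |x y. x \<in> X p \<and> y \<in> Y p}"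

definition bundle_perp :: "'n::finite subbundle \<Rightarrow> 'n subbundle" where
  "bundle_perp Y p = hperp (Y p)"

definition bundle_map :: "'n::finite subbundle \<Rightarrow> riemann_sphere \<Rightarrow> 'n cmat" where
  "bundle_map Y p = orth_proj (Y p) - orth_proj (bundle_perp Y p)"

text \<open>For \<open>n < 2\<close> the binomial coefficients with \<open>k > n\<close> vanish, so the curve lies in the
  first \<open>n + 1\<close> coordinates; this is the inclusion of $\mathbb{C}^{n+1}$ in $\mathbb{C}^3$.\<close>

definition veronese_curve :: "nat \<Rightarrow> complex \<Rightarrow> complex^3" where
  "veronese_curve n z =
    vector (map (\<lambda>k. of_real (sqrt (real (n choose k))) * z ^ k) [0, 1, 2])"

definition veronese_deriv :: "nat \<Rightarrow> nat \<Rightarrow> complex \<Rightarrow> complex^3" where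
  "veronese_deriv n i z = (\<chi> k. (deriv ^^ i) (\<lambda>u. veronese_curve n u $ k) z)"

definition osculating :: "nat \<Rightarrow> nat \<Rightarrow> complex \<Rightarrow> (complex^3) set" where
  "osculating n i z = vec.span {veronese_deriv n j z |j. j < i}"

definition veronese_fin :: "nat \<Rightarrow> nat \<Rightarrow> complex \<Rightarrow> (complex^3) set" where
  "veronese_fin n i z = osculating n (Suc i) z \<inter> hperp (osculating n i z)"

text \<open>\<open>veronese n i\<close> is $V_i^n$. The fibre at infinity of the continuous extension consists of
  the limits of sections.\<close>

primrec veronese :: "nat \<Rightarrow> nat \<Rightarrow> 3 subbundle" where
  "veronese n i (Fin z) = veronese_fin n i z"
| "veronese n i Infty = {v. \<exists>s. (\<forall>z. s z \<in> veronese_fin n i z) \<and> (s \<longlongrightarrow> v) at_infinity}"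

end

theory Submission
  imports Defs "HOL-Complex_Analysis.Cauchy_Integral_Formula"
begin

text \<open>A uniton number one extended solution is \<open>P + \<zeta> P\<^sup>\<bottom>\<close> with \<open>P\<close> the projection onto a holomorphic
  subbundle, so \<open>\<psi> = Q (P - P\<^sup>\<bottom>)\<close> and the induced metric is \<open>e |dz|\<^sup>2\<close> with
  \<open>e = tr (P\<^sub>z P\<^sub>z\<^sup>*)\<close>. Up to passing to the conjugate of \<open>P\<^sup>\<bottom>\<close>, the rank is one. Constant curvature
  makes the second Frenet density a constant multiple \<open>2 - K/2\<close> of \<open>e\<close>; the Frenet equations then force
  \<open>K = 4\<close> (the curve lies in a projective line) or \<open>K = 2\<close>. The function \<open>u = e\<^sup>-\<^sup>1\<^sup>/\<^sup>2\<close> satisfies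
  \<open>u\<^sub>z\<^sub>z = q u\<close> with \<open>q\<close> entire and vanishing at infinity, so \<open>u\<^sub>z\<^sub>z = 0\<close> and \<open>u\<close> is a positive Hermitian
  form in \<open>(1, z)\<close>, which an affine change of coordinate turns into a multiple of \<open>1 + |z|\<^sup>2\<close>. With \<open>n = 4/K\<close>,
  the matrix \<open>T = (1 + |z|\<^sup>2)\<^sup>n P\<close> is annihilated by the third \<open>z\<close>-derivative, hence
  \<open>T = f f\<^sup>*\<close> for a polynomial curve \<open>f\<close> whose coefficients are orthogonal with the norms of the
  Veronese curve.\<close>

section \<open>Smooth maps and commuting partial derivatives\<close>

text \<open>The constant 2 - K/2 and the values of K come from the Toda system of the Frenet
  densities l0 = e and l1. Flatness of the trivial bundle gives (log l0)_{z zbar} = l1 - 2 l0, and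
  curvature K makes the left side -(K/2) e; hence l1 = (2 - K/2) e. In C^3 the sequence stops there:
  a nonzero l1 satisfies (log l1)_{z zbar} = l0 - 2 l1, which leaves K = 2, and l1 = 0 means K = 4.
  Logarithms never occur; the identities are multiplied out, and scalars are extracted from matrices
  by P X P = tr (X P) P for rank-one P.

  Passing to rank one works because the complement of a holomorphic bundle is antiholomorphic,
  conjugation restores holomorphy, and e is unchanged. On the way back, rank two with n = 2 becomes
  the complement of V_2^2, the second model, while for n = 1 the conjugate complement inside C^2 is
  again V_0^1 up to a constant unitary. So the third model serves both ranks.

  The chart at infinity serves twice: its positive density makes q decay, and continuity there
  extends the final equality from the plane to the sphere.\<close>

lemma C_diff_Suc_imp: "C_diff (Suc k) f \<Longrightarrow> C_diff k f"
proof (induction k arbitrary: f)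
  case 0
  then show ?case
    by (auto intro!: continuous_at_imp_continuous_on differentiable_imp_continuous_within)
next
  case (Suc k)
  then show ?case by simp
qed

lemma C_diff_SucI:
  assumes "\<And>x. (f has_derivative f' x) (at x)" "\<And>v. C_diff k (\<lambda>x. f' x v)"
  shows "C_diff (Suc k) f"
proof -
  have "frechet_derivative f (at x) = f' x" for x
    using frechet_derivative_at[OF assms(1)] by simp
  with assms show ?thesis by (auto simp: differentiable_def)
qed

lemma C_diff_const: "C_diff k (\<lambda>x. c)"
  by (induction k arbitrary: c) auto

lemma C_diff_add: "C_diff k f \<Longrightarrow> C_diff k g \<Longrightarrow> C_diff k (\<lambda>x. f x + g x)"
proof (induction k arbitrary: f g)
  case 0
  then show ?case by (auto intro: continuous_intros)
next
  case (Suc k)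
  show ?case
  proof (rule C_diff_SucI)
    show "((\<lambda>x. f x + g x) has_derivative
        (\<lambda>v. frechet_derivative f (at x) v + frechet_derivative g (at x) v)) (at x)" for x
      using Suc.prems by (auto intro!: has_derivative_add simp: frechet_derivative_works)
    show "C_diff k (\<lambda>x. frechet_derivative f (at x) v + frechet_derivative g (at x) v)" for v
      using Suc by auto
  qed
qed

lemma C_diff_bounded_linear:
  assumes "bounded_linear L"
  shows "C_diff k f \<Longrightarrow> C_diff k (\<lambda>x. L (f x))"
proof (induction k arbitrary: f)
  case 0
  then show ?case using assms by (auto intro: bounded_linear.continuous_on)
next
  case (Suc k)
  show ?case
  proof (rule C_diff_SucI)
    show "((\<lambda>x. L (f x)) has_derivative (\<lambda>v. L (frechet_derivative f (at x) v))) (at x)" for x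
      using Suc.prems by (auto intro!: bounded_linear.has_derivative[OF assms] simp: frechet_derivative_works)
    show "C_diff k (\<lambda>x. L (frechet_derivative f (at x) v))" for v
      using Suc by auto
  qed
qed

lemma C_diff_bounded_bilinear:
  assumes "bounded_bilinear B"
  shows "C_diff k f \<Longrightarrow> C_diff k g \<Longrightarrow> C_diff k (\<lambda>x. B (f x) (g x))"
proof (induction k arbitrary: f g)
  case 0
  then show ?case using assms by (auto intro: bounded_bilinear.continuous_on)
next
  case (Suc k)
  show ?case
  proof (rule C_diff_SucI)
    show "((\<lambda>x. B (f x) (g x)) has_derivative
        (\<lambda>v. B (f x) (frechet_derivative g (at x) v) + B (frechet_derivative f (at x) v) (g x))) (at x)" for x
      using Suc.prems by (auto intro!: bounded_bilinear.FDERIV[OF assms] simp: frechet_derivative_works)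
    show "C_diff k (\<lambda>x. B (f x) (frechet_derivative g (at x) v)
        + B (frechet_derivative f (at x) v) (g x))" for v
      using Suc.prems C_diff_Suc_imp[OF Suc.prems(1)] C_diff_Suc_imp[OF Suc.prems(2)]
      by (intro C_diff_add Suc.IH) auto
  qed
qed

text \<open>Solutions of \<open>du = c u\<^sup>m de\<close> gain one derivative at a time; this covers \<open>1 / e\<close> and \<open>1 / sqrt e\<close>.\<close>

lemma C_diff_scaled_power:
  fixes u e :: "'a::real_normed_vector \<Rightarrow> real"
  assumes "\<And>x. (u has_derivative (\<lambda>v. c * u x ^ m * frechet_derivative e (at x) v)) (at x)"
    and "\<And>k. C_diff k e"
  shows "C_diff k u"
proof (induction k)
  case 0
  show ?case
    using assms(1) by (auto intro!: continuous_at_imp_continuous_on has_derivative_continuous)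
next
  case (Suc k)
  have pow: "C_diff k (\<lambda>x. u x ^ n)" for n
    by (induction n) (auto intro: C_diff_const C_diff_bounded_bilinear[OF bounded_bilinear_mult] Suc)
  show ?case
  proof (rule C_diff_SucI[OF assms(1)])
    have "C_diff k (\<lambda>x. frechet_derivative e (at x) v)" for v
      using assms(2)[of "Suc k"] by simp
    then show "C_diff k (\<lambda>x. c * u x ^ m * frechet_derivative e (at x) v)" for v
      by (intro C_diff_bounded_bilinear[OF bounded_bilinear_mult] pow C_diff_const)
  qed
qed

named_theorems smooth_intros

lemma smooth_const [smooth_intros]: "smooth (\<lambda>x. c)"
  by (simp add: smooth_def C_diff_const)

lemma smooth_bounded_linear: "bounded_linear L \<Longrightarrow> smooth f \<Longrightarrow> smooth (\<lambda>x. L (f x))"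
  by (simp add: smooth_def C_diff_bounded_linear)

lemma smooth_bounded_bilinear:
  "bounded_bilinear B \<Longrightarrow> smooth f \<Longrightarrow> smooth g \<Longrightarrow> smooth (\<lambda>x. B (f x) (g x))"
  by (simp add: smooth_def C_diff_bounded_bilinear)

lemma smooth_add [smooth_intros]: "smooth f \<Longrightarrow> smooth g \<Longrightarrow> smooth (\<lambda>x. f x + g x)"
  by (simp add: smooth_def C_diff_add)

lemma smooth_uminus [smooth_intros]: "smooth f \<Longrightarrow> smooth (\<lambda>x. - f x)"
  using smooth_bounded_linear[OF bounded_linear_minus[OF bounded_linear_ident]] .

lemma smooth_diff [smooth_intros]: "smooth f \<Longrightarrow> smooth g \<Longrightarrow> smooth (\<lambda>x. f x - g x)"
  using smooth_add[OF _ smooth_uminus, of f g] by simp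

lemma smooth_ident [smooth_intros]: "smooth (\<lambda>x. x)"
proof -
  have "C_diff k (\<lambda>x::'a. x)" for k
    by (cases k) (auto intro!: C_diff_SucI[OF has_derivative_ident] C_diff_const simp del: C_diff.simps(2))
  then show ?thesis by (simp add: smooth_def)
qed

lemma smooth_imp_differentiable: "smooth f \<Longrightarrow> f differentiable (at x)"
  using smooth_def[of f] C_diff.simps(2)[of 0 f] by auto

lemma smooth_has_derivative: "smooth f \<Longrightarrow> (f has_derivative frechet_derivative f (at x)) (at x)"
  using smooth_imp_differentiable by (simp add: frechet_derivative_works)

lemma smooth_continuous: "smooth f \<Longrightarrow> continuous_on UNIV f"
  using smooth_def[of f] C_diff.simps(1)[of f] by auto

lemma smooth_frechet_derivative [smooth_intros]:
  "smooth f \<Longrightarrow> smooth (\<lambda>x. frechet_derivative f (at x) v)"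
  unfolding smooth_def using C_diff.simps(2)[of _ f] by blast

lemma smooth_mult [smooth_intros]:
  fixes f g :: "'a::real_normed_vector \<Rightarrow> 'b::real_normed_algebra"
  shows "smooth f \<Longrightarrow> smooth g \<Longrightarrow> smooth (\<lambda>x. f x * g x)"
  using smooth_bounded_bilinear[OF bounded_bilinear_mult] .

lemma smooth_power [smooth_intros]:
  fixes f :: "'a::real_normed_vector \<Rightarrow> 'b::real_normed_algebra_1"
  shows "smooth f \<Longrightarrow> smooth (\<lambda>x. f x ^ n)"
  by (induction n) (auto intro: smooth_intros)

lemma smooth_of_real [smooth_intros]: 
  "smooth f \<Longrightarrow> smooth (\<lambda>x. of_real (f x) :: 'b::real_normed_algebra_1)"
  using smooth_bounded_linear[OF bounded_linear_of_real] .

lemma smooth_cnj [smooth_intros]: "smooth f \<Longrightarrow> smooth (\<lambda>x. cnj (f x))"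
  using smooth_bounded_linear[OF bounded_linear_cnj] .

lemma smooth_Re [smooth_intros]: "smooth f \<Longrightarrow> smooth (\<lambda>x. Re (f x))"
  using smooth_bounded_linear[OF bounded_linear_Re] .

lemma smooth_inverse [smooth_intros]:
  fixes e :: "'a::real_normed_vector \<Rightarrow> real"
  assumes "smooth e" "\<And>x. e x \<noteq> 0"
  shows "smooth (\<lambda>x. inverse (e x))"
proof -
  have "((\<lambda>x. inverse (e x)) has_derivative
      (\<lambda>v. (-1) * (inverse (e x))^2 * frechet_derivative e (at x) v)) (at x)" for x
    using Deriv.has_derivative_inverse[OF assms(2) smooth_has_derivative[OF assms(1), of x]]
    by (simp add: power2_eq_square algebra_simps)
  from C_diff_scaled_power[OF this] assms(1) show ?thesis by (auto simp: smooth_def)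
qed

lemma smooth_inverse_sqrt [smooth_intros]:
  fixes e :: "'a::real_normed_vector \<Rightarrow> real"
  assumes "smooth e" and pos: "\<And>x. e x > 0"
  shows "smooth (\<lambda>x. inverse (sqrt (e x)))"
proof -
  have "((\<lambda>x. inverse (sqrt (e x))) has_derivative
      (\<lambda>v. (-1/2) * (inverse (sqrt (e x)))^3 * frechet_derivative e (at x) v)) (at x)" for x
  proof -
    have "sqrt (e x) \<noteq> 0" using pos[of x] by simp
    then have "((\<lambda>x. inverse (sqrt (e x))) has_derivative (\<lambda>v. - (inverse (sqrt (e x)) *
        (frechet_derivative e (at x) v * (inverse (sqrt (e x)) / 2)) * inverse (sqrt (e x))))) (at x)"
      by (rule Deriv.has_derivative_inverse[OF _ has_derivative_real_sqrt[OF pos smooth_has_derivative[OF assms(1)]]])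
    then show ?thesis by (simp add: power3_eq_cube algebra_simps)
  qed
  from C_diff_scaled_power[OF this] assms(1) show ?thesis by (auto simp: smooth_def)
qed

lemma smooth_compose_affine:
  fixes a b :: complex
  assumes "smooth F" shows "smooth (\<lambda>z. F (a * z + b))"
proof -
  have "C_diff k F \<Longrightarrow> C_diff k (\<lambda>z. F (a * z + b))" for k and F :: "complex \<Rightarrow> 'a"
  proof (induction k arbitrary: F)
    case 0
    then show ?case by (auto intro!: continuous_on_compose2[of UNIV F] continuous_intros)
  next
    case (Suc k)
    show ?case
    proof (rule C_diff_SucI)
      show "((\<lambda>z. F (a * z + b)) has_derivative
          (\<lambda>v. frechet_derivative F (at (a * z + b)) (a * v))) (at z)" for z
      proof (rule has_derivative_compose[where f="\<lambda>z. a * z + b" and g=F])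
        show "((\<lambda>z. a * z + b) has_derivative (*) a) (at z)"
          by (auto intro!: derivative_eq_intros)
        show "(F has_derivative frechet_derivative F (at (a * z + b))) (at (a * z + b))"
          using Suc.prems by (simp add: frechet_derivative_works)
      qed
      show "C_diff k (\<lambda>x. frechet_derivative F (at (a * x + b)) (a * v))" for v
        using Suc.IH[of "\<lambda>x. frechet_derivative F (at x) (a * v)"] Suc.prems by simp
    qed
  qed
  with assms show ?thesis by (auto simp: smooth_def)
qed

section \<open>Symmetry of second partial derivatives\<close>

lemma coord_dir_simps [simp]: "coord_dir 1 = 1" "coord_dir 2 = \<i>"
  by (simp_all add: coord_dir_def)

text \<open>Classical second-difference argument: on a square of side \<open>h\<close> at
  \<open>z\<close> the mixed difference \<open>?D\<close> equals h^2 times either mixed partial at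
  some nearby point, by the mean value theorem applied in the two orders. Continuity of both mixed
  partials closes the gap as h shrinks.\<close>

lemma partial_commute_real:
  fixes f :: "complex \<Rightarrow> real"
  assumes f: "smooth f"
  shows "partial 1 (partial 2 f) z = partial 2 (partial 1 f) z"
proof -
  define fx where "fx = partial 1 f"
  define fy where "fy = partial 2 f"
  have sm: "smooth fx" "smooth fy"
    unfolding fx_def fy_def partial_def by (auto intro: smooth_intros f)
  have line1: "((\<lambda>t. g (Complex t y)) has_real_derivative partial 1 g (Complex t y)) (at t)"
    if "smooth g" for g :: "complex \<Rightarrow> real" and t y
  proof -
    have "((\<lambda>t. Complex t y) has_derivative (\<lambda>t. Complex t 0)) (at t)"
      unfolding complex_eq_iff Complex_eq by (auto intro!: derivative_eq_intros)
    from has_derivative_compose[OF this smooth_has_derivative[OF that]]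
    have "((\<lambda>t. g (Complex t y)) has_derivative
        (\<lambda>t'. frechet_derivative g (at (Complex t y)) (Complex t' 0))) (at t)" .
    moreover have "frechet_derivative g (at w) (Complex t' 0) = partial 1 g w * t'" for t' w
      using linear_scale[OF linear_frechet_derivative[OF smooth_imp_differentiable[OF that]], of w t' 1]
      by (simp add: partial_def coord_dir_def scaleR_conv_of_real complex_of_real_def)
    ultimately show ?thesis by (simp add: has_field_derivative_def)
  qed
  have imag: "t *\<^sub>R \<i> = Complex 0 t" for t
    by (simp add: complex_eq_iff)
  have line2: "((\<lambda>t. g (Complex x t)) has_real_derivative partial 2 g (Complex x t)) (at t)"
    if "smooth g" for g :: "complex \<Rightarrow> real" and t x
  proof -
    have "((\<lambda>t. Complex x t) has_derivative (\<lambda>t. Complex 0 t)) (at t)"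
      unfolding complex_eq_iff Complex_eq by (auto intro!: derivative_eq_intros)
    from has_derivative_compose[OF this smooth_has_derivative[OF that]]
    have "((\<lambda>t. g (Complex x t)) has_derivative
        (\<lambda>t'. frechet_derivative g (at (Complex x t)) (Complex 0 t'))) (at t)" .
    moreover have "frechet_derivative g (at w) (Complex 0 t') = partial 2 g w * t'" for t' w
      using linear_scale[OF linear_frechet_derivative[OF smooth_imp_differentiable[OF that]], of w t' \<i>]
      unfolding imag partial_def coord_dir_simps by (metis real_scaleR_def mult.commute)
    ultimately show ?thesis by (simp add: has_field_derivative_def)
  qed
  have ex: "\<exists>p q. dist p z \<le> 2 * h \<and> dist q z \<le> 2 * h \<and> partial 2 fx p = partial 1 fy q" if "h > 0" for h
  proof -
    define x y where "x = Re z" and "y = Im z"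
    let ?D = "f (Complex (x+h) (y+h)) - f (Complex (x+h) y) - f (Complex x (y+h)) + f (Complex x y)"
    have near: "dist (Complex s t) z \<le> 2 * h" if "x < s" "s < x+h" "y < t" "t < y+h" for s t
    proof -
      have "dist (Complex s t) z \<le> \<bar>s - x\<bar> + \<bar>t - y\<bar>"
        unfolding dist_norm x_def y_def using cmod_le[of "Complex s t - z"] by simp
      with that show ?thesis by simp
    qed
    have "\<exists>s. x < s \<and> s < x+h \<and> (f (Complex (x+h) (y+h)) - f (Complex (x+h) y)) -
        (f (Complex x (y+h)) - f (Complex x y)) = (x+h-x) * (fx (Complex s (y+h)) - fx (Complex s y))"
      using that unfolding fx_def
      by (intro MVT2[where f="\<lambda>t. f (Complex t (y+h)) - f (Complex t y)"] DERIV_diff line1 f) auto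
    then obtain s where s: "x < s" "s < x+h" "?D = h * (fx (Complex s (y+h)) - fx (Complex s y))"
      by (auto simp: algebra_simps)
    have "\<exists>t. y < t \<and> t < y+h \<and> fx (Complex s (y+h)) - fx (Complex s y)
        = (y+h-y) * partial 2 fx (Complex s t)"
      using that by (intro MVT2 line2 sm) auto
    then obtain t where t: "y < t" "t < y+h" "?D = h * (h * partial 2 fx (Complex s t))"
      using s by auto
    have "\<exists>s. y < s \<and> s < y+h \<and> (f (Complex (x+h) (y+h)) - f (Complex x (y+h))) -
        (f (Complex (x+h) y) - f (Complex x y)) = (y+h-y) * (fy (Complex (x+h) s) - fy (Complex x s))"
      using that unfolding fy_def
      by (intro MVT2[where f="\<lambda>t. f (Complex (x+h) t) - f (Complex x t)"] DERIV_diff line2 f) auto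
    then obtain t' where t': "y < t'" "t' < y+h" "?D = h * (fy (Complex (x+h) t') - fy (Complex x t'))"
      by (auto simp: algebra_simps)
    have "\<exists>t. x < t \<and> t < x+h \<and> fy (Complex (x+h) t') - fy (Complex x t')
        = (x+h-x) * partial 1 fy (Complex t t')"
      using that by (intro MVT2 line1 sm) auto
    then obtain s' where s': "x < s'" "s' < x+h" "?D = h * (h * partial 1 fy (Complex s' t'))"
      using t' by auto
    from s'(3) t(3) that have "partial 2 fx (Complex s t) = partial 1 fy (Complex s' t')" by simp
    with near s s' t t' show ?thesis by blast
  qed
  have "smooth (partial 2 fx)" "smooth (partial 1 fy)"
    unfolding partial_def[abs_def] by (auto intro: smooth_intros sm)
  then have lim: "(partial 2 fx \<longlongrightarrow> partial 2 fx z) (at z)" "(partial 1 fy \<longlongrightarrow> partial 1 fy z) (at z)"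
    and cont: "isCont (partial 2 fx) z" "isCont (partial 1 fy) z"
    using smooth_continuous by (auto simp: continuous_on_eq_continuous_at isCont_def)
  have "\<bar>partial 2 fx z - partial 1 fy z\<bar> \<le> 0 + 2 * r" if "r > 0" for r
  proof -
    obtain d1 where d1: "d1 > 0" "\<And>p. dist p z < d1 \<Longrightarrow> dist (partial 2 fx p) (partial 2 fx z) < r"
      using cont(1) \<open>r > 0\<close> unfolding continuous_at_eps_delta by blast
    obtain d2 where d2: "d2 > 0" "\<And>p. dist p z < d2 \<Longrightarrow> dist (partial 1 fy p) (partial 1 fy z) < r"
      using cont(2) \<open>r > 0\<close> unfolding continuous_at_eps_delta by blast
    define h where "h = min d1 d2 / 4"
    have h: "h > 0" "2 * h < d1" "2 * h < d2" using d1 d2 by (auto simp: h_def min_def)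
    obtain p q where "dist p z \<le> 2 * h" "dist q z \<le> 2 * h" "partial 2 fx p = partial 1 fy q"
      using ex[OF h(1)] by blast
    with d1(2)[of p] d2(2)[of q] h show ?thesis by (simp add: dist_real_def)
  qed
  note bnd = this
  have "\<bar>partial 2 fx z - partial 1 fy z\<bar> \<le> 0"
  proof (rule field_le_epsilon)
    fix r :: real assume "r > 0"
    then show "\<bar>partial 2 fx z - partial 1 fy z\<bar> \<le> 0 + r"
      using bnd[of "r / 2"] by simp
  qed
  then show ?thesis by (simp add: fx_def fy_def)
qed

lemma partial_bounded_linear:
  assumes "bounded_linear L" "smooth f"
  shows "partial i (\<lambda>z. L (f z)) = (\<lambda>z. L (partial i f z))"
  using frechet_derivative_at[OF bounded_linear.has_derivative[OF assms(1) smooth_has_derivative[OF assms(2)]]]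
  by (auto simp: partial_def fun_eq_iff)

lemma smooth_partial [smooth_intros]: "smooth f \<Longrightarrow> smooth (partial i f)"
  unfolding partial_def[abs_def] by (rule smooth_frechet_derivative)

lemma partial_commute:
  fixes f :: "complex \<Rightarrow> 'a::euclidean_space"
  assumes f: "smooth f"
  shows "partial 1 (partial 2 f) z = partial 2 (partial 1 f) z"
proof (rule euclidean_eqI)
  fix b :: 'a
  have L: "bounded_linear (\<lambda>x. x \<bullet> b)" by (rule bounded_linear_inner_left)
  show "partial 1 (partial 2 f) z \<bullet> b = partial 2 (partial 1 f) z \<bullet> b"
    using partial_commute_real[OF smooth_bounded_linear[OF L f], of z]
    by (simp add: partial_bounded_linear[OF L] f smooth_partial)
qed

section \<open>Complex matrices and Wirtinger derivatives\<close>

lemma cscale_nth [simp]: "cscale c A $ i $ j = c * A $ i $ j"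
  by (simp add: cscale_def)

lemma ctranspose_nth [simp]: "ctranspose A $ i $ j = cnj (A $ j $ i)"
  by (simp add: ctranspose_def)

definition mconj :: "'n::finite cmat \<Rightarrow> 'n cmat" where
  "mconj A = (\<chi> i j. cnj (A $ i $ j))"

lemma mconj_nth [simp]: "mconj A $ i $ j = cnj (A $ i $ j)"
  by (simp add: mconj_def)

lemma cmat_eqI: "(\<And>i j. A $ i $ j = B $ i $ j) \<Longrightarrow> A = (B :: 'n::finite cmat)"
  by (simp add: vec_eq_iff)

lemma mmult_nth: "(A ** B) $ i $ j = (\<Sum>k\<in>UNIV. A $ i $ k * B $ k $ j)"
  by (simp add: matrix_matrix_mult_def)

lemma cscale_simps [simp]:
  fixes A B :: "'n::finite cmat"
  shows "cscale c (cscale d A) = cscale (c * d) A" "cscale 1 A = A" "cscale 0 A = 0" "cscale c 0 = 0"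
    "cscale c A ** B = cscale c (A ** B)" "A ** cscale c B = cscale c (A ** B)"
    "ctranspose (cscale c A) = cscale (cnj c) (ctranspose A)"
    "mconj (cscale c A) = cscale (cnj c) (mconj A)"
    "trace (cscale c A) = c * trace A"
    "- cscale c A = cscale (- c) A"
    "cscale (-1) A = - A"
  by (auto intro!: cmat_eqI simp: mmult_nth sum_distrib_left sum_distrib_right trace_def algebra_simps)

lemma cscale_right_distrib: "cscale c (A + B) = cscale c A + cscale c (B :: 'n::finite cmat)"
  and cscale_left_distrib: "cscale (c + d) A = cscale c A + cscale d (A :: 'n::finite cmat)"
  and cscale_right_diff: "cscale c (A - B) = cscale c A - cscale c (B :: 'n::finite cmat)"
  by (auto intro!: cmat_eqI simp: algebra_simps)

lemma scaleR_cmat: "r *\<^sub>R A = cscale (of_real r) (A :: 'n::finite cmat)"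
  by (rule cmat_eqI) (simp add: scaleR_conv_of_real[where 'a=complex])

lemma cscale_eq_0_iff [simp]: "cscale c A = 0 \<longleftrightarrow> c = 0 \<or> A = (0 :: 'n::finite cmat)"
  by (auto simp: vec_eq_iff)

lemma cscale_cancel: "cscale c A = cscale c B \<longleftrightarrow> c = 0 \<or> A = (B :: 'n::finite cmat)"
  by (auto simp: vec_eq_iff)

lemma mmult_zero [simp]: "(0 :: 'n::finite cmat) ** A = 0" "A ** (0 :: 'n::finite cmat) = 0"
  by (auto intro!: cmat_eqI simp: mmult_nth)

lemma mmult_distrib:
  fixes A B C :: "'n::finite cmat"
  shows "(A + B) ** C = A ** C + B ** C" "A ** (B + C) = A ** B + A ** C"
    "(A - B) ** C = A ** C - B ** C" "A ** (B - C) = A ** B - A ** C"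
  by (auto intro!: cmat_eqI simp: mmult_nth algebra_simps sum.distrib sum_subtractf)

lemma mmult_minus [simp]:
  fixes A B :: "'n::finite cmat"
  shows "(- A) ** B = - (A ** B)" "A ** (- B) = - (A ** B)"
  by (auto intro!: cmat_eqI simp: mmult_nth sum_negf)

lemma ctranspose_simps [simp]:
  fixes A B :: "'n::finite cmat"
  shows "ctranspose (A + B) = ctranspose A + ctranspose B" "ctranspose (A - B) = ctranspose A - ctranspose B"
    "ctranspose (- A) = - ctranspose A" "ctranspose 0 = (0 :: 'n cmat)" "ctranspose (mat 1) = (mat 1 :: 'n cmat)"
    "ctranspose (ctranspose A) = A" "ctranspose (A ** B) = ctranspose B ** ctranspose A"
  by (auto intro!: cmat_eqI simp: mmult_nth mat_def mult.commute)

lemma mconj_simps [simp]: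
  fixes A B :: "'n::finite cmat"
  shows "mconj (A + B) = mconj A + mconj B" "mconj (A - B) = mconj A - mconj B"
    "mconj (- A) = - mconj A" "mconj 0 = (0 :: 'n cmat)" "mconj (mat 1) = (mat 1 :: 'n cmat)"
    "mconj (mconj A) = A" "mconj (A ** B) = mconj A ** mconj B"
    "mconj (ctranspose A) = ctranspose (mconj A)"
  by (auto intro!: cmat_eqI simp: mmult_nth mat_def)

lemma ctranspose_eq_0_iff [simp]: "ctranspose A = 0 \<longleftrightarrow> A = (0 :: 'n::finite cmat)"
  by (auto simp: vec_eq_iff)

lemma mconj_eq_0_iff [simp]: "mconj A = 0 \<longleftrightarrow> A = (0 :: 'n::finite cmat)"
  by (auto simp: vec_eq_iff)

lemma trace_cnj: "trace (ctranspose A) = cnj (trace (A :: 'n::finite cmat))"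
  "trace (mconj A) = cnj (trace A)"
  by (simp_all add: trace_def)

lemma trace_mmult_ctranspose:
  "trace (A ** ctranspose A) = of_real (\<Sum>i\<in>UNIV. \<Sum>j\<in>UNIV. (norm (A $ i $ j))\<^sup>2)"
  for A :: "'n::finite cmat"
  unfolding trace_def mmult_nth by (simp add: complex_norm_square[symmetric] mult.commute)

lemma trace_mmult_ctranspose_eq_0: "trace (A ** ctranspose A) = 0 \<longleftrightarrow> A = (0 :: 'n::finite cmat)"
proof
  assume "trace (A ** ctranspose A) = 0"
  then have "(\<Sum>i\<in>UNIV. \<Sum>j\<in>UNIV. (norm (A $ i $ j))\<^sup>2) = 0"
    unfolding trace_mmult_ctranspose of_real_eq_0_iff .
  then have "norm (A $ i $ j) ^ 2 = 0" for i j
    by (simp add: sum_nonneg_eq_0_iff sum_nonneg)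
  then show "A = 0" by (simp add: vec_eq_iff)
qed (simp add: trace_def)

lemma matrix_inv_eqI:
  fixes A B :: "'a::semiring_1 ^ 'n ^ 'n"
  assumes "A ** B = mat 1" "B ** A = mat 1"
  shows "matrix_inv A = B"
proof -
  have "A ** matrix_inv A = mat 1 \<and> matrix_inv A ** A = mat 1"
    unfolding matrix_inv_def by (rule someI[of _ B]) (use assms in auto)
  then show ?thesis
    by (metis assms(2) matrix_mul_assoc matrix_mul_lid matrix_mul_rid)
qed

lemma unitary_groupD:
  assumes "U \<in> unitary_group"
  shows "U ** ctranspose U = mat 1" "ctranspose U ** U = mat 1"
    "X ** U ** ctranspose U = X" "X ** ctranspose U ** U = X"
  using assms by (auto simp: unitary_group_def matrix_mul_assoc[symmetric])

lemma unitary_group_ctranspose: "U \<in> unitary_group \<Longrightarrow> ctranspose U \<in> unitary_group"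
  by (simp add: unitary_group_def)

lemma unitary_group_mult: "U \<in> unitary_group \<Longrightarrow> V \<in> unitary_group \<Longrightarrow> U ** V \<in> unitary_group"
  unfolding unitary_group_def mem_Collect_eq ctranspose_simps
  by (metis matrix_mul_assoc matrix_mul_lid)

lemma unitary_group_mconj: "U \<in> unitary_group \<Longrightarrow> mconj U \<in> unitary_group"
  unfolding unitary_group_def mem_Collect_eq
  by (metis mconj_simps(5,7,8))

lemma unitary_group_one [simp]: "mat 1 \<in> unitary_group"
  by (simp add: unitary_group_def)

lemma bounded_bilinear_mmult: "bounded_bilinear ((**) :: 'n::finite cmat \<Rightarrow> _ \<Rightarrow> 'n cmat)"
  unfolding bilinear_conv_bounded_bilinear[symmetric]
  by (auto simp: bilinear_def scaleR_cmat mmult_distrib intro!: linearI)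

lemma bounded_bilinear_cscale: "bounded_bilinear (cscale :: complex \<Rightarrow> 'n::finite cmat \<Rightarrow> 'n cmat)"
  unfolding bilinear_conv_bounded_bilinear[symmetric]
  by (auto simp: bilinear_def scaleR_cmat cscale_left_distrib cscale_right_distrib scaleR_conv_of_real
      mult.commute intro!: linearI)

lemma bounded_linear_ctranspose: "bounded_linear (ctranspose :: 'n::finite cmat \<Rightarrow> _)"
  unfolding linear_conv_bounded_linear[symmetric] by (rule linearI) (auto simp: scaleR_cmat)

lemma bounded_linear_mconj: "bounded_linear (mconj :: 'n::finite cmat \<Rightarrow> _)"
  unfolding linear_conv_bounded_linear[symmetric] by (rule linearI) (auto simp: scaleR_cmat)

lemma bounded_linear_trace: "bounded_linear (trace :: 'n::finite cmat \<Rightarrow> complex)"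
  unfolding linear_conv_bounded_linear[symmetric]
  by (rule linearI) (auto simp: scaleR_cmat trace_add scaleR_conv_of_real)

lemma smooth_mmult [smooth_intros]:
  fixes A B :: "'a::real_normed_vector \<Rightarrow> 'n::finite cmat"
  shows "smooth A \<Longrightarrow> smooth B \<Longrightarrow> smooth (\<lambda>x. A x ** B x)"
  by (rule smooth_bounded_bilinear[OF bounded_bilinear_mmult])

lemma smooth_cscale [smooth_intros]:
  fixes A :: "'a::real_normed_vector \<Rightarrow> 'n::finite cmat"
  shows "smooth f \<Longrightarrow> smooth A \<Longrightarrow> smooth (\<lambda>x. cscale (f x) (A x))"
  by (rule smooth_bounded_bilinear[OF bounded_bilinear_cscale])

lemma smooth_ctranspose [smooth_intros]:
  fixes A :: "'a::real_normed_vector \<Rightarrow> 'n::finite cmat"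
  shows "smooth A \<Longrightarrow> smooth (\<lambda>x. ctranspose (A x))"
  by (rule smooth_bounded_linear[OF bounded_linear_ctranspose])

lemma smooth_mconj [smooth_intros]:
  fixes A :: "'a::real_normed_vector \<Rightarrow> 'n::finite cmat"
  shows "smooth A \<Longrightarrow> smooth (\<lambda>x. mconj (A x))"
  by (rule smooth_bounded_linear[OF bounded_linear_mconj])

lemma smooth_trace [smooth_intros]:
  fixes A :: "'a::real_normed_vector \<Rightarrow> 'n::finite cmat"
  shows "smooth A \<Longrightarrow> smooth (\<lambda>x. trace (A x))"
  by (rule smooth_bounded_linear[OF bounded_linear_trace])

lemma smooth_divide_const [smooth_intros]:
  fixes f :: "'a::real_normed_vector \<Rightarrow> complex"
  shows "smooth f \<Longrightarrow> smooth (\<lambda>x. f x / c)"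
  using smooth_mult[OF _ smooth_const, of f "inverse c"] by (simp add: divide_inverse)

section \<open>Wirtinger calculus for scalar and matrix valued functions\<close>

definition dz :: "(complex \<Rightarrow> complex) \<Rightarrow> complex \<Rightarrow> complex" where
  "dz f z = (partial 1 f z - \<i> * partial 2 f z) / 2"

definition dzb :: "(complex \<Rightarrow> complex) \<Rightarrow> complex \<Rightarrow> complex" where
  "dzb f z = (partial 1 f z + \<i> * partial 2 f z) / 2"

lemma smooth_wirtinger [smooth_intros]:
  "smooth F \<Longrightarrow> smooth (d_z F)" "smooth F \<Longrightarrow> smooth (d_zbar F)"
  "smooth f \<Longrightarrow> smooth (dz f)" "smooth f \<Longrightarrow> smooth (dzb f)"
  unfolding d_z_def[abs_def] d_zbar_def[abs_def] dz_def[abs_def] dzb_def[abs_def]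
  by (auto intro!: smooth_intros)

lemma partial_eqI:
  "(f has_derivative f') (at z) \<Longrightarrow> partial i f z = f' (coord_dir i)"
  unfolding partial_def by (metis frechet_derivative_at)

lemma has_derivative_partial:
  "smooth f \<Longrightarrow> (f has_derivative (\<lambda>h. Re h *\<^sub>R partial 1 f z + Im h *\<^sub>R partial 2 f z)) (at z)"
proof -
  assume f: "smooth f"
  have lin: "linear (frechet_derivative f (at z))"
    by (rule linear_frechet_derivative[OF smooth_imp_differentiable[OF f]])
  have "frechet_derivative f (at z) h = Re h *\<^sub>R partial 1 f z + Im h *\<^sub>R partial 2 f z" for h
  proof -
    have "h = Re h *\<^sub>R 1 + Im h *\<^sub>R \<i>" by (simp add: complex_eq_iff)
    then have "frechet_derivative f (at z) h = frechet_derivative f (at z) (Re h *\<^sub>R 1 + Im h *\<^sub>R \<i>)"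
      by simp
    also have "\<dots> = Re h *\<^sub>R partial 1 f z + Im h *\<^sub>R partial 2 f z"
      unfolding linear_add[OF lin] linear_scale[OF lin] partial_def coord_dir_simps ..
    finally show ?thesis .
  qed
  then have "frechet_derivative f (at z) = (\<lambda>h. Re h *\<^sub>R partial 1 f z + Im h *\<^sub>R partial 2 f z)" by auto
  with smooth_has_derivative[OF f, of z] show ?thesis by simp
qed

lemma has_derivative_wirtinger:
  fixes F :: "complex \<Rightarrow> 'n::finite cmat"
  assumes "smooth F"
  shows "(F has_derivative (\<lambda>h. cscale h (d_z F z) + cscale (cnj h) (d_zbar F z))) (at z)"
proof -
  have "Re h *\<^sub>R partial 1 F z + Im h *\<^sub>R partial 2 F z
      = cscale h (d_z F z) + cscale (cnj h) (d_zbar F z)" for h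
    by (rule cmat_eqI) (simp add: d_z_def d_zbar_def complex_eq_iff field_simps)
  with has_derivative_partial[OF assms, of z] show ?thesis by simp
qed

lemma has_derivative_wirtinger_scalar:
  assumes "smooth f"
  shows "(f has_derivative (\<lambda>h. h * dz f z + cnj h * dzb f z)) (at z)"
proof -
  have "Re h *\<^sub>R partial 1 f z + Im h *\<^sub>R partial 2 f z = h * dz f z + cnj h * dzb f z" for h
    by (simp add: dz_def dzb_def complex_eq_iff field_simps)
  with has_derivative_partial[OF assms, of z] show ?thesis by simp
qed

lemma wirtinger_eqI:
  fixes F :: "complex \<Rightarrow> 'n::finite cmat"
  assumes "(F has_derivative (\<lambda>h. cscale h a + cscale (cnj h) b)) (at z)"
  shows "d_z F z = a" "d_zbar F z = b"
  unfolding d_z_def d_zbar_def partial_eqI[OF assms]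
  by (auto intro!: cmat_eqI simp: algebra_simps)

lemma wirtinger_eqI_scalar:
  assumes "(f has_derivative (\<lambda>h. h * a + cnj h * b)) (at z)"
  shows "dz f z = a" "dzb f z = b"
  unfolding dz_def dzb_def partial_eqI[OF assms]
  by (auto simp: complex_eq_iff)

lemma wirtinger_funI:
  fixes F :: "complex \<Rightarrow> 'n::finite cmat"
  assumes "\<And>z. (F has_derivative (\<lambda>h. cscale h (a z) + cscale (cnj h) (b z))) (at z)"
  shows "d_z F = a \<and> d_zbar F = b"
  using wirtinger_eqI[OF assms] by auto

lemma wirtinger_funI_scalar:
  assumes "\<And>z. (f has_derivative (\<lambda>h. h * a z + cnj h * b z)) (at z)"
  shows "dz f = a \<and> dzb f = b"
  using wirtinger_eqI_scalar[OF assms] by auto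

text \<open>Both Wirtinger derivatives are read off from one real derivative, split into its complex
  linear and antilinear parts; hence the conjunction. The rules that follow repeat this pattern, and
  the lists without \<open>_conj\<close> collect the two halves.\<close>

lemma wirtinger_mmult_conj:
  fixes F G :: "complex \<Rightarrow> 'n::finite cmat"
  assumes "smooth F" "smooth G"
  shows "d_z (\<lambda>z. F z ** G z) = (\<lambda>z. d_z F z ** G z + F z ** d_z G z) \<and>
    d_zbar (\<lambda>z. F z ** G z) = (\<lambda>z. d_zbar F z ** G z + F z ** d_zbar G z)"
  by (intro wirtinger_funI has_derivative_eq_rhs[OF bounded_bilinear.FDERIV[OF bounded_bilinear_mmult
      assms[THEN has_derivative_wirtinger]]]) (simp add: fun_eq_iff mmult_distrib cscale_right_distrib)

lemmas wirtinger_mmult = wirtinger_mmult_conj[THEN conjunct1] wirtinger_mmult_conj[THEN conjunct2]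

lemma wirtinger_cscale_conj:
  fixes F :: "complex \<Rightarrow> 'n::finite cmat"
  assumes "smooth f" "smooth F"
  shows "d_z (\<lambda>z. cscale (f z) (F z)) = (\<lambda>z. cscale (dz f z) (F z) + cscale (f z) (d_z F z)) \<and>
    d_zbar (\<lambda>z. cscale (f z) (F z)) = (\<lambda>z. cscale (dzb f z) (F z) + cscale (f z) (d_zbar F z))"
  by (intro wirtinger_funI has_derivative_eq_rhs[OF bounded_bilinear.FDERIV[OF bounded_bilinear_cscale
      has_derivative_wirtinger_scalar[OF assms(1)] has_derivative_wirtinger[OF assms(2)]]])
    (simp add: fun_eq_iff cscale_left_distrib cscale_right_distrib mult.commute)

lemmas wirtinger_cscale = wirtinger_cscale_conj[THEN conjunct1] wirtinger_cscale_conj[THEN conjunct2]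

lemma wirtinger_mult_conj:
  assumes "smooth f" "smooth g"
  shows "dz (\<lambda>z. f z * g z) = (\<lambda>z. dz f z * g z + f z * dz g z) \<and>
    dzb (\<lambda>z. f z * g z) = (\<lambda>z. dzb f z * g z + f z * dzb g z)"
  by (intro wirtinger_funI_scalar has_derivative_eq_rhs[OF has_derivative_mult[OF
      assms[THEN has_derivative_wirtinger_scalar]]]) (simp add: fun_eq_iff algebra_simps)

lemmas wirtinger_mult = wirtinger_mult_conj[THEN conjunct1] wirtinger_mult_conj[THEN conjunct2]

lemma wirtinger_add_conj:
  fixes F :: "complex \<Rightarrow> 'n::finite cmat"
  shows "smooth F \<Longrightarrow> smooth G \<Longrightarrow> d_z (\<lambda>z. F z + G z) = (\<lambda>z. d_z F z + d_z G z) \<and>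
      d_zbar (\<lambda>z. F z + G z) = (\<lambda>z. d_zbar F z + d_zbar G z)"
    "smooth f \<Longrightarrow> smooth g \<Longrightarrow> dz (\<lambda>z. f z + g z) = (\<lambda>z. dz f z + dz g z) \<and>
      dzb (\<lambda>z. f z + g z) = (\<lambda>z. dzb f z + dzb g z)"
  by (intro wirtinger_funI has_derivative_eq_rhs[OF has_derivative_add[OF
      has_derivative_wirtinger has_derivative_wirtinger]]; simp add: fun_eq_iff cscale_right_distrib)
    (intro wirtinger_funI_scalar has_derivative_eq_rhs[OF has_derivative_add[OF
      has_derivative_wirtinger_scalar has_derivative_wirtinger_scalar]]; simp add: fun_eq_iff algebra_simps)

lemmas wirtinger_add = wirtinger_add_conj[THEN conjunct1] wirtinger_add_conj[THEN conjunct2]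

lemma wirtinger_const_conj:
  "d_z (\<lambda>z. C :: 'n::finite cmat) = (\<lambda>z. 0) \<and> d_zbar (\<lambda>z. C :: 'n cmat) = (\<lambda>z. 0)"
  "dz (\<lambda>z. c) = (\<lambda>z. 0) \<and> dzb (\<lambda>z. c) = (\<lambda>z. 0)"
  "dz (\<lambda>z. z) = (\<lambda>z. 1) \<and> dzb (\<lambda>z. z) = (\<lambda>z. 0)"
  "dz cnj = (\<lambda>z. 0) \<and> dzb cnj = (\<lambda>z. 1)"
  by (rule wirtinger_funI wirtinger_funI_scalar; auto intro!: derivative_eq_intros)+

lemmas wirtinger_const = wirtinger_const_conj[THEN conjunct1] wirtinger_const_conj[THEN conjunct2]

lemma wirtinger_uminus:
  fixes F :: "complex \<Rightarrow> 'n::finite cmat"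
  shows "smooth F \<Longrightarrow> d_z (\<lambda>z. - F z) = (\<lambda>z. - d_z F z)"
    "smooth F \<Longrightarrow> d_zbar (\<lambda>z. - F z) = (\<lambda>z. - d_zbar F z)"
    "smooth f \<Longrightarrow> dz (\<lambda>z. - f z) = (\<lambda>z. - dz f z)"
    "smooth f \<Longrightarrow> dzb (\<lambda>z. - f z) = (\<lambda>z. - dzb f z)"
  using wirtinger_cscale[of "\<lambda>z. -1" F] wirtinger_mult[of "\<lambda>z. -1" f]
  by (simp_all add: smooth_const wirtinger_const)

lemma wirtinger_diff:
  fixes F :: "complex \<Rightarrow> 'n::finite cmat"
  shows "smooth F \<Longrightarrow> smooth G \<Longrightarrow> d_z (\<lambda>z. F z - G z) = (\<lambda>z. d_z F z - d_z G z)"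
    "smooth F \<Longrightarrow> smooth G \<Longrightarrow> d_zbar (\<lambda>z. F z - G z) = (\<lambda>z. d_zbar F z - d_zbar G z)"
    "smooth f \<Longrightarrow> smooth g \<Longrightarrow> dz (\<lambda>z. f z - g z) = (\<lambda>z. dz f z - dz g z)"
    "smooth f \<Longrightarrow> smooth g \<Longrightarrow> dzb (\<lambda>z. f z - g z) = (\<lambda>z. dzb f z - dzb g z)"
  using wirtinger_add(1,3)[of F "\<lambda>z. - G z"] wirtinger_add(2,4)[of f "\<lambda>z. - g z"]
  by (simp_all add: smooth_uminus wirtinger_uminus)

lemma wirtinger_linear_conj:
  fixes F :: "complex \<Rightarrow> 'n::finite cmat"
  assumes F: "smooth F"
  shows "d_z (\<lambda>z. ctranspose (F z)) = (\<lambda>z. ctranspose (d_zbar F z)) \<and>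
      d_zbar (\<lambda>z. ctranspose (F z)) = (\<lambda>z. ctranspose (d_z F z))"
    "d_z (\<lambda>z. mconj (F z)) = (\<lambda>z. mconj (d_zbar F z)) \<and>
      d_zbar (\<lambda>z. mconj (F z)) = (\<lambda>z. mconj (d_z F z))"
    "dz (\<lambda>z. trace (F z)) = (\<lambda>z. trace (d_z F z)) \<and>
      dzb (\<lambda>z. trace (F z)) = (\<lambda>z. trace (d_zbar F z))"
  by (intro wirtinger_funI wirtinger_funI_scalar;
      rule has_derivative_eq_rhs[OF bounded_linear.has_derivative[OF _ has_derivative_wirtinger[OF F]]];
      simp add: fun_eq_iff trace_add
        bounded_linear_ctranspose bounded_linear_mconj bounded_linear_trace)+

lemma wirtinger_cnj_conj:
  assumes "smooth f"
  shows "dz (\<lambda>z. cnj (f z)) = (\<lambda>z. cnj (dzb f z)) \<and> dzb (\<lambda>z. cnj (f z)) = (\<lambda>z. cnj (dz f z))"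
  by (intro wirtinger_funI_scalar has_derivative_eq_rhs[OF bounded_linear.has_derivative[OF bounded_linear_cnj
      has_derivative_wirtinger_scalar[OF assms]]]) (simp add: fun_eq_iff)

lemmas wirtinger_linear = wirtinger_linear_conj[THEN conjunct1] wirtinger_linear_conj[THEN conjunct2]
  wirtinger_cnj_conj[THEN conjunct1] wirtinger_cnj_conj[THEN conjunct2]

lemma partial_mult_const:
  fixes F :: "complex \<Rightarrow> 'n::finite cmat" and f :: "complex \<Rightarrow> complex"
  shows "smooth F \<Longrightarrow> partial i (\<lambda>z. cscale c (F z)) = (\<lambda>z. cscale c (partial i F z))"
    "smooth f \<Longrightarrow> partial i (\<lambda>z. c * f z) = (\<lambda>z. c * partial i f z)"
  by (rule partial_bounded_linear[OF bounded_bilinear.bounded_linear_right[OF bounded_bilinear_cscale]])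
    (auto intro: partial_bounded_linear[OF bounded_linear_mult_right])

lemma partial_add:
  assumes "smooth f" "smooth g"
  shows "partial i (\<lambda>z. f z + g z) = (\<lambda>z. partial i f z + partial i g z)"
    "partial i (\<lambda>z. f z - g z) = (\<lambda>z. partial i f z - partial i g z)"
  using partial_eqI[OF has_derivative_add[OF assms[THEN smooth_has_derivative]]]
    partial_eqI[OF has_derivative_diff[OF assms[THEN smooth_has_derivative]]]
  by (simp_all add: fun_eq_iff partial_def)

lemma wirtinger_commute:
  fixes F :: "complex \<Rightarrow> 'n::finite cmat"
  shows "smooth F \<Longrightarrow> d_z (d_zbar F) = d_zbar (d_z F)" "smooth f \<Longrightarrow> dz (dzb f) = dzb (dz f)"
proof -
  assume F: "smooth F"
  note sm = F smooth_partial[OF F] smooth_cscale[OF smooth_const]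
    smooth_add[OF smooth_partial[OF F] smooth_cscale[OF smooth_const smooth_partial[OF F]]]
    smooth_diff[OF smooth_partial[OF F] smooth_cscale[OF smooth_const smooth_partial[OF F]]]
  show "d_z (d_zbar F) = d_zbar (d_z F)"
    unfolding fun_eq_iff d_z_def[abs_def] d_zbar_def[abs_def]
    by (simp add: partial_mult_const partial_add sm partial_commute cmat_eqI algebra_simps)
next
  assume f: "smooth f"
  define k :: complex where "k = 1/2"
  have eq: "dz f = (\<lambda>z. k * (partial 1 f z - \<i> * partial 2 f z))"
    "dzb f = (\<lambda>z. k * (partial 1 f z + \<i> * partial 2 f z))" for f
    by (auto simp: dz_def dzb_def k_def)
  note sm = f smooth_partial[OF f] smooth_mult[OF smooth_const]
    smooth_add[OF smooth_partial[OF f] smooth_mult[OF smooth_const smooth_partial[OF f]]]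
    smooth_diff[OF smooth_partial[OF f] smooth_mult[OF smooth_const smooth_partial[OF f]]]
  show "dz (dzb f) = dzb (dz f)"
    unfolding fun_eq_iff eq
    by (simp add: partial_mult_const partial_add sm partial_commute) (simp add: algebra_simps)
qed

lemmas wirtinger_rules = wirtinger_mmult wirtinger_cscale wirtinger_mult wirtinger_add wirtinger_const
  wirtinger_uminus wirtinger_diff wirtinger_linear

lemma dz_dzb_eq_0_imp_const:
  assumes "smooth f" "\<And>z. dz f z = 0" "\<And>z. dzb f z = 0"
  shows "f z = f w"
proof -
  have "(f has_derivative (\<lambda>h. 0)) (at x within UNIV)" for x
    using has_derivative_wirtinger_scalar[OF assms(1), of x] assms by simp
  then obtain c where "\<And>x. x \<in> UNIV \<Longrightarrow> f x = c"
    using has_derivative_zero_constant[of UNIV f] by auto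
  then show ?thesis by simp
qed

lemma d_z_d_zbar_eq_0_imp_const:
  fixes F :: "complex \<Rightarrow> 'n::finite cmat"
  assumes "smooth F" "\<And>z. d_z F z = 0" "\<And>z. d_zbar F z = 0"
  shows "F z = F w"
proof -
  have "(F has_derivative (\<lambda>h. 0)) (at x within UNIV)" for x
    using has_derivative_wirtinger[OF assms(1), of x] assms by simp
  then obtain c where "\<And>x. x \<in> UNIV \<Longrightarrow> F x = c"
    using has_derivative_zero_constant[of UNIV F] by auto
  then show ?thesis by simp
qed

section \<open>Projections onto holomorphic subbundles\<close>

lemma trace_zero [simp]: "trace (0 :: 'n::finite cmat) = 0"
  by (simp add: trace_def)

lemma trace_uminus [simp]: "trace (- A) = - trace (A :: 'n::finite cmat)"
  by (simp add: trace_def sum_negf)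

lemma mat_nth2: "(mat c :: real^2^2) $ i $ j = (if i = j then c else 0)"
  by (simp add: mat_def)

text \<open>Harmonicity in disguise: with a, b the two partials of \<open>d_zbar P\<close> and c, d
  those of \<open>d_z P\<close>, the hypothesis is the equality of the mixed Wirtinger derivatives
  of \<open>P\<close>, and the left side of the conclusion is the divergence of \<open>mc F\<close>
  in \<open>harmonic_F\<close>.\<close>

lemma partials_of_mixed_wirtinger_eq:
  fixes a b c d :: "'n::finite cmat"
  assumes "cscale (1/2) (a - cscale \<i> b) = cscale (1/2) (c + cscale \<i> d)"
  shows "cscale 2 (a - c) + cscale (-2*\<i>) (d + b) = 0"
proof (rule cmat_eqI)
  fix i j
  have "a - cscale \<i> b = c + cscale \<i> d"
    using assms by (simp only: cscale_cancel) simp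
  then have "(a - cscale \<i> b) $ i $ j = (c + cscale \<i> d) $ i $ j" by (simp only:)
  then have "a $ i $ j - \<i> * b $ i $ j = c $ i $ j + \<i> * d $ i $ j" by simp
  then show "(cscale 2 (a - c) + cscale (-2*\<i>) (d + b)) $ i $ j = (0 :: 'n cmat) $ i $ j"
    by (simp add: algebra_simps)
qed

text \<open>\<open>hol\<close> is the adjoint of \<open>d_zbar P z ** P z = 0\<close>, and that says
  that the zbar-derivative of a section of the image of \<open>P\<close> is again a section: the
  image is a holomorphic subbundle. Then \<open>d_z P\<close> maps the image into its complement and
  kills the complement, which is what the product rules below express.\<close>

locale holo_proj =
  fixes P :: "complex \<Rightarrow> 'n::finite cmat"
  assumes smooth_P [smooth_intros]: "smooth P"
    and herm: "ctranspose (P z) = P z"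
    and idem: "P z ** P z = P z"
    and hol: "P z ** d_z P z = 0"
begin

lemma d_zbar_eq: "d_zbar P z = ctranspose (d_z P z)"
proof -
  have "d_zbar (\<lambda>z. ctranspose (P z)) z = ctranspose (d_z P z)"
    by (simp add: wirtinger_rules smooth_P)
  then show ?thesis by (simp add: herm)
qed

lemma ctranspose_d_z: "ctranspose (d_z P z) = d_zbar P z"
  and ctranspose_d_zbar: "ctranspose (d_zbar P z) = d_z P z"
  by (simp_all add: d_zbar_eq)

lemma hol': "d_zbar P z ** P z = 0"
  using arg_cong[OF hol[of z], of ctranspose] by (simp add: herm ctranspose_d_z)

lemma d_z_mult_P: "d_z P z ** P z = d_z P z"
proof -
  have "d_z P z = d_z (\<lambda>z. P z ** P z) z" by (simp only: idem)
  also have "\<dots> = d_z P z ** P z" by (simp add: wirtinger_rules smooth_P hol)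
  finally show ?thesis by (rule sym)
qed

lemma P_mult_d_zbar: "P z ** d_zbar P z = d_zbar P z"
  using arg_cong[OF d_z_mult_P[of z], of ctranspose] by (simp add: herm ctranspose_d_z)

lemma d_z_mult_d_z: "d_z P z ** d_z P z = 0"
proof -
  have "d_z P z ** d_z P z = (d_z P z ** P z) ** d_z P z" by (simp only: d_z_mult_P)
  also have "\<dots> = 0" by (simp only: matrix_mul_assoc[symmetric] hol mmult_zero)
  finally show ?thesis .
qed

lemma d_zbar_mult_d_zbar: "d_zbar P z ** d_zbar P z = 0"
proof -
  have "d_zbar P z ** d_zbar P z = d_zbar P z ** (P z ** d_zbar P z)" by (simp only: P_mult_d_zbar)
  also have "\<dots> = 0" by (simp only: matrix_mul_assoc hol' mmult_zero)
  finally show ?thesis .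
qed

lemma partial_P:
  "partial 1 P z = d_z P z + d_zbar P z" "partial 2 P z = cscale \<i> (d_z P z - d_zbar P z)"
  by (rule cmat_eqI; simp add: d_z_def d_zbar_def field_simps)+

definition energy :: "complex \<Rightarrow> real" where
  "energy z = Re (trace (d_z P z ** d_zbar P z))"

lemma of_real_energy: "of_real (energy z) = trace (d_z P z ** d_zbar P z)"
  unfolding energy_def d_zbar_eq trace_mmult_ctranspose by simp

lemma energy_pos: "d_z P z \<noteq> 0 \<Longrightarrow> energy z > 0"
proof -
  assume "d_z P z \<noteq> 0"
  then have "energy z \<noteq> 0"
    using trace_mmult_ctranspose_eq_0[of "d_z P z"] of_real_energy[of z] by (auto simp: d_zbar_eq)
  moreover have "energy z \<ge> 0"
    unfolding energy_def d_zbar_eq trace_mmult_ctranspose by (simp add: sum_nonneg)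
  ultimately show ?thesis by simp
qed

lemma smooth_energy [smooth_intros]: "smooth energy"
  unfolding energy_def[abs_def] by (intro smooth_intros smooth_P)

definition reflection :: "complex \<Rightarrow> 'n cmat" where
  "reflection z = cscale 2 (P z) - mat 1"

lemma smooth_reflection: "smooth reflection"
  unfolding reflection_def[abs_def] by (intro smooth_intros smooth_P)

lemma reflection_square: "reflection z ** reflection z = mat 1"
  unfolding reflection_def by (rule cmat_eqI) (simp add: mmult_distrib idem cscale_right_diff)

lemma ctranspose_refl: "ctranspose (reflection z) = reflection z"
  by (simp add: reflection_def herm)

lemma reflection_unitary: "reflection z \<in> unitary_group"
  by (simp add: unitary_group_def ctranspose_refl reflection_square)

lemma d_reflection: "d_z reflection = (\<lambda>z. cscale 2 (d_z P z))" "d_zbar reflection = (\<lambda>z. cscale 2 (d_zbar P z))"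
  unfolding reflection_def[abs_def] by (simp_all add: wirtinger_rules smooth_intros smooth_P)

lemma partial_refl:
  fixes F :: "complex \<Rightarrow> 'n cmat"
  assumes "smooth F"
  shows "partial i (\<lambda>z. Q ** F z) z = (Q :: 'n cmat) ** partial i F z"
  using partial_bounded_linear[OF bounded_bilinear.bounded_linear_right[OF bounded_bilinear_mmult] assms]
  by metis

context
  fixes Q :: "'n cmat" and F
  assumes Q: "Q \<in> unitary_group" and F: "F = (\<lambda>z. Q ** reflection z)"
begin

lemma smooth_F: "smooth F"
  unfolding F by (intro smooth_intros smooth_reflection)

lemma F_unitary: "F z \<in> unitary_group"
  unfolding F by (intro unitary_group_mult Q reflection_unitary)

lemma matrix_inv_F: "matrix_inv (F z) = reflection z ** ctranspose Q"
  by (rule matrix_inv_eqI)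
    (metis unitary_groupD(1)[OF F_unitary] unitary_groupD(2)[OF F_unitary] ctranspose_simps(7) ctranspose_refl F)+

lemma mc_F_gen: "mc F i z = reflection z ** partial i reflection z"
  unfolding mc_def matrix_inv_F unfolding F partial_refl[OF smooth_reflection]
  by (simp add: matrix_mul_assoc unitary_groupD(4)[OF Q])

lemma partial_refl': "partial i reflection z = cscale 2 (partial i P z)"
proof -
  have "partial i (\<lambda>z. mat 1 :: 'n cmat) z = 0" by (simp add: partial_def)
  then show ?thesis
    unfolding reflection_def[abs_def] partial_add(2)[OF smooth_cscale[OF smooth_const smooth_P] smooth_const]
      partial_mult_const(1)[OF smooth_P] by simp
qed

lemma mc_F:
  "mc F 1 = (\<lambda>z. cscale 2 (d_zbar P z - d_z P z))" "mc F 2 = (\<lambda>z. cscale (-2*\<i>) (d_z P z + d_zbar P z))"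
proof -
  \<comment> \<open>The image of \<open>d_z P\<close> lies in the kernel of \<open>P\<close> and
    that of \<open>d_zbar P\<close> in the image of \<open>P\<close>, where the reflection is -1 and
    +1.\<close>
  have 1: "reflection z ** d_z P z = - d_z P z" "reflection z ** d_zbar P z = d_zbar P z" for z
    unfolding reflection_def by (auto intro!: cmat_eqI simp: mmult_distrib hol P_mult_d_zbar)
  have m1: "mc F 1 z = cscale 2 (d_zbar P z - d_z P z)" for z
    unfolding mc_F_gen partial_refl' partial_P by (simp add: mmult_distrib 1)
  have m2: "mc F 2 z = cscale (-2*\<i>) (d_z P z + d_zbar P z)" for z
    unfolding mc_F_gen partial_refl' partial_P
    by (simp add: mmult_distrib 1) (rule cmat_eqI, simp add: algebra_simps)
  show "mc F 1 = (\<lambda>z. cscale 2 (d_zbar P z - d_z P z))"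
    by (rule ext) (rule m1)
  show "mc F 2 = (\<lambda>z. cscale (-2*\<i>) (d_z P z + d_zbar P z))"
    by (rule ext) (rule m2)
qed

lemma harmonic_F: "(\<Sum>i\<in>UNIV. cov_deriv F i (mc F i) z) = 0"
proof -
  note sm = smooth_P smooth_wirtinger(1,2)[OF smooth_P]
  \<comment> \<open>The bracket in the connection is the commutator of \<open>mc F i\<close> with
    itself.\<close>
  have c: "cov_deriv F i (mc F i) z = partial i (mc F i) z" for i
    by (simp add: cov_deriv_def)
  have "d_z (d_zbar P) z = d_zbar (d_z P) z"
    using wirtinger_commute(1)[OF smooth_P] by simp
  then have "cscale 2 (partial 1 (d_zbar P) z - partial 1 (d_z P) z)
      + cscale (-2*\<i>) (partial 2 (d_z P) z + partial 2 (d_zbar P) z) = 0"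
    unfolding d_z_def[of "d_zbar P"] d_zbar_def[of "d_z P"] by (rule partials_of_mixed_wirtinger_eq)
  moreover have "partial 1 (mc F 1) z = cscale 2 (partial 1 (d_zbar P) z - partial 1 (d_z P) z)"
    unfolding mc_F partial_mult_const(1)[OF smooth_diff[OF sm(3,2)]] partial_add(2)[OF sm(3,2)] ..
  moreover have "partial 2 (mc F 2) z = cscale (-2*\<i>) (partial 2 (d_z P) z + partial 2 (d_zbar P) z)"
    unfolding mc_F partial_mult_const(1)[OF smooth_add[OF sm(2,3)]] partial_add(1)[OF sm(2,3)] ..
  ultimately show ?thesis
    unfolding sum_2 c by (simp only:)
qed

lemma trace_P_products:
  "trace (d_zbar P z ** d_z P z) = of_real (energy z)" "trace (d_z P z ** d_zbar P z) = of_real (energy z)"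
  by (simp_all only: of_real_energy trace_mul_sym[of "d_zbar P z"])

text \<open>The metric is conformal because \<open>d_z P\<close> and \<open>d_zbar P\<close> square
  to zero and their two mixed products have equal traces. The factor 1/8 in \<open>h_metric\<close>
  is absorbed exactly: two factors 2 from \<open>mc_F\<close> and two equal traces.\<close>

lemma induced_metric_F: "induced_metric F z = mat (energy z)"
proof -
  have "h_metric (mc F i z) (mc F j z) = (if i = j then energy z else 0)" for i j
    using exhaust_2[of i] exhaust_2[of j]
    by (elim disjE; simp only:)
      (simp_all add: mc_F h_metric_def ctranspose_d_z ctranspose_d_zbar mmult_distrib d_z_mult_d_z
        d_zbar_mult_d_zbar trace_P_products trace_add trace_sub)
  then show ?thesis by (simp add: induced_metric_def mat_def)
qed

text \<open>For a conformal metric the trace of the second fundamental form is 1/E times the flat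
  sum in \<open>harmonic_F\<close>, so minimality reduces to harmonicity.\<close>

lemma zero_mean_curvature_F:
  assumes "d_z P z \<noteq> 0"
  shows "zero_mean_curvature F z"
proof -
  define E where "E = energy z"
  have E: "E > 0" using energy_pos[OF assms] by (simp add: E_def)
  have inv: "matrix_inv (mat E :: real^2^2) = mat (1 / E)"
    by (rule matrix_inv_eqI) (use E in \<open>simp_all add: vec_eq_iff matrix_matrix_mult_def mat_nth2 sum_2 forall_2\<close>)
  have "(\<Sum>i\<in>UNIV. \<Sum>j\<in>UNIV. matrix_inv (induced_metric F z) $ i $ j *\<^sub>R cov_deriv F i (mc F j) z)
      = (1 / E) *\<^sub>R (\<Sum>i\<in>UNIV. cov_deriv F i (mc F i) z)"
    unfolding induced_metric_F E_def[symmetric] inv sum_2 mat_nth2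
    by (simp add: scaleR_right_distrib)
  also have "\<dots> = 0" by (simp only: harmonic_F scaleR_zero_right)
  finally show ?thesis
    unfolding zero_mean_curvature_def by (simp only: h_metric_def mmult_zero trace_zero) simp
qed

lemma frechet_derivative_F: "frechet_derivative F (at z) h =
   Q ** cscale 2 (cscale h (d_z P z) + cscale (cnj h) (d_zbar P z))"
proof -
  have "(reflection has_derivative (\<lambda>h. cscale h (d_z reflection z) + cscale (cnj h) (d_zbar reflection z))) (at z)"
    by (rule has_derivative_wirtinger[OF smooth_reflection])
  from bounded_linear.has_derivative[OF bounded_bilinear.bounded_linear_right[OF bounded_bilinear_mmult[where 'n='n], of Q] this]
  have "frechet_derivative F (at z) = (\<lambda>h. Q ** (cscale h (d_z reflection z) + cscale (cnj h) (d_zbar reflection z)))"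
    unfolding F[symmetric] by (rule frechet_derivative_at[symmetric])
  then have "frechet_derivative F (at z) h = Q ** (cscale h (d_z reflection z) + cscale (cnj h) (d_zbar reflection z))"
    by (rule fun_cong)
  also have "\<dots> = Q ** cscale 2 (cscale h (d_z P z) + cscale (cnj h) (d_zbar P z))"
    by (simp only: d_reflection cscale_right_distrib cscale_simps(1) mult.commute)
  finally show ?thesis .
qed

lemma inj_derivative_F: "inj (frechet_derivative F (at z)) \<longleftrightarrow> d_z P z \<noteq> 0"
proof
  assume inj: "inj (frechet_derivative F (at z))"
  show "d_z P z \<noteq> 0"
  proof
    assume "d_z P z = 0"
    then have "frechet_derivative F (at z) 1 = frechet_derivative F (at z) 0"
      unfolding frechet_derivative_F d_zbar_eq by simp
    from injD[OF inj this] show False by simp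
  qed
next
  assume nz: "d_z P z \<noteq> 0"
  have lin: "linear (frechet_derivative F (at z))"
    by (rule linear_frechet_derivative[OF smooth_imp_differentiable[OF smooth_F]])
  show "inj (frechet_derivative F (at z))"
    unfolding linear_injective_0[OF lin] frechet_derivative_F
  proof (intro allI impI)
    fix h assume *: "Q ** cscale 2 (cscale h (d_z P z) + cscale (cnj h) (d_zbar P z)) = 0"
    have "(ctranspose Q ** Q) ** cscale 2 (cscale h (d_z P z) + cscale (cnj h) (d_zbar P z)) = 0"
      unfolding matrix_mul_assoc[symmetric] * by (rule mmult_zero)
    then have "cscale h (d_z P z) + cscale (cnj h) (d_zbar P z) = 0"
      by (simp only: unitary_groupD(2)[OF Q] matrix_mul_lid cscale_eq_0_iff) simp
    \<comment> \<open>Multiplying by \<open>P\<close> from the right keeps the \<open>d_z P\<close>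
      term and kills the \<open>d_zbar P\<close> term, which isolates \<open>h\<close>.\<close>
    then have "(cscale h (d_z P z) + cscale (cnj h) (d_zbar P z)) ** P z = 0"
      by (simp only: mmult_zero)
    then have "cscale h (d_z P z) = 0"
      by (simp only: mmult_distrib cscale_simps d_z_mult_P hol' add_0_right)
    then show "h = 0" using nz by simp
  qed
qed

end

end

text \<open>The formula K = -(Laplacian of log E) / (2 E), multiplied by 2 E^3 so that neither
  logarithm nor quotient remains.\<close>

lemma gauss_curvature_conformal:
  fixes E :: "complex \<Rightarrow> real"
  assumes E: "smooth E" and pos: "\<And>z. E z > 0"
  shows "2 * E z ^ 3 * gauss_curvature (\<lambda>z. mat (E z)) z =
    (partial 1 E z)\<^sup>2 + (partial 2 E z)\<^sup>2 - E z * (partial 1 (partial 1 E) z + partial 2 (partial 2 E) z)"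
proof -
  have ne: "E z \<noteq> 0" for z using pos[of z] by simp
  have inv: "matrix_inv (mat (E z) :: real^2^2) = mat (1 / E z)" for z
    by (rule matrix_inv_eqI) (use ne in \<open>simp_all add: vec_eq_iff matrix_matrix_mult_def mat_nth2 sum_2 forall_2\<close>)
  have p0: "partial i (\<lambda>z. 0 :: real) z = 0" for i z by (simp add: partial_def)
  have g: "(\<lambda>z. mat (E z) $ i $ j) = (if i = j then E else (\<lambda>z. 0))" for i j :: 2
    by (auto simp: mat_def)
  have [simp]: "(1::2) \<noteq> 2" "(2::2) \<noteq> 1" by auto
  \<comment> \<open>Exactly the symbols that enter \<open>riemann\<close> with indices 1 1 2 2; the
    component with upper index 2 drops from the curvature because the metric is diagonal.\<close>
  have ch: "christoffel (\<lambda>z. mat (E z)) 1 1 1 = (\<lambda>z. (1/2) * (inverse (E z) * partial 1 E z))"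
    "christoffel (\<lambda>z. mat (E z)) 1 1 2 = (\<lambda>z. (1/2) * (inverse (E z) * partial 2 E z))"
    "christoffel (\<lambda>z. mat (E z)) 1 2 1 = (\<lambda>z. (1/2) * (inverse (E z) * partial 2 E z))"
    "christoffel (\<lambda>z. mat (E z)) 1 2 2 = (\<lambda>z. (-1/2) * (inverse (E z) * partial 1 E z))"
    "christoffel (\<lambda>z. mat (E z)) 2 1 2 = (\<lambda>z. (1/2) * (inverse (E z) * partial 1 E z))"
    "christoffel (\<lambda>z. mat (E z)) 2 2 2 = (\<lambda>z. (1/2) * (inverse (E z) * partial 2 E z))"
    unfolding christoffel_def[abs_def] inv g sum_2
    by (auto simp: fun_eq_iff p0 mat_def field_simps)
  have dq: "partial i (\<lambda>z. c * (inverse (E z) * partial j E z)) z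
      = c * (partial i (partial j E) z / E z - partial i E z * partial j E z / (E z)\<^sup>2)" for i j z c
  proof -
    have "((\<lambda>z. c * (inverse (E z) * partial j E z)) has_derivative (\<lambda>h. c * (inverse (E z) *
        frechet_derivative (partial j E) (at z) h +
        - (inverse (E z) * frechet_derivative E (at z) h * inverse (E z)) * partial j E z))) (at z)"
      by (intro has_derivative_mult_right has_derivative_mult Deriv.has_derivative_inverse ne
          smooth_has_derivative E smooth_partial)
    from partial_eqI[OF this, of i] show ?thesis
      using ne[of z] by (simp add: partial_def[of i] divide_inverse power2_eq_square algebra_simps)
  qed
  have "riemann (\<lambda>z. mat (E z)) 1 1 2 2 z = - (1/2) * (partial 1 (partial 1 E) z / E z - (partial 1 E z)\<^sup>2 / (E z)\<^sup>2)
      - (1/2) * (partial 2 (partial 2 E) z / E z - (partial 2 E z)\<^sup>2 / (E z)\<^sup>2)"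
    unfolding riemann_def sum_2 ch dq by (simp add: power2_eq_square algebra_simps)
  then have "2 * (E z)\<^sup>2 * riemann (\<lambda>z. mat (E z)) 1 1 2 2 z = 2 * (E z)\<^sup>2 *
      (- (1/2) * (partial 1 (partial 1 E) z / E z - (partial 1 E z)\<^sup>2 / (E z)\<^sup>2)
      - (1/2) * (partial 2 (partial 2 E) z / E z - (partial 2 E z)\<^sup>2 / (E z)\<^sup>2))"
    by (simp only:)
  also have "\<dots> = (partial 1 E z)\<^sup>2 + (partial 2 E z)\<^sup>2
      - E z * (partial 1 (partial 1 E) z + partial 2 (partial 2 E) z)"
    using ne[of z] by (simp add: field_simps power2_eq_square)
  finally have "2 * (E z)\<^sup>2 * riemann (\<lambda>z. mat (E z)) 1 1 2 2 z = (partial 1 E z)\<^sup>2 + (partial 2 E z)\<^sup>2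
      - E z * (partial 1 (partial 1 E) z + partial 2 (partial 2 E) z)" .
  moreover have "riemann (\<lambda>z. mat (E z)) 1 1 2 2 z = E z * gauss_curvature (\<lambda>z. mat (E z)) z"
    unfolding gauss_curvature_def sum_2 using ne[of z] by (simp add: mat_def det_2)
  moreover have "2 * E z ^ 3 * G = 2 * (E z)\<^sup>2 * (E z * G)" for G
    by (simp add: power2_eq_square power3_eq_cube)
  ultimately show ?thesis by metis
qed

text \<open>The Laplacian is 4 times the mixed Wirtinger derivative, so the right side is minus that
  of \<open>gauss_curvature_conformal\<close>; together they give the assumption
  \<open>curvature\<close> of the rank-one locale.\<close>

lemma laplace_of_real:
  fixes E :: "complex \<Rightarrow> real" and e
  assumes E: "smooth E" and e_def: "e = (\<lambda>z. complex_of_real (E z))"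
  shows "4 * (e z * dzb (dz e) z - dz e z * dzb e z) = 
    of_real (E z * (partial 1 (partial 1 E) z + partial 2 (partial 2 E) z) - ((partial 1 E z)\<^sup>2 + (partial 2 E z)\<^sup>2))"
proof -
  have pe: "partial i (\<lambda>z. complex_of_real (f z)) = (\<lambda>z. of_real (partial i f z))" if "smooth f" for f i
    by (rule partial_bounded_linear[OF bounded_linear_of_real that])
  have "dz e = (\<lambda>z. (1/2) * (of_real (partial 1 E z) - \<i> * of_real (partial 2 E z)))"
    "dzb e = (\<lambda>z. (1/2) * (of_real (partial 1 E z) + \<i> * of_real (partial 2 E z)))"
    unfolding e_def by (auto simp: dz_def dzb_def pe E)
  note de = this
  note sm = smooth_of_real[OF smooth_partial[OF E], where 'b=complex]
  have "dzb (dz e) z = (of_real (partial 1 (partial 1 E) z + partial 2 (partial 2 E) z)) / 4"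
    unfolding dzb_def[of "dz e"] unfolding de
      partial_mult_const(2)[OF smooth_diff[OF sm smooth_mult[OF smooth_const sm]]]
      partial_add(2)[OF sm smooth_mult[OF smooth_const sm]] partial_mult_const(2)[OF sm]
      pe[OF smooth_partial[OF E]] partial_commute_real[OF E]
    by (simp add: algebra_simps)
  then show ?thesis unfolding de unfolding e_def
    by (simp add: power2_eq_square algebra_simps)
qed

section \<open>Frenet equations in rank one\<close>

text \<open>Turns a product identity into a rewrite rule inside right-nested products, so that
  \<open>simp\<close> can normalise words in \<open>P\<close>, \<open>A\<close>, \<open>Ab\<close>,
  \<open>B\<close>, \<open>Bs\<close> by a multiplication table.\<close>

lemma mmult_eq_assoc: "X ** Y = Z \<Longrightarrow> X ** (Y ** W) = Z ** (W :: 'n::finite cmat)"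
  by (simp only: matrix_mul_assoc)

section \<open>Rank-one matrices and traces of orthogonal projections\<close>

definition outer :: "complex^'n::finite \<Rightarrow> complex^'n \<Rightarrow> 'n cmat" where
  "outer x y = (\<chi> i j. x $ i * cnj (y $ j))"

lemma outer_nth [simp]: "outer x y $ i $ j = x $ i * cnj (y $ j)"
  by (simp add: outer_def)

lemma mmult_outer: "X ** outer x y = outer (X *v x) y"
  by (rule cmat_eqI) (simp add: mmult_nth matrix_vector_mult_def sum_distrib_right mult.assoc)

lemma ctranspose_outer: "ctranspose (outer x y) = outer y x"
  by (rule cmat_eqI) (simp add: mult.commute)

lemma outer_mmult: "outer x y ** X = outer x (ctranspose X *v y)"
  by (rule cmat_eqI) (simp add: mmult_nth matrix_vector_mult_def sum_distrib_left sum_distrib_right mult_ac)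

lemma outer_outer: "outer a b ** outer c d = cscale (hinner c b) (outer a d)"
  by (rule cmat_eqI) (simp add: mmult_nth hinner_def sum_distrib_left sum_distrib_right mult_ac)

lemma trace_outer: "trace (outer x y) = hinner x y"
  by (simp add: trace_def hinner_def)

lemma outer_congruence: "outer (U *v x) (U *v y) = U ** outer x y ** ctranspose U"
  by (simp add: mmult_outer outer_mmult)

lemma outer_vector_scalar: "outer (c *s x) (d *s y) = cscale (c * cnj d) (outer x y)"
  by (rule cmat_eqI) (simp add: mult_ac)

definition orth_projection :: "'n::finite cmat \<Rightarrow> bool" where
  "orth_projection P \<longleftrightarrow> ctranspose P = P \<and> P ** P = P"

lemma orth_projection_trace_eq_0:
  assumes "orth_projection P" "trace P = 0" shows "P = 0"
  using assms trace_mmult_ctranspose_eq_0[of P] by (simp add: orth_projection_def)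

lemma orth_projection_complement: "orth_projection P \<Longrightarrow> orth_projection (mat 1 - P)"
  by (simp add: orth_projection_def mmult_distrib)

lemma orth_projection_diff:
  assumes "orth_projection P" "orth_projection Q" "P ** Q = Q"
  shows "orth_projection (P - Q)"
proof -
  have "Q ** P = Q"
    using arg_cong[OF assms(3), of ctranspose] assms(1,2) by (simp add: orth_projection_def)
  then show ?thesis using assms by (simp add: orth_projection_def mmult_distrib)
qed

lemma orth_projection_outer: "hinner v v = 1 \<Longrightarrow> orth_projection (outer v v)"
  by (simp add: orth_projection_def ctranspose_outer outer_outer)

text \<open>A nonzero column of \<open>P\<close>, scaled to length one, is a unit vector in the
  image. By symmetry and idempotence the diagonal entry in that column is its squared length, so it
  suffices to find a nonzero diagonal entry; one exists because a projection of trace 0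
  vanishes.\<close>

lemma orth_projection_split:
  assumes P: "orth_projection P" and "P \<noteq> 0"
  obtains v where "hinner v v = 1" "P ** outer v v = outer v v" "orth_projection (P - outer v v)"
proof -
  have herm: "cnj (P $ i $ j) = P $ j $ i" for i j
    using P unfolding orth_projection_def vec_eq_iff by (metis ctranspose_nth)
  have idem: "(\<Sum>k\<in>UNIV. P $ i $ k * P $ k $ j) = P $ i $ j" for i j
    using P unfolding orth_projection_def mmult_nth[symmetric] by simp
  obtain j where j: "P $ j $ j \<noteq> 0"
    using orth_projection_trace_eq_0[OF P] \<open>P \<noteq> 0\<close> sum.neutral[of UNIV "\<lambda>i. P $ i $ i"]
    unfolding trace_def by blast
  define p where "p = (\<Sum>k\<in>UNIV. (norm (P $ k $ j))\<^sup>2)"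
  have pjj: "P $ j $ j = of_real p"
    unfolding idem[of j j, symmetric] p_def of_real_sum complex_norm_square herm by (simp only: mult.commute)
  have "p \<ge> 0" by (simp add: p_def sum_nonneg)
  with j pjj have p: "p > 0" by (cases "p = 0") auto
  define v where "v = (\<chi> i. P $ i $ j / of_real (sqrt p))"
  have sq: "complex_of_real (sqrt p) * of_real (sqrt p) = of_real p"
    using p by (simp flip: of_real_mult)
  have "hinner v v = (\<Sum>i\<in>UNIV. P $ i $ j * cnj (P $ i $ j)) / of_real p"
    by (simp add: hinner_def v_def sum_divide_distrib sq)
  also have "(\<Sum>i\<in>UNIV. P $ i $ j * cnj (P $ i $ j)) = of_real p"
    by (simp only: p_def of_real_sum complex_norm_square)
  finally have v: "hinner v v = 1" using p by simp
  have "P *v v = v"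
    by (simp add: vec_eq_iff matrix_vector_mult_def v_def idem flip: sum_divide_distrib)
  then have Pv: "P ** outer v v = outer v v" by (simp add: mmult_outer)
  show ?thesis
    by (rule that[OF v Pv orth_projection_diff[OF P orth_projection_outer[OF v] Pv]])
qed

lemma orth_projection_trace_1:
  assumes P: "orth_projection P" and tr: "trace P = 1"
  obtains v where "hinner v v = 1" "P = outer v v"
proof -
  have "P \<noteq> 0" using tr by auto
  from orth_projection_split[OF P this] obtain v
    where v: "hinner v v = 1" "P ** outer v v = outer v v" "orth_projection (P - outer v v)" .
  have "P - outer v v = 0"
    by (rule orth_projection_trace_eq_0[OF v(3)]) (simp add: trace_sub tr trace_outer v(1))
  with v show ?thesis by (intro that[of v]) simp_all
qed

lemma orth_projection_trace_ge_1:
  fixes P :: "'n::finite cmat"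
  assumes P: "orth_projection P" and "P \<noteq> 0"
  obtains Q :: "'n cmat" where "orth_projection Q" "trace Q = trace P - 1"
proof -
  obtain v where v: "hinner v v = 1" "orth_projection (P - outer v v)"
    using orth_projection_split[OF assms] .
  then show ?thesis by (intro that[OF v(2)]) (simp add: trace_sub trace_outer)
qed

lemma orth_projection_trace_nonneg: "orth_projection P \<Longrightarrow> Re (trace P) \<ge> 0"
  using trace_mmult_ctranspose[of P] by (simp add: orth_projection_def sum_nonneg)

text \<open>Traces of projections are ranks: splitting off a unit vector lowers the trace by 1, and
  this must end because such traces are nonnegative.\<close>

lemma orth_projection_trace_nat:
  fixes P :: "'n::finite cmat"
  assumes "orth_projection P" "Re (trace P) < real n"
  shows "\<exists>k<n. trace P = of_nat k"
  using assms
proof (induction n arbitrary: P)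
  case 0
  then show ?case using orth_projection_trace_nonneg[of P] by simp
next
  case (Suc n)
  show ?case
  proof (cases "P = 0")
    case False
    obtain Q :: "'n cmat" where Q: "orth_projection Q" "trace Q = trace P - 1"
      by (rule orth_projection_trace_ge_1[OF Suc.prems(1) False]) blast
    then obtain k where "k < n" "trace Q = of_nat k"
      using Suc.IH[of Q] Suc.prems(2) by auto
    with Q(2) show ?thesis by (intro exI[of _ "Suc k"]) (simp add: algebra_simps)
  qed (auto intro: exI[of _ 0])
qed

text \<open>Every endomorphism of a line is a scalar. This is how scalar functions are extracted
  from matrix identities in the Frenet computations.\<close>

lemma rank_one_compress:
  assumes "orth_projection P" "trace P = 1"
  shows "P ** X ** P = cscale (trace (X ** P)) P"
proof -
  obtain v where v: "hinner v v = 1" "P = outer v v" using orth_projection_trace_1[OF assms] .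
  have "P ** X ** P = outer v v ** outer (X *v v) v"
    by (simp only: v(2) matrix_mul_assoc[symmetric] mmult_outer[of X])
  also have "\<dots> = cscale (hinner (X *v v) v) (outer v v)" by (rule outer_outer)
  also have "hinner (X *v v) v = trace (X ** P)" by (simp only: v(2) mmult_outer trace_outer)
  finally show ?thesis by (simp only: v(2))
qed

text \<open>\<open>curvature\<close> is the Liouville equation (log e)_{z zbar} = -(K/2) e
  multiplied by e^2; \<open>nondeg\<close> is the immersion condition of
  \<open>inj_derivative_F\<close>.\<close>

locale rank_one_holo_proj = holo_proj P for P :: "complex \<Rightarrow> 3 cmat" +
  fixes K :: real
  assumes rank_one: "trace (P z) = 1"
    and nondeg: "d_z P z \<noteq> 0"
    and curvature: "of_real (energy z) * dzb (dz (\<lambda>z. of_real (energy z))) z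
      - dz (\<lambda>z. of_real (energy z)) z * dzb (\<lambda>z. of_real (energy z)) z
      = - of_real (K / 2) * of_real (energy z) ^ 3"
begin

text \<open>\<open>B\<close> is the component of \<open>P\<^sub>z\<^sub>z\<close> that maps the line of \<open>P\<close> to the third line of the Frenet frame
  \<open>P, e\<^sup>-\<^sup>1 P\<^sub>z P\<^sub>z\<^sup>*, (c e\<^sup>2)\<^sup>-\<^sup>1 B B\<^sup>*\<close>, and \<open>c\<close> is the ratio of the second to the first Frenet density.\<close>

definition e :: "complex \<Rightarrow> complex" where "e z = of_real (energy z)"
definition A where "A = d_z P"
definition Ab where "Ab = d_zbar P"
definition lam where "lam z = dz e z / e z"
definition B where "B z = d_z A z - cscale (lam z) (A z)"
definition Bs where "Bs z = ctranspose (B z)"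
definition c :: complex where "c = of_real (2 - K / 2)"

lemma e_nonzero [simp]: "e z \<noteq> 0"
  using energy_pos[OF nondeg, of z] by (simp add: e_def)

lemma cnj_e [simp]: "cnj (e z) = e z"
  by (simp add: e_def)

lemma cnj_c [simp]: "cnj c = c"
  by (simp add: c_def)

lemma orth_P: "orth_projection (P z)"
  by (simp add: orth_projection_def herm idem)

lemma sm_e [smooth_intros]: "smooth e"
  unfolding e_def[abs_def] by (intro smooth_intros)

lemma sm_A [smooth_intros]: "smooth A" and sm_Ab [smooth_intros]: "smooth Ab"
  unfolding A_def Ab_def by (intro smooth_intros smooth_P)+

lemma lam_alt: "lam z = of_real (inverse (energy z)) * dz e z"
  by (simp add: lam_def e_def field_simps)

lemma sm_lam [smooth_intros]: "smooth lam"
  unfolding lam_alt[abs_def]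
  by (intro smooth_intros) (metis energy_pos nondeg less_irrefl)

lemma sm_B [smooth_intros]: "smooth B"
  unfolding B_def[abs_def] by (intro smooth_intros)

lemma ct: "ctranspose (A z) = Ab z" "ctranspose (Ab z) = A z" "ctranspose (B z) = Bs z" "ctranspose (Bs z) = B z"
  by (simp_all add: A_def Ab_def Bs_def d_zbar_eq)

lemma d_z_Ab: "d_z Ab = d_zbar A"
  unfolding Ab_def A_def by (rule wirtinger_commute(1)[OF smooth_P])

lemma d_z_P: "d_z P = A" and d_zbar_P: "d_zbar P = Ab"
  by (simp_all add: A_def Ab_def)

lemma AP_products: "P z ** P z = P z" "P z ** A z = 0" "A z ** P z = A z" "Ab z ** P z = 0" "P z ** Ab z = Ab z"
  "A z ** A z = 0" "Ab z ** Ab z = 0"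
  unfolding A_def Ab_def
  by (rule idem hol d_z_mult_P hol' P_mult_d_zbar d_z_mult_d_z d_zbar_mult_d_zbar)+

lemma e_trace: "trace (A z ** Ab z) = e z" "trace (Ab z ** A z) = e z"
  unfolding e_def A_def Ab_def of_real_energy by (rule refl, rule trace_mul_sym)

lemma Ab_A: "Ab z ** A z = cscale (e z) (P z)"
proof -
  have "Ab z ** A z = P z ** (Ab z ** A z) ** P z"
    by (simp only: AP_products matrix_mul_assoc[symmetric] mmult_eq_assoc[OF AP_products(5)])
  also have "\<dots> = cscale (trace (Ab z ** A z ** P z)) (P z)"
    by (rule rank_one_compress[OF orth_P rank_one])
  also have "Ab z ** A z ** P z = Ab z ** A z"
    by (simp only: AP_products matrix_mul_assoc[symmetric])
  finally show ?thesis by (simp only: e_trace)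
qed

lemmas AP_assoc = AP_products[THEN mmult_eq_assoc] Ab_A[THEN mmult_eq_assoc]
lemmas AP_simps = AP_products Ab_A AP_assoc matrix_mul_assoc[symmetric] mmult_zero cscale_simps(1-7)
  mmult_distrib mmult_minus

text \<open>\<open>d_zbar A\<close> is the Hermitian matrix of mixed derivatives of
  \<open>P\<close>. Differentiating \<open>A P = A\<close> leaves \<open>d_zbar A P + A Ab\<close>,
  and differentiating \<open>P A = 0\<close> determines the first summand after taking
  adjoints.\<close>

lemma d_zbar_A: "d_zbar A z = A z ** Ab z - Ab z ** A z"
proof -
  have "d_zbar (\<lambda>z. P z ** A z) z = 0"
    by (simp only: AP_products wirtinger_const)
  then have 1: "Ab z ** A z + P z ** d_zbar A z = 0"
    by (simp only: wirtinger_mmult smooth_P sm_A d_zbar_P)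
  have herm2: "ctranspose (d_zbar A z) = d_zbar A z"
  proof -
    have "ctranspose (d_zbar A z) = d_z (\<lambda>z. ctranspose (A z)) z"
      by (simp only: wirtinger_linear sm_A)
    then show ?thesis by (simp only: ct d_z_Ab)
  qed
  have "ctranspose (Ab z ** A z + P z ** d_zbar A z) = 0" by (simp only: 1 ctranspose_simps)
  then have 2: "d_zbar A z ** P z = - (Ab z ** A z)"
    by (simp only: ctranspose_simps ct herm herm2 eq_neg_iff_add_eq_0 add.commute)
  have "d_zbar A z = d_zbar (\<lambda>z. A z ** P z) z" by (simp only: AP_products)
  also have "\<dots> = d_zbar A z ** P z + A z ** Ab z"
    by (simp only: wirtinger_mmult smooth_P sm_A d_zbar_P)
  finally show ?thesis unfolding 2 by simp
qed

lemma A2_products: "P z ** d_z A z = 0" "d_z A z ** P z = d_z A z" "d_z A z ** A z = 0" "A z ** d_z A z = 0"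
proof -
  have "d_z (\<lambda>z. P z ** A z) z = 0"
    by (simp only: AP_products wirtinger_const)
  then have "A z ** A z + P z ** d_z A z = 0"
    by (simp only: wirtinger_mmult smooth_P sm_A d_z_P)
  then show 1: "P z ** d_z A z = 0"
    by (simp only: AP_products add_0_left)
  have "d_z A z = d_z (\<lambda>z. A z ** P z) z" by (simp only: AP_products)
  also have "\<dots> = d_z A z ** P z + A z ** A z"
    by (simp only: wirtinger_mmult smooth_P sm_A d_z_P)
  also have "\<dots> = d_z A z ** P z" by (simp only: AP_products add_0_right)
  finally show 2: "d_z A z ** P z = d_z A z" by (rule sym)
  have "d_z A z ** A z = (d_z A z ** P z) ** A z" by (simp only: 2)
  then show "d_z A z ** A z = 0" by (simp only: AP_simps)
  have "A z ** d_z A z = (A z ** P z) ** d_z A z" by (simp only: AP_products)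
  then show "A z ** d_z A z = 0" by (simp only: matrix_mul_assoc[symmetric] 1 mmult_zero)
qed

lemma trace_A: "trace (A z) = 0"
proof -
  have "trace (A z) = trace (A z ** P z)" by (simp only: AP_products)
  also have "\<dots> = trace (P z ** A z)" by (rule trace_mul_sym)
  finally show ?thesis by (simp only: AP_products trace_zero)
qed

text \<open>The left side maps the line of \<open>P\<close> to itself, so only its trace matters.
  That is \<open>dz e\<close>, by differentiating e = trace (Ab A): the other term is e A, which is
  traceless.\<close>

lemma Ab_A2: "Ab z ** d_z A z = cscale (dz e z) (P z)"
proof -
  have "dz e z = dz (\<lambda>z. trace (Ab z ** A z)) z" by (simp only: e_trace)
  also have "\<dots> = trace (d_z Ab z ** A z + Ab z ** d_z A z)"
    by (simp only: wirtinger_linear wirtinger_mmult sm_A sm_Ab smooth_mmult)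
  also have "d_z Ab z ** A z = cscale (e z) (A z)"
    by (simp only: d_z_Ab d_zbar_A AP_simps diff_zero)
  also have "trace (cscale (e z) (A z) + Ab z ** d_z A z) = trace (Ab z ** d_z A z)"
    by (simp add: trace_add trace_A)
  finally have *: "trace (Ab z ** d_z A z) = dz e z" by (rule sym)
  have "Ab z ** d_z A z = P z ** (Ab z ** d_z A z) ** P z"
    by (simp only: AP_simps A2_products)
  also have "\<dots> = cscale (trace (Ab z ** d_z A z ** P z)) (P z)"
    by (rule rank_one_compress[OF orth_P rank_one])
  also have "Ab z ** d_z A z ** P z = Ab z ** d_z A z"
    by (simp only: AP_simps A2_products)
  finally show ?thesis by (simp only: *)
qed

lemma lam_e: "lam z * e z = dz e z" "e z * lam z = dz e z"
  by (simp_all add: lam_def)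

text \<open>\<open>lam\<close> is chosen for the third identity: \<open>Ab A = e P\<close> and
  \<open>Ab (d_z A) = dz e P\<close>, so subtracting \<open>dz e / e\<close> times \<open>A\<close>
  makes \<open>B\<close> orthogonal to the second line of the frame as well.\<close>

lemma B_products: "P z ** B z = 0" "B z ** P z = B z" "Ab z ** B z = 0" "B z ** A z = 0" "A z ** B z = 0"
  unfolding B_def by (simp_all only: AP_simps A2_products Ab_A2 lam_e) simp_all

lemma Bs_products: "Bs z ** P z = 0" "P z ** Bs z = Bs z" "Bs z ** A z = 0" "Ab z ** Bs z = 0" "Bs z ** Ab z = 0"
  using B_products[THEN arg_cong[of _ _ ctranspose], of z]
  by (simp_all only: ctranspose_simps ct herm)

lemma d_z_A: "d_z A z = B z + cscale (lam z) (A z)"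
  by (simp add: B_def)

text \<open>\<open>lam\<close> is the logarithmic derivative of \<open>e\<close>, so this is the
  Liouville equation itself.\<close>

lemma dzb_lam: "dzb lam z = - of_real (K / 2) * e z"
proof -
  have "dzb (dz e) z = dzb (\<lambda>z. lam z * e z) z" by (simp only: lam_e)
  also have "\<dots> = dzb lam z * e z + lam z * dzb e z"
    by (simp only: wirtinger_mult sm_lam sm_e)
  finally have "e z * dzb (dz e) z - dz e z * dzb e z = dzb lam z * e z * e z"
    by (simp add: lam_e(1)[symmetric] algebra_simps)
  moreover have "e z * dzb (dz e) z - dz e z * dzb e z = - of_real (K / 2) * e z ^ 3"
    using curvature[of z] unfolding e_def[abs_def] .
  moreover have "x = - k * y" if "x * y * y = - k * y ^ 3" "y \<noteq> 0" for x y k :: complex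
  proof -
    have "(x + k * y) * (y * y) = 0" using that(1) by (simp add: algebra_simps power3_eq_cube)
    then have "x + k * y = 0" using that(2) by simp
    then show ?thesis by (simp add: eq_neg_iff_add_eq_0)
  qed
  ultimately show ?thesis by (metis e_nonzero)
qed

text \<open>Origin of \<open>c\<close>: commuting the derivatives of \<open>A\<close> yields -2 e A,
  one e A from each of the two products of \<open>A\<close> with \<open>d_zbar A\<close>, and
  differentiating \<open>lam\<close> gives back (K/2) e A.\<close>

lemma d_zbar_B: "d_zbar B z = B z ** Ab z - cscale (c * e z) (A z)"
proof -
  have "d_zbar (d_z A) z = d_z (d_zbar A) z"
    by (simp only: wirtinger_commute(1)[OF sm_A])
  also have "d_zbar A = (\<lambda>z. A z ** Ab z - Ab z ** A z)"
    by (rule ext) (rule d_zbar_A)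
  also have "d_z (\<lambda>z. A z ** Ab z - Ab z ** A z) z =
      (d_z A z ** Ab z + A z ** d_zbar A z) - (d_zbar A z ** A z + Ab z ** d_z A z)"
    by (simp only: wirtinger_diff wirtinger_mmult sm_A sm_Ab smooth_mmult d_z_Ab)
  also have "\<dots> = d_z A z ** Ab z - cscale (2 * e z) (A z) - cscale (dz e z) (P z)"
    by (simp only: d_zbar_A AP_simps Ab_A2) (rule cmat_eqI, simp)
  finally have 1: "d_zbar (d_z A) z = d_z A z ** Ab z - cscale (2 * e z) (A z) - cscale (dz e z) (P z)" .
  have "d_zbar B z = d_zbar (d_z A) z - (cscale (dzb lam z) (A z) + cscale (lam z) (d_zbar A z))"
    unfolding B_def[abs_def] by (simp only: wirtinger_diff wirtinger_cscale sm_A smooth_wirtinger sm_lam smooth_cscale)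
  also have "\<dots> = B z ** Ab z - cscale (c * e z) (A z)"
    unfolding 1 d_zbar_A dzb_lam
    by (simp only: d_z_A AP_simps lam_e(1)[symmetric]) (rule cmat_eqI, simp add: c_def algebra_simps)
  finally show ?thesis .
qed

text \<open>Differentiate \<open>Ab B = 0\<close> in zbar. In trace form this is |B|^2 = c e^2, so
  \<open>c = 0\<close> exactly when \<open>B\<close> vanishes.\<close>

lemma Bs_B: "Bs z ** B z = cscale (c * (e z)\<^sup>2) (P z)"
proof -
  have "d_zbar Ab z = d_zbar (\<lambda>z. ctranspose (A z)) z" by (simp only: ct)
  also have "\<dots> = ctranspose (d_z A z)" by (simp only: wirtinger_linear sm_A)
  also have "\<dots> = Bs z + cscale (cnj (lam z)) (Ab z)" by (simp only: d_z_A ctranspose_simps cscale_simps ct)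
  finally have 1: "d_zbar Ab z = Bs z + cscale (cnj (lam z)) (Ab z)" .
  have "d_zbar (\<lambda>z. Ab z ** B z) z = 0"
    by (simp only: B_products wirtinger_const)
  then have "d_zbar Ab z ** B z + Ab z ** d_zbar B z = 0"
    by (simp only: wirtinger_mmult sm_Ab sm_B)
  then have "Bs z ** B z - cscale (c * e z * e z) (P z) = 0"
    unfolding 1 d_zbar_B
    by (simp only: AP_simps B_products B_products(3)[THEN mmult_eq_assoc] add_0_right diff_0 add_uminus_conv_diff)
  then show ?thesis by (simp only: right_minus_eq power2_eq_square mult.assoc)
qed

lemma d_z_B_products: "P z ** d_z B z = 0" "d_z B z ** P z = d_z B z" "Ab z ** d_z B z = 0"
proof -
  have "d_z (\<lambda>z. P z ** B z) z = 0"
    by (simp only: B_products wirtinger_const)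
  then have "A z ** B z + P z ** d_z B z = 0"
    by (simp only: wirtinger_mmult smooth_P sm_B d_z_P)
  then show "P z ** d_z B z = 0"
    by (simp only: B_products add_0_left)
  have "d_z B z = d_z (\<lambda>z. B z ** P z) z" by (simp only: B_products)
  also have "\<dots> = d_z B z ** P z + B z ** A z"
    by (simp only: wirtinger_mmult smooth_P sm_B d_z_P)
  also have "\<dots> = d_z B z ** P z" by (simp only: B_products add_0_right)
  finally show "d_z B z ** P z = d_z B z" by (rule sym)
  have "d_z (\<lambda>z. Ab z ** B z) z = 0"
    by (simp only: B_products wirtinger_const)
  moreover have "d_zbar A z ** B z = 0"
    by (simp only: d_zbar_A AP_simps B_products) simp
  ultimately show "Ab z ** d_z B z = 0"
    by (simp only: wirtinger_mmult sm_Ab sm_B d_z_Ab add_0_left)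
qed

text \<open>Here dimension three enters: three mutually orthogonal projections of trace 1 leave a
  complement that is a projection of trace 0.\<close>

lemma frame_resolution:
  assumes "c \<noteq> 0"
  shows "P z + cscale (1 / e z) (A z ** Ab z) + cscale (1 / (c * (e z)\<^sup>2)) (B z ** Bs z) = mat 1"
proof -
  define P1 where "P1 = cscale (1 / e z) (A z ** Ab z)"
  define P2 where "P2 = cscale (1 / (c * (e z)\<^sup>2)) (B z ** Bs z)"
  note assoc = B_products[THEN mmult_eq_assoc] Bs_products[THEN mmult_eq_assoc] Bs_B[THEN mmult_eq_assoc]
  have prods: "P z ** P1 = 0" "P z ** P2 = 0" "P1 ** P z = 0" "P2 ** P z = 0" "P1 ** P2 = 0" "P2 ** P1 = 0"
    "P1 ** P1 = P1" "P2 ** P2 = P2"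
    unfolding P1_def P2_def using assms
    by (simp_all only: AP_simps B_products Bs_products Bs_B assoc) simp_all
  have "orth_projection (mat 1 - P z - P1 - P2)"
    unfolding orth_projection_def
    by (simp add: mmult_distrib prods idem herm) (simp add: P1_def P2_def ct)
  moreover have "trace (mat 1 - P z - P1 - P2) = 0"
  proof -
    have "trace (B z ** Bs z) = c * (e z)\<^sup>2"
      unfolding trace_mul_sym[of "B z"] Bs_B by (simp add: rank_one)
    then show ?thesis using assms by (simp add: trace_sub trace_I P1_def P2_def e_trace rank_one)
  qed
  ultimately have "mat 1 - P z - P1 - P2 = 0" by (rule orth_projection_trace_eq_0)
  then show ?thesis by (simp add: P1_def P2_def algebra_simps)
qed

text \<open>Nothing lies beyond the third line, so the frame leaves only a multiple of
  \<open>B\<close>. The factor is the logarithmic derivative of |B|^2 = c e^2, hence 2 lam.\<close>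

lemma d_z_B:
  assumes c: "c \<noteq> 0"
  shows "d_z B z = cscale (2 * lam z) (B z)"
proof -
  have "d_z B z = (P z + cscale (1 / e z) (A z ** Ab z) + cscale (1 / (c * (e z)\<^sup>2)) (B z ** Bs z)) ** d_z B z"
    by (simp only: frame_resolution[OF c] matrix_mul_lid)
  also have "\<dots> = cscale (1 / (c * (e z)\<^sup>2)) (B z ** (Bs z ** d_z B z))"
    by (simp only: AP_simps d_z_B_products) simp
  also have "Bs z ** d_z B z = P z ** (Bs z ** d_z B z) ** P z"
    by (simp only: matrix_mul_assoc[symmetric] d_z_B_products Bs_products Bs_products[THEN mmult_eq_assoc])
  also have "\<dots> = cscale (trace (Bs z ** d_z B z ** P z)) (P z)"
    by (rule rank_one_compress[OF orth_P rank_one])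
  also have "Bs z ** d_z B z ** P z = Bs z ** d_z B z"
    by (simp only: matrix_mul_assoc[symmetric] d_z_B_products)
  also have "trace (Bs z ** d_z B z) = 2 * c * e z * dz e z"
  proof -
    have "d_z Bs z = d_z (\<lambda>z. ctranspose (B z)) z" by (simp only: ct)
    also have "\<dots> = ctranspose (d_zbar B z)" by (simp only: wirtinger_linear sm_B)
    also have "\<dots> = A z ** Bs z - cscale (c * e z) (Ab z)"
      by (simp only: d_zbar_B ctranspose_simps cscale_simps ct) simp
    finally have dBs: "d_z Bs z ** B z = cscale (c * (e z)\<^sup>2) (A z)"
      by (simp only: AP_simps B_products Bs_B) simp
    have smBs: "smooth Bs" unfolding Bs_def[abs_def] by (intro smooth_intros)
    have "dz (\<lambda>z. c * (e z * e z)) z = dz (\<lambda>z. trace (Bs z ** B z)) z"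
      by (simp add: Bs_B rank_one power2_eq_square)
    also have "\<dots> = trace (d_z Bs z ** B z + Bs z ** d_z B z)"
      by (simp only: wirtinger_linear wirtinger_mmult smBs sm_B smooth_mmult)
    also have "\<dots> = trace (Bs z ** d_z B z)"
      by (simp add: dBs trace_add trace_A)
    finally show ?thesis
      by (simp add: wirtinger_mult wirtinger_const smooth_const sm_e smooth_mult algebra_simps)
  qed
  finally show ?thesis using c
    by (simp add: B_products lam_def power2_eq_square)
qed

lemma B_nonzero: assumes "c \<noteq> 0" shows "B z \<noteq> 0"
proof
  assume "B z = 0"
  then have "P z = 0" using Bs_B[of z] assms by simp
  then show False using rank_one[of z] by simp
qed

text \<open>If \<open>c = 0\<close>, then K = 4 by definition of \<open>c\<close>, and
  \<open>B\<close> vanishes. Otherwise the mixed second derivatives of \<open>B\<close> agree;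
  comparing the coefficients of \<open>B\<close> gives 1 + c = K, and with c = 2 - K/2 this is K =
  2.\<close>

lemma curvature_cases: "(K = 4 \<and> (\<forall>z. B z = 0)) \<or> (K = 2 \<and> c = 1)"
proof (cases "c = 0")
  case True
  have "B z = 0" for z
  proof -
    have "trace (Bs z ** ctranspose (Bs z)) = 0" by (simp add: ct Bs_B True)
    then show ?thesis unfolding trace_mmult_ctranspose_eq_0 by (simp add: Bs_def)
  qed
  moreover have "K = 4" using True unfolding c_def of_real_eq_0_iff by simp
  ultimately show ?thesis by simp
next
  case False
  \<comment> \<open>One point is enough, since the conclusion concerns constants.\<close>
  let ?z = "0 :: complex"
  have "d_z B = (\<lambda>z. cscale (2 * lam z) (B z))"
    by (rule ext) (rule d_z_B[OF False])
  then have "d_zbar (d_z B) ?z = d_zbar (\<lambda>z. cscale (2 * lam z) (B z)) ?z"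
    by (simp only:)
  also have "\<dots> = cscale (2 * dzb lam ?z) (B ?z) + cscale (2 * lam ?z) (d_zbar B ?z)"
    by (simp add: wirtinger_cscale wirtinger_mult wirtinger_const sm_B sm_lam smooth_mult smooth_const)
  finally have 1: "d_zbar (d_z B) ?z = cscale (2 * dzb lam ?z) (B ?z) + cscale (2 * lam ?z) (d_zbar B ?z)" .
  have "d_zbar B = (\<lambda>z. B z ** Ab z - cscale (c * e z) (A z))"
    by (rule ext) (rule d_zbar_B)
  then have "d_z (d_zbar B) ?z = d_z (\<lambda>z. B z ** Ab z - cscale (c * e z) (A z)) ?z"
    by (simp only:)
  also have "\<dots> = (d_z B ?z ** Ab ?z + B ?z ** d_zbar A ?z) - (cscale (c * dz e ?z) (A ?z) + cscale (c * e ?z) (d_z A ?z))"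
    by (simp add: wirtinger_diff wirtinger_mmult wirtinger_cscale wirtinger_mult wirtinger_const sm_A sm_Ab sm_B sm_e
        smooth_mmult smooth_cscale smooth_mult smooth_const d_z_Ab)
  also have "\<dots> = cscale (2 * lam ?z) (B ?z ** Ab ?z) - cscale ((1 + c) * e ?z) (B ?z) - cscale (2 * c * dz e ?z) (A ?z)"
    by (simp only: d_z_B[OF False] d_zbar_A d_z_A AP_simps B_products B_products[THEN mmult_eq_assoc] lam_e(1)[symmetric])
      (rule cmat_eqI, simp add: algebra_simps)
  finally have "cscale (2 * dzb lam ?z) (B ?z) + cscale (2 * lam ?z) (d_zbar B ?z) =
      cscale (2 * lam ?z) (B ?z ** Ab ?z) - cscale ((1 + c) * e ?z) (B ?z) - cscale (2 * c * dz e ?z) (A ?z)"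
    unfolding wirtinger_commute(1)[OF sm_B] 1 .
  then have "cscale ((1 + c - of_real K) * e ?z) (B ?z) = 0"
    unfolding d_zbar_B dzb_lam lam_e(1)[symmetric] by (simp add: vec_eq_iff algebra_simps)
  then have "1 + c = of_real K" using B_nonzero[OF False] by simp
  then have "Re (1 + c) = K" by simp
  then have "K = 2" by (simp add: c_def)
  then have "K = 2 \<and> c = 1" unfolding c_def by simp
  then show ?thesis ..
qed

end

section \<open>Conformal factors of constant curvature on the sphere\<close>

lemma has_derivative_wirtinger_mult:
  fixes f g :: "complex \<Rightarrow> complex"
  assumes "(f has_derivative (\<lambda>h. h * a + cnj h * b)) (at z)" "(g has_derivative (\<lambda>h. h * c + cnj h * d)) (at z)"
  shows "((\<lambda>z. f z * g z) has_derivative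
    (\<lambda>h. h * (a * g z + f z * c) + cnj h * (b * g z + f z * d))) (at z)"
  by (rule has_derivative_eq_rhs[OF has_derivative_mult[OF assms]]) (simp add: fun_eq_iff algebra_simps)

lemma has_derivative_reciprocal:
  assumes "(z::complex) \<noteq> 0"
  shows "((\<lambda>z. 1 / z) has_derivative (\<lambda>h. - (h / z\<^sup>2))) (at z)"
  by (rule has_derivative_eq_rhs[OF has_derivative_divide'[OF has_derivative_const has_derivative_ident assms]])
    (simp add: fun_eq_iff power2_eq_square)

lemma has_derivative_wirtinger_reciprocal:
  assumes "(z::complex) \<noteq> 0"
  shows "((\<lambda>z. 1 / z) has_derivative (\<lambda>h. h * (- (1 / z\<^sup>2)) + cnj h * 0)) (at z)"
  by (rule has_derivative_eq_rhs[OF has_derivative_reciprocal[OF assms]]) (simp add: fun_eq_iff)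

lemma has_derivative_compose_reciprocal:
  assumes "smooth f" "z \<noteq> 0"
  shows "((\<lambda>z. f (1 / z)) has_derivative
    (\<lambda>h. h * (- (1 / z\<^sup>2) * dz f (1 / z)) + cnj h * (- (1 / (cnj z)\<^sup>2) * dzb f (1 / z)))) (at z)"
  by (rule has_derivative_eq_rhs[OF has_derivative_compose[OF has_derivative_reciprocal[OF assms(2)]
        has_derivative_wirtinger_scalar[OF assms(1)]]])
    (simp add: fun_eq_iff)

lemma d_z_compose_reciprocal:
  fixes F G :: "complex \<Rightarrow> 'n::finite cmat"
  assumes "smooth F" "z \<noteq> 0" and G: "\<And>z. z \<noteq> 0 \<Longrightarrow> G z = F (1 / z)"
  shows "d_z G z = cscale (- (1 / z\<^sup>2)) (d_z F (1 / z))"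
    "d_zbar G z = cscale (- (1 / (cnj z)\<^sup>2)) (d_zbar F (1 / z))"
proof -
  have "((\<lambda>z. F (1 / z)) has_derivative (\<lambda>h. cscale h (cscale (- (1 / z\<^sup>2)) (d_z F (1 / z))) +
      cscale (cnj h) (cscale (- (1 / (cnj z)\<^sup>2)) (d_zbar F (1 / z))))) (at z)"
    by (rule has_derivative_eq_rhs[OF has_derivative_compose[OF has_derivative_reciprocal[OF assms(2)]
        has_derivative_wirtinger[OF assms(1)]]])
      (simp add: fun_eq_iff)
  then have "(G has_derivative (\<lambda>h. cscale h (cscale (- (1 / z\<^sup>2)) (d_z F (1 / z))) +
      cscale (cnj h) (cscale (- (1 / (cnj z)\<^sup>2)) (d_zbar F (1 / z))))) (at z)"
    by (rule has_derivative_transform_within_open[of _ _ _ _ "- {0}"]) (use assms in auto)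
  then show "d_z G z = cscale (- (1 / z\<^sup>2)) (d_z F (1 / z))"
    "d_zbar G z = cscale (- (1 / (cnj z)\<^sup>2)) (d_zbar F (1 / z))"
    by (rule wirtinger_eqI)+
qed

text \<open>Under \<open>z \<mapsto> 1 / z\<close>, a density of weight \<open>-1/2\<close> such as the inverse square root of a conformal
  factor has a second \<open>z\<close>-derivative that picks up no lower order terms.\<close>

lemma dz_dz_weight_transform:
  assumes u: "smooth u" and v: "smooth v" and z: "z \<noteq> 0"
    and uv: "\<And>z. z \<noteq> 0 \<Longrightarrow> u z = z * cnj z * v (1 / z)"
  shows "dz (dz u) z = cnj z / z ^ 3 * dz (dz v) (1 / z)"
proof -
  have id: "((\<lambda>z. z) has_derivative (\<lambda>h. h * 1 + cnj h * 0)) (at z)"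
    and cn: "(cnj has_derivative (\<lambda>h. h * 0 + cnj h * 1)) (at z)" for z
    by (auto intro!: derivative_eq_intros)
  have du: "dz u z = cnj z * v (1 / z) - cnj z * (1 / z) * dz v (1 / z)" if "z \<noteq> 0" for z
  proof -
    have "((\<lambda>z. z * cnj z * v (1 / z)) has_derivative
        (\<lambda>h. h * (cnj z * v (1 / z) - cnj z * (1 / z) * dz v (1 / z))
          + cnj h * (z * v (1 / z) - z / cnj z * dzb v (1 / z)))) (at z)"
      by (rule has_derivative_eq_rhs[OF has_derivative_wirtinger_mult[OF
          has_derivative_wirtinger_mult[OF id cn] has_derivative_compose_reciprocal[OF v that]]])
        (use that in \<open>simp add: fun_eq_iff power2_eq_square\<close>)
    then have "(u has_derivative
        (\<lambda>h. h * (cnj z * v (1 / z) - cnj z * (1 / z) * dz v (1 / z))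
          + cnj h * (z * v (1 / z) - z / cnj z * dzb v (1 / z)))) (at z)"
      by (rule has_derivative_transform_within_open[of _ _ _ _ "- {0}"]) (use that uv in auto)
    then show ?thesis by (rule wirtinger_eqI_scalar)
  qed
  have 1: "((\<lambda>z. cnj z * v (1 / z)) has_derivative
      (\<lambda>h. h * (- cnj z / z\<^sup>2 * dz v (1 / z)) + cnj h * (v (1 / z) - cnj z / (cnj z)\<^sup>2 * dzb v (1 / z)))) (at z)"
    by (rule has_derivative_eq_rhs[OF has_derivative_wirtinger_mult[OF cn has_derivative_compose_reciprocal[OF v z]]])
      (simp add: fun_eq_iff algebra_simps)
  have 2: "((\<lambda>z. cnj z * (1 / z) * dz v (1 / z)) has_derivative
      (\<lambda>h. h * (- cnj z / z\<^sup>2 * dz v (1 / z) - cnj z / z ^ 3 * dz (dz v) (1 / z)) +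
        cnj h * (1 / z * dz v (1 / z) - cnj z / z / (cnj z)\<^sup>2 * dzb (dz v) (1 / z)))) (at z)"
    by (rule has_derivative_eq_rhs[OF has_derivative_wirtinger_mult[OF has_derivative_wirtinger_mult[OF cn
        has_derivative_wirtinger_reciprocal[OF z]] has_derivative_compose_reciprocal[OF smooth_wirtinger(3)[OF v] z]]])
      (use z in \<open>simp add: fun_eq_iff power2_eq_square power3_eq_cube algebra_simps\<close>)
  have "((\<lambda>z. cnj z * v (1 / z) - cnj z * (1 / z) * dz v (1 / z)) has_derivative
      (\<lambda>h. h * (cnj z / z ^ 3 * dz (dz v) (1 / z)) + cnj h * (v (1 / z) - cnj z / (cnj z)\<^sup>2 * dzb v (1 / z)
        - (1 / z * dz v (1 / z) - cnj z / z / (cnj z)\<^sup>2 * dzb (dz v) (1 / z))))) (at z)"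
    by (rule has_derivative_eq_rhs[OF has_derivative_diff[OF 1 2]]) (simp add: fun_eq_iff algebra_simps)
  then have "(dz u has_derivative
      (\<lambda>h. h * (cnj z / z ^ 3 * dz (dz v) (1 / z)) + cnj h * (v (1 / z) - cnj z / (cnj z)\<^sup>2 * dzb v (1 / z)
        - (1 / z * dz v (1 / z) - cnj z / z / (cnj z)\<^sup>2 * dzb (dz v) (1 / z))))) (at z)"
    by (rule has_derivative_transform_within_open[of _ _ _ _ "- {0}"]) (use z du in auto)
  then show ?thesis by (rule wirtinger_eqI_scalar)
qed

text \<open>\<open>U\<close> and \<open>V\<close> stand for the inverse square roots of one
  conformal factor in the two charts: since |dz|^2 changes by |z|^(-4) under inversion, they differ
  by |z|^2. The constant \<open>k\<close> becomes the determinant of the Hermitian form.\<close>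

lemma quadratic_of_spherical_density:
  fixes U V :: "complex \<Rightarrow> real"
  assumes U: "smooth U" "\<And>z. U z > 0" and V: "smooth V" "\<And>z. V z > 0"
    and UV: "\<And>z. z \<noteq> 0 \<Longrightarrow> U z = (norm z)\<^sup>2 * V (1 / z)"
    and u_def: "u = (\<lambda>z. complex_of_real (U z))"
    and pde: "\<And>z. u z * dzb (dz u) z - dz u z * dzb u z = of_real k" and k: "k > 0"
  obtains a b c where "a > 0" "c > 0" "a * c - (norm b)\<^sup>2 = k"
    "\<And>z. u z = of_real a + b * z + cnj b * cnj z + of_real c * (z * cnj z)"
proof -
  define v where "v = (\<lambda>z. complex_of_real (V z))"
  have sm: "smooth u" "smooth v" unfolding u_def v_def by (intro smooth_intros U V)+
  note smw = smooth_wirtinger(3,4)[OF sm(1)] smooth_wirtinger(3)[OF smooth_wirtinger(3)[OF sm(1)]]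
    smooth_wirtinger(4)[OF smooth_wirtinger(3)[OF sm(1)]]
  have une: "u z \<noteq> 0" for z using U(2)[of z] by (simp add: u_def)
  have vne: "v z \<noteq> 0" for z using V(2)[of z] by (simp add: v_def)
  have uv: "u z = z * cnj z * v (1 / z)" if "z \<noteq> 0" for z
    unfolding u_def v_def UV[OF that] of_real_mult complex_norm_square by simp
  \<comment> \<open>The z-derivative of the equation. The products of \<open>dz u\<close> with the
    mixed derivative cancel, and what remains says that u_zz / u is holomorphic.\<close>
  have dudu: "u z * dzb (dz (dz u)) z = dz (dz u) z * dzb u z" for z
  proof -
    have comm: "dz (dzb (dz u)) = dzb (dz (dz u))" "dz (dzb u) = dzb (dz u)"
      using wirtinger_commute(2)[OF smw(1)] wirtinger_commute(2)[OF sm(1)] by simp_all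
    have "dz (\<lambda>z. u z * dzb (dz u) z - dz u z * dzb u z) z = 0"
      by (simp only: pde wirtinger_const)
    then have "dz u z * dzb (dz u) z + u z * dz (dzb (dz u)) z - (dz (dz u) z * dzb u z + dz u z * dz (dzb u) z) = 0"
      by (simp only: wirtinger_diff wirtinger_mult sm smw smooth_mult)
    then show ?thesis unfolding comm by simp
  qed
  define q where "q = (\<lambda>z. dz (dz u) z * of_real (inverse (U z)))"
  have qu: "q z * u z = dz (dz u) z" for z
    using U(2)[of z] by (simp add: q_def u_def)
  have smq: "smooth q"
    unfolding q_def by (intro smooth_intros sm U) (use U(2) in \<open>metis less_irrefl\<close>)
  have dq: "dzb q z = 0" for z
  proof -
    have "dzb (dz (dz u)) z = dzb (\<lambda>z. q z * u z) z" by (simp only: qu)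
    also have "\<dots> = dzb q z * u z + q z * dzb u z"
      by (simp only: wirtinger_mult smq sm)
    finally have "u z * dzb (dz (dz u)) z = dzb q z * u z * u z + (q z * u z) * dzb u z"
      by (simp add: algebra_simps)
    then show ?thesis unfolding dudu qu using une[of z] by simp
  qed
  have "q holomorphic_on UNIV"
  proof -
    have "(q has_field_derivative dz q z) (at z)" for z
      using has_derivative_wirtinger_scalar[OF smq, of z]
      unfolding has_field_derivative_def dq by (simp add: mult.commute[of _ "dz q z"])
    then show ?thesis by (auto simp: holomorphic_on_def field_differentiable_def)
  qed
  moreover have "(q \<longlongrightarrow> 0) at_infinity"
  proof -
    have inf: "((\<lambda>z::complex. 1 / z) \<longlongrightarrow> 0) at_infinity"
      using tendsto_inverse_0[where 'a=complex] unfolding inverse_eq_divide[abs_def] .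
    have "isCont (dz (dz v)) 0" "isCont v 0"
      using smooth_continuous[OF sm(2)] smooth_continuous[OF smooth_wirtinger(3)[OF smooth_wirtinger(3)[OF sm(2)]]]
      by (auto simp: continuous_on_eq_continuous_at)
    \<comment> \<open>The exponent 4 is the weight of a quadratic differential: the factor cnj z /
      z^3 from u_zz is divided by z cnj z from u.\<close>
    then have "((\<lambda>z. (1 / z) ^ 4 * (dz (dz v) (1 / z) / v (1 / z))) \<longlongrightarrow> 0 ^ 4 * (dz (dz v) 0 / v 0)) at_infinity"
      by (intro tendsto_intros inf isCont_tendsto_compose[OF _ inf] vne)
    then have "((\<lambda>z. (1 / z) ^ 4 * (dz (dz v) (1 / z) / v (1 / z))) \<longlongrightarrow> 0) at_infinity" by simp
    moreover have "eventually (\<lambda>z. (1 / z) ^ 4 * (dz (dz v) (1 / z) / v (1 / z)) = q z) at_infinity"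
      unfolding eventually_at_infinity
    proof (intro exI[of _ 1] allI impI)
      fix z :: complex assume "1 \<le> norm z"
      then have z: "z \<noteq> 0" by auto
      have tr: "dz (dz u) z = cnj z / z ^ 3 * dz (dz v) (1 / z)"
        by (rule dz_dz_weight_transform[OF sm z]) (rule uv)
      have "q z = dz (dz u) z / u z" using qu[of z] une[of z] by (simp add: field_simps)
      also have "\<dots> = (cnj z / z ^ 3 * dz (dz v) (1 / z)) / (z * cnj z * v (1 / z))"
        unfolding tr uv[OF z] ..
      also have "\<dots> = (1 / z) ^ 4 * (dz (dz v) (1 / z) / v (1 / z))"
        using z vne[of "1/z"] by (simp add: field_simps eval_nat_numeral)
      finally show "(1 / z) ^ 4 * (dz (dz v) (1 / z) / v (1 / z)) = q z" by (rule sym)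
    qed
    ultimately show ?thesis by (rule Lim_transform_eventually)
  qed
  ultimately have q0: "q z = 0" for z by (rule Liouville_weak_0)
  have d2: "dz (dz u) = (\<lambda>z. 0)" using qu q0 by auto
  have cnju: "dzb u = (\<lambda>z. cnj (dz u z))"
  proof -
    have "dzb u = dzb (\<lambda>z. cnj (u z))" by (simp add: u_def)
    then show ?thesis by (simp only: wirtinger_linear sm)
  qed
  have d2b: "dzb (dzb u) = (\<lambda>z. 0)"
    unfolding cnju by (simp only: wirtinger_linear smw d2 complex_cnj_zero)
  define h where "h = dzb (dz u)"
  have comm: "dz (dzb u) = h" using wirtinger_commute(2)[OF sm(1)] by (simp add: h_def)
  have h: "h z = h 0" for z
  proof (rule dz_dzb_eq_0_imp_const[of h])
    show "smooth h" unfolding h_def by (rule smw)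
    show "dz h z = 0" for z
      unfolding h_def wirtinger_commute(2)[OF smw(1)] d2 wirtinger_const ..
    show "dzb h z = 0" for z
      unfolding comm[symmetric] wirtinger_commute(2)[OF smw(2), symmetric] d2b wirtinger_const ..
  qed
  note smid = smooth_ident smooth_cnj[OF smooth_ident] smooth_const
  define c0 where "c0 = h 0"
  have hc: "dzb (dz u) = (\<lambda>z. c0)"
    unfolding h_def[symmetric] c0_def by (rule ext) (rule h)
  have b: "dz u z - c0 * cnj z = dz u 0 - c0 * cnj 0" for z
  proof (rule dz_dzb_eq_0_imp_const[of "\<lambda>z. dz u z - c0 * cnj z"])
    show "smooth (\<lambda>z. dz u z - c0 * cnj z)" by (intro smooth_intros sm)
    show "dz (\<lambda>z. dz u z - c0 * cnj z) z = 0" "dzb (\<lambda>z. dz u z - c0 * cnj z) z = 0" for z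
      by (simp_all add: wirtinger_diff wirtinger_mult wirtinger_const smid smw smooth_mult d2 hc)
  qed
  define b where "b = dz u 0"
  have dzu: "dz u z = b + c0 * cnj z" for z using b[of z] by (simp add: b_def algebra_simps)
  \<comment> \<open>The equation at 0, where \<open>dz u\<close> is b and the mixed derivative is
    c0, is the determinant identity. It also shows that c0 is real and positive.\<close>
  have "u 0 * c0 - b * cnj b = of_real k"
    using pde[of 0] by (simp add: b_def hc cnju)
  then have "of_real (U 0) * c0 = of_real (k + (norm b)\<^sup>2)"
    unfolding of_real_add complex_norm_square u_def by (simp add: algebra_simps)
  then have h0: "c0 = of_real ((k + (norm b)\<^sup>2) / U 0)"
    using U(2)[of 0] by (simp add: field_simps)
  define c where "c = (k + (norm b)\<^sup>2) / U 0"
  have "c > 0" using k U(2)[of 0] by (simp add: c_def add_pos_nonneg)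
  moreover have "U 0 * c - (norm b)\<^sup>2 = k" using U(2)[of 0] by (simp add: c_def)
  moreover have "u z = of_real (U 0) + b * z + cnj b * cnj z + of_real c * (z * cnj z)" for z
  proof -
    have "u z - (b * z + cnj b * cnj z + of_real c * (z * cnj z)) =
        u 0 - (b * 0 + cnj b * cnj 0 + of_real c * (0 * cnj 0))"
    proof (rule dz_dzb_eq_0_imp_const[of "\<lambda>z. u z - (b * z + cnj b * cnj z + of_real c * (z * cnj z))"])
      show "smooth (\<lambda>z. u z - (b * z + cnj b * cnj z + of_real c * (z * cnj z)))" by (intro smooth_intros sm)
      show "dz (\<lambda>z. u z - (b * z + cnj b * cnj z + of_real c * (z * cnj z))) z = 0"
        "dzb (\<lambda>z. u z - (b * z + cnj b * cnj z + of_real c * (z * cnj z))) z = 0" for z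
        by (simp_all add: wirtinger_diff wirtinger_add wirtinger_mult wirtinger_const smid sm smooth_mult smooth_add
            cnju dzu) (simp_all add: h0 c_def)
    qed
    then show ?thesis by (simp add: u_def algebra_simps)
  qed
  ultimately show ?thesis using U(2)[of 0] by (intro that[of "U 0" c b])
qed

lemma quadratic_holo_matrix:
  fixes G :: "complex \<Rightarrow> 'n::finite cmat"
  assumes sm: "smooth G" and db: "d_zbar G = (\<lambda>z. 0)" and d3: "d_z (d_z (d_z G)) = (\<lambda>z. 0)"
  shows "G z = G 0 + cscale z (d_z G 0) + cscale (z\<^sup>2 / 2) (d_z (d_z G) 0)"
proof -
  note smw = smooth_wirtinger(1)[OF sm] smooth_wirtinger(1)[OF smooth_wirtinger(1)[OF sm]]
  note sc = smooth_ident smooth_const smooth_mult smooth_cscale smooth_diff smooth_add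
  have db1: "d_zbar (d_z G) = (\<lambda>z. 0)"
    unfolding wirtinger_commute(1)[OF sm, symmetric] db wirtinger_const ..
  have db2: "d_zbar (d_z (d_z G)) = (\<lambda>z. 0)"
    unfolding wirtinger_commute(1)[OF smw(1), symmetric] db1 wirtinger_const ..
  have G2: "d_z (d_z G) z = d_z (d_z G) 0" for z
    by (rule d_z_d_zbar_eq_0_imp_const[of "d_z (d_z G)", OF smw(2)]) (simp_all add: d3 db2)
  define C1 C2 where "C1 = d_z G 0" and "C2 = d_z (d_z G) 0"
  have G2': "d_z (d_z G) = (\<lambda>z. C2)"
    unfolding C2_def by (rule ext) (rule G2)
  have lin: "d_z G z - cscale z C2 = d_z G 0 - cscale 0 C2" for z
  proof (rule d_z_d_zbar_eq_0_imp_const[of "\<lambda>z. d_z G z - cscale z C2"])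
    show "smooth (\<lambda>z. d_z G z - cscale z C2)" by (intro sc smw)
    show "d_z (\<lambda>z. d_z G z - cscale z C2) z = 0" "d_zbar (\<lambda>z. d_z G z - cscale z C2) z = 0" for z
      by (simp_all add: wirtinger_diff wirtinger_cscale wirtinger_const sc smw db1 G2')
  qed
  have G1: "d_z G z = C1 + cscale z C2" for z
    using lin[of z] by (simp only: C1_def diff_eq_eq cscale_simps(3) diff_zero)
  have fin: "G z - (cscale z C1 + cscale (z * z) (cscale (1/2) C2)) = G 0 - (cscale 0 C1 + cscale (0 * 0) (cscale (1/2) C2))"
  proof (rule d_z_d_zbar_eq_0_imp_const[of "\<lambda>z. G z - (cscale z C1 + cscale (z * z) (cscale (1/2) C2))"])
    show "smooth (\<lambda>z. G z - (cscale z C1 + cscale (z * z) (cscale (1/2) C2)))" by (intro sc sm)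
    show "d_zbar (\<lambda>z. G z - (cscale z C1 + cscale (z * z) (cscale (1/2) C2))) z = 0" for z
      by (simp only: wirtinger_diff wirtinger_add wirtinger_cscale wirtinger_mult wirtinger_const sc sm db) simp
    show "d_z (\<lambda>z. G z - (cscale z C1 + cscale (z * z) (cscale (1/2) C2))) z = 0" for z
      by (simp only: wirtinger_diff wirtinger_add wirtinger_cscale wirtinger_mult wirtinger_const sc sm G1)
        (rule cmat_eqI, simp)
  qed
  have "G z = G 0 + (cscale z C1 + cscale (z * z) (cscale (1/2) C2))"
    using fin by (simp only: diff_eq_eq) simp
  then show ?thesis by (simp add: C1_def C2_def power2_eq_square add.assoc)
qed

section \<open>Rigidity of the Veronese curves\<close>

definition sph :: "complex \<Rightarrow> complex" where
  "sph z = 1 + z * cnj z"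

lemma sph_alt: "sph z = of_real (1 + (norm z)\<^sup>2)"
  by (simp only: sph_def of_real_add of_real_1 complex_norm_square)

lemma sph_nonzero [simp]: "sph z \<noteq> 0"
  unfolding sph_alt of_real_eq_0_iff by (metis less_irrefl zero_less_one_class.zero_less_one add_pos_nonneg zero_le_power2)

lemma cnj_sph [simp]: "cnj (sph z) = sph z"
  by (simp add: sph_alt)

lemma sph_0 [simp]: "sph 0 = 1"
  by (simp add: sph_def)

lemma smooth_sph [smooth_intros]: "smooth sph"
  unfolding sph_def[abs_def] by (intro smooth_intros)

lemma smooth_cnj_id: "smooth cnj"
  using smooth_cnj[OF smooth_ident] .

lemma d_sph: "dz sph = cnj" "dzb sph = (\<lambda>z. z)"
proof -
  have "(sph has_derivative (\<lambda>h. h * cnj z + cnj h * z)) (at z)" for z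
    unfolding sph_def[abs_def] by (auto intro!: derivative_eq_intros simp: fun_eq_iff algebra_simps)
  from wirtinger_eqI_scalar[OF this] show "dz sph = cnj" "dzb sph = (\<lambda>z. z)" by auto
qed

lemma veronese_curve_nth:
  "veronese_curve 1 z $ 1 = 1" "veronese_curve 1 z $ 2 = z" "veronese_curve 1 z $ 3 = 0"
  "veronese_curve 2 z $ 1 = 1" "veronese_curve 2 z $ 2 = of_real (sqrt 2) * z" "veronese_curve 2 z $ 3 = z\<^sup>2"
  by (simp_all add: veronese_curve_def)

lemma cscale_mult_vec: "cscale c A *v x = c *s (A *v x)"
  by (simp add: vec_eq_iff matrix_vector_mult_def sum_distrib_left mult.assoc)

text \<open>For n = 1 and n = 2 the squared length of the curve is \<open>sph z ^ n\<close>, so this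
  is the projection onto V_0^n, in a form that can be differentiated.\<close>

definition veronese_model :: "nat \<Rightarrow> complex \<Rightarrow> 3 cmat" where
  "veronese_model n z = cscale (1 / sph z ^ n) (outer (veronese_curve n z) (veronese_curve n z))"

lemma unitary_of_frame:
  fixes u v w :: "complex^3"
  assumes "outer u u + outer v v + outer w w = mat 1"
  obtains U where "U \<in> unitary_group" "\<And>x. U *v x = x $ 1 *s u + x $ 2 *s v + x $ 3 *s w"
proof -
  define U :: "3 cmat" where "U = (\<chi> i j. if j = 1 then u $ i else if j = 2 then v $ i else w $ i)"
  have ne: "(1::3) \<noteq> 2" "(3::3) \<noteq> 1" "(3::3) \<noteq> 2" "(2::3) \<noteq> 1" by auto
  have "U ** ctranspose U = outer u u + outer v v + outer w w"
    by (rule cmat_eqI) (simp only: mmult_nth sum_3, simp add: U_def ne)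
  then have 1: "U ** ctranspose U = mat 1" using assms by simp
  then have "ctranspose U ** U = mat 1" using matrix_left_right_inverse by blast
  with 1 have "U \<in> unitary_group" by (simp add: unitary_group_def)
  moreover have "U *v x = x $ 1 *s u + x $ 2 *s v + x $ 3 *s w" for x
    by (simp add: vec_eq_iff matrix_vector_mult_def sum_3 U_def ne mult.commute)
  ultimately show ?thesis by (rule that)
qed

context holo_proj
begin

text \<open>A holomorphic section of the line bundle: \<open>T\<close> plays the role of \<open>f f\<^sup>*\<close>, and the
  antiholomorphic Taylor polynomial below evaluates the second factor at \<open>0\<close>.\<close>

lemma developing_map:
  assumes smT: "smooth T" and T: "\<And>z. T z = cscale (\<rho> z) (P z)" and real: "\<And>z. cnj (\<rho> z) = \<rho> z"
    and d3: "d_z (d_z (d_z T)) = (\<lambda>z. 0)"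
  shows "P z ** (T 0 + cscale z (d_z T 0) + cscale (z\<^sup>2 / 2) (d_z (d_z T) 0)) =
    T 0 + cscale z (d_z T 0) + cscale (z\<^sup>2 / 2) (d_z (d_z T) 0)"
proof -
  define Tb where "Tb = d_zbar T"
  define Tbb where "Tbb = d_zbar Tb"
  note sz = smooth_wirtinger(1) and sb = smooth_wirtinger(2)
  have smTb: "smooth Tb" and smTbb: "smooth Tbb"
    unfolding Tbb_def Tb_def by (intro sb smT)+
  have Th: "T = (\<lambda>z. ctranspose (T z))"
    by (simp add: fun_eq_iff T real herm)
  have Tb: "Tb = (\<lambda>z. ctranspose (d_z T z))"
    unfolding Tb_def by (subst Th) (simp only: wirtinger_linear smT)
  have Tbb: "Tbb = (\<lambda>z. ctranspose (d_z (d_z T) z))"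
    unfolding Tbb_def Tb by (simp only: wirtinger_linear sz smT)
  have Tbbb: "d_zbar Tbb = (\<lambda>z. 0)"
    unfolding Tbb by (simp only: wirtinger_linear sz smT d3 ctranspose_simps)
  have d3b: "d_z (d_z (d_z (d_zbar F))) = d_zbar (d_z (d_z (d_z F)))" if "smooth F" for F :: "complex \<Rightarrow> 'n cmat"
    by (simp only: wirtinger_commute(1) sz that)
  have d3Tb: "d_z (d_z (d_z Tb)) = (\<lambda>z. 0)"
    unfolding Tb_def d3b[OF smT] d3 wirtinger_const ..
  have d3Tbb: "d_z (d_z (d_z Tbb)) = (\<lambda>z. 0)"
    unfolding Tbb_def d3b[OF smTb] d3Tb wirtinger_const ..
  \<comment> \<open>The columns of \<open>T\<close> lie in the image of \<open>P\<close>. The next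
    facts keep its zbar-derivatives there, because \<open>d_zbar P\<close> annihilates that
    image.\<close>
  have PT: "P z ** T z = T z" for z by (simp add: T idem)
  have AbT: "d_zbar P z ** T z = 0" for z by (simp add: T hol')
  have "d_zbar (\<lambda>z. P z ** T z) = Tb" by (simp only: PT Tb_def)
  then have "d_zbar P z ** T z + P z ** Tb z = Tb z" for z
    unfolding wirtinger_mmult(2)[OF smooth_P smT] Tb_def by (rule fun_cong)
  then have PTb: "P z ** Tb z = Tb z" for z by (simp only: AbT add_0_left)
  have AbTb: "d_zbar P z ** Tb z = 0" for z
  proof -
    have "d_zbar P z ** Tb z = (d_zbar P z ** P z) ** Tb z"
      by (simp only: matrix_mul_assoc[symmetric] PTb)
    then show ?thesis by (simp only: hol' mmult_zero)
  qed
  have "d_zbar (\<lambda>z. P z ** Tb z) = Tbb" by (simp only: PTb Tbb_def)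
  then have "d_zbar P z ** Tb z + P z ** Tbb z = Tbb z" for z
    unfolding wirtinger_mmult(2)[OF smooth_P smTb] Tbb_def by (rule fun_cong)
  then have PTbb: "P z ** Tbb z = Tbb z" for z by (simp only: AbTb add_0_left)
  define t where "t = (\<lambda>z. (1/2) * (cnj z * cnj z))"
  have smt: "smooth t" unfolding t_def by (intro smooth_intros)
  have dt: "dz t = (\<lambda>z. 0)" "dzb t = cnj"
    unfolding t_def by (simp_all only: wirtinger_mult wirtinger_const smooth_const smooth_cnj_id smooth_mult) auto
  define G where "G = (\<lambda>z. T z - cscale (cnj z) (Tb z) + cscale (t z) (Tbb z))"
  note sm = smooth_add smooth_diff smooth_cscale smooth_cnj_id smt smTb smTbb smT sz
  have smG: "smooth G" unfolding G_def by (intro sm)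
  have shift: "d_z (\<lambda>z. X z - cscale (cnj z) (Y z) + cscale (t z) (Z z)) =
      (\<lambda>z. d_z X z - cscale (cnj z) (d_z Y z) + cscale (t z) (d_z Z z))"
    if "smooth X" "smooth Y" "smooth Z" for X Y Z :: "complex \<Rightarrow> 'n cmat"
    by (simp only: wirtinger_add wirtinger_diff wirtinger_cscale wirtinger_const dt sm that cscale_simps add_0_left)
  have d1G: "d_z G = (\<lambda>z. d_z T z - cscale (cnj z) (d_z Tb z) + cscale (t z) (d_z Tbb z))"
    unfolding G_def by (rule shift[OF smT smTb smTbb])
  have d2G: "d_z (d_z G) = (\<lambda>z. d_z (d_z T) z - cscale (cnj z) (d_z (d_z Tb) z) + cscale (t z) (d_z (d_z Tbb) z))"
    unfolding d1G by (rule shift[OF smT[THEN sz] smTb[THEN sz] smTbb[THEN sz]])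
  have d3G: "d_z (d_z (d_z G)) = (\<lambda>z. 0)"
    unfolding d2G shift[OF smT[THEN sz, THEN sz] smTb[THEN sz, THEN sz] smTbb[THEN sz, THEN sz]] d3 d3Tb d3Tbb
    by simp
  \<comment> \<open>The sum telescopes to \<open>t\<close> times the third zbar-derivative of
    \<open>T\<close>, which is the adjoint of the third z-derivative and so vanishes.\<close>
  have dbG: "d_zbar G = (\<lambda>z. 0)"
    unfolding G_def
    by (simp only: wirtinger_add wirtinger_diff wirtinger_cscale wirtinger_const dt sm Tbbb Tb_def[symmetric] Tbb_def[symmetric])
      (rule ext, rule cmat_eqI, simp)
  have G: "G z = G 0 + cscale z (d_z G 0) + cscale (z\<^sup>2 / 2) (d_z (d_z G) 0)" for z
    by (rule quadratic_holo_matrix[OF smG dbG d3G])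
  have t0: "t 0 = 0" by (simp add: t_def)
  have G0: "G 0 = T 0" "d_z G 0 = d_z T 0" "d_z (d_z G) 0 = d_z (d_z T) 0"
    by (simp add: G_def t0) (simp add: d1G t0, simp add: d2G t0)
  have "P z ** G z = G z"
    unfolding G_def by (simp only: mmult_distrib cscale_simps PT PTb PTbb)
  then show ?thesis unfolding G[of z] G0 .
qed

end

context rank_one_holo_proj
begin

text \<open>\<open>round\<close> is the metric n |dz|^2 / (1 + |z|^2)^2, of curvature 4/n;
  \<open>rank_one_classification\<close> reaches this form by an affine coordinate.\<close>

context
  fixes n :: nat
  assumes nK: "(n = 1 \<and> K = 4) \<or> (n = 2 \<and> K = 2)"
    and round: "\<And>z. e z * sph z ^ 2 = of_nat n"
begin

lemma sph_lam: "sph z * lam z = - 2 * cnj z"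
proof -
  have "dz (\<lambda>z. e z * (sph z * sph z)) z = 0"
    using round by (simp add: power2_eq_square wirtinger_const)
  then have "dz e z * (sph z * sph z) + e z * (cnj z * sph z + sph z * cnj z) = 0"
    by (simp only: wirtinger_mult sm_e smooth_sph smooth_mult d_sph)
  then have "sph z * e z * (sph z * lam z + 2 * cnj z) = 0"
    unfolding lam_e(1)[symmetric] by (simp add: algebra_simps)
  then have "sph z * lam z + 2 * cnj z = 0" by simp
  then show ?thesis by (simp add: eq_neg_iff_add_eq_0)
qed

lemma e_0: "e 0 = of_nat n"
  using round[of 0] by simp

text \<open>With T = sph^n P, the relation \<open>sph lam = -2 cnj z\<close> cancels all terms of
  the (n+1)-st z-derivative, so \<open>developing_map\<close> applies. At 0, where sph is 1 and cnj
  z is 0, the derivatives of \<open>T\<close> reduce to P, A and B.\<close>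

lemma developing:
  "P z ** (P 0 + cscale z (A 0) + cscale (z\<^sup>2 / 2) (B 0)) = P 0 + cscale z (A 0) + cscale (z\<^sup>2 / 2) (B 0)"
  using nK
proof (elim disjE conjE)
  note sm = smooth_add smooth_cscale smooth_mult smooth_cnj_id smooth_const smooth_sph smooth_P sm_A sm_B
  note wr = wirtinger_add wirtinger_cscale wirtinger_mult wirtinger_const d_sph d_z_P
  assume n: "n = 1" and K: "K = 4"
  have B0: "B z = 0" for z using curvature_cases K by auto
  define T where "T = (\<lambda>z. cscale (sph z) (P z))"
  have smT: "smooth T" unfolding T_def by (intro sm)
  have T1: "d_z T = (\<lambda>z. cscale (cnj z) (P z) + cscale (sph z) (A z))"
    unfolding T_def by (simp only: wr sm)
  have T2: "d_z (d_z T) = (\<lambda>z. 0)"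
  proof
    fix z
    have "d_z (d_z T) z = cscale (cnj z) (A z) + (cscale (cnj z) (A z) + cscale (sph z) (d_z A z))"
      unfolding T1 by (simp only: wr sm cscale_simps add_0_left)
    also have "\<dots> = cscale (2 * cnj z + sph z * lam z) (A z)"
      unfolding d_z_A B0 by (rule cmat_eqI) (simp add: algebra_simps)
    also have "\<dots> = 0" by (simp add: sph_lam)
    finally show "d_z (d_z T) z = 0" .
  qed
  have T3: "d_z (d_z (d_z T)) = (\<lambda>z. 0)" unfolding T2 wirtinger_const ..
  have T0: "T 0 = P 0" "d_z T 0 = A 0" "d_z (d_z T) 0 = B 0"
    by (simp add: T_def) (simp add: T1, simp add: T2 B0)
  show ?thesis
    using developing_map[OF smT _ _ T3, of sph z] unfolding T0 by (simp add: T_def)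
next
  note sm = smooth_add smooth_cscale smooth_mult smooth_cnj_id smooth_const smooth_sph smooth_P sm_A sm_B
  note wr = wirtinger_add wirtinger_cscale wirtinger_mult wirtinger_const d_sph d_z_P
  assume n: "n = 2" and K: "K = 2"
  have "c \<noteq> 0" unfolding c_def using K by simp
  note dB = d_z_B[OF this]
  define T where "T = (\<lambda>z. cscale (sph z * sph z) (P z))"
  have smT: "smooth T" unfolding T_def by (intro sm)
  have T1: "d_z T = (\<lambda>z. cscale (2 * (cnj z * sph z)) (P z) + cscale (sph z * sph z) (A z))"
    unfolding T_def by (simp only: wr sm) (simp add: mult.commute)
  have T2: "d_z (d_z T) = (\<lambda>z. cscale (2 * (cnj z * cnj z)) (P z) + cscale (2 * (cnj z * sph z)) (A z)
      + cscale (sph z * sph z) (B z))"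
  proof
    fix z
    have "d_z (d_z T) z = cscale (2 * (cnj z * cnj z)) (P z) + cscale (2 * (cnj z * sph z)) (A z)
        + (cscale (cnj z * sph z + sph z * cnj z) (A z) + cscale (sph z * sph z) (d_z A z))"
      unfolding T1 by (simp only: wr sm) simp
    also have "\<dots> = cscale (2 * (cnj z * cnj z)) (P z) + cscale (4 * (cnj z * sph z) + sph z * (sph z * lam z)) (A z)
        + cscale (sph z * sph z) (B z)"
      unfolding d_z_A by (rule cmat_eqI) (simp add: algebra_simps)
    also have "4 * (cnj z * sph z) + sph z * (sph z * lam z) = 2 * (cnj z * sph z)"
      unfolding sph_lam by simp
    finally show "d_z (d_z T) z = cscale (2 * (cnj z * cnj z)) (P z) + cscale (2 * (cnj z * sph z)) (A z)
        + cscale (sph z * sph z) (B z)" .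
  qed
  have T3: "d_z (d_z (d_z T)) = (\<lambda>z. 0)"
  proof
    fix z
    have "d_z (d_z (d_z T)) z = cscale (2 * (cnj z * cnj z)) (A z) + (cscale (2 * (cnj z * cnj z)) (A z)
        + cscale (2 * (cnj z * sph z)) (d_z A z)) + (cscale (cnj z * sph z + sph z * cnj z) (B z)
        + cscale (sph z * sph z) (d_z B z))"
      unfolding T2 by (simp only: wr sm) simp
    also have "\<dots> = cscale (4 * (cnj z * cnj z) + 2 * cnj z * (sph z * lam z)) (A z)
        + cscale (4 * (cnj z * sph z) + 2 * sph z * (sph z * lam z)) (B z)"
      unfolding d_z_A dB by (rule cmat_eqI) (simp add: algebra_simps)
    also have "\<dots> = 0" unfolding sph_lam by (simp add: algebra_simps)
    finally show "d_z (d_z (d_z T)) z = 0" .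
  qed
  have T0: "T 0 = P 0" "d_z T 0 = A 0" "d_z (d_z T) 0 = B 0"
    by (simp add: T_def) (simp add: T1, simp add: T2)
  show ?thesis
    using developing_map[OF smT _ _ T3, of "\<lambda>z. sph z * sph z" z] unfolding T0 by (simp add: T_def)
qed

text \<open>The columns of \<open>G z\<close> lie in the line of \<open>P z\<close>, so
  \<open>G z\<close> times its adjoint is a multiple of \<open>P z\<close>. The factor is the
  squared length of the section, which has to come out as \<open>sph z ^ n\<close>.\<close>

lemma P_section:
  defines "G \<equiv> \<lambda>z. P 0 + cscale z (A 0) + cscale (z\<^sup>2 / 2) (B 0)"
  shows "P z = cscale (1 / sph z ^ n) (G z ** P 0 ** ctranspose (G z))"
proof -
  have PG: "P z ** G z = G z" unfolding G_def by (rule developing)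
  have GP: "ctranspose (G z) ** P z = ctranspose (G z)"
    using arg_cong[OF PG, of ctranspose] by (simp add: herm)
  have GP0: "G z ** P 0 = G z" unfolding G_def by (simp only: mmult_distrib AP_products B_products cscale_simps)
  have "ctranspose (G z) ** G z = cscale (1 + z * cnj z * e 0 + (z * cnj z)\<^sup>2 / 4 * (c * (e 0)\<^sup>2)) (P 0)"
    unfolding G_def
    by (simp only: ctranspose_simps cscale_simps herm ct AP_simps B_products Bs_products Bs_B)
      (rule cmat_eqI, simp add: algebra_simps power2_eq_square)
  \<comment> \<open>For n = 1 the values are e = 1 and c = 0; for n = 2 they are e = 2 and c = 1,
    and 1 + 2t + t^2 is a square.\<close>
  also have "1 + z * cnj z * e 0 + (z * cnj z)\<^sup>2 / 4 * (c * (e 0)\<^sup>2) = sph z ^ n"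
    using nK unfolding e_0 c_def by (auto simp: sph_def power2_eq_square algebra_simps)
  finally have "trace (ctranspose (G z) ** G z) = sph z ^ n" by (simp add: rank_one)
  then have tr: "trace (G z ** ctranspose (G z)) = sph z ^ n" by (simp only: trace_mul_sym[of "G z"])
  have "G z ** ctranspose (G z) = P z ** (G z ** ctranspose (G z)) ** P z"
    by (simp only: matrix_mul_assoc[symmetric] GP) (simp only: matrix_mul_assoc PG)
  also have "\<dots> = cscale (trace (G z ** ctranspose (G z) ** P z)) (P z)"
    by (rule rank_one_compress[OF orth_P rank_one])
  also have "G z ** ctranspose (G z) ** P z = G z ** ctranspose (G z)"
    by (simp only: matrix_mul_assoc[symmetric] GP)
  finally have "G z ** ctranspose (G z) = cscale (sph z ^ n) (P z)" by (simp only: tr)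
  then show ?thesis by (simp add: GP0)
qed

text \<open>The vectors v, A v, B v at 0 are orthogonal with squared lengths 1, e and c e^2. The
  nonzero ones, normalised, become columns of \<open>U\<close>, and the coefficients of the
  polynomial section in this frame are those of the Veronese curve.\<close>

theorem rigidity:
  obtains U where "U \<in> unitary_group" "\<And>z. P z = U ** veronese_model n z ** ctranspose U"
proof -
  obtain v where v: "hinner v v = 1" "P 0 = outer v v"
    using orth_projection_trace_1[OF orth_P rank_one] .
  have "outer v v *v v = hinner v v *s v"
    by (simp add: vec_eq_iff matrix_vector_mult_def hinner_def sum_distrib_right sum_distrib_left mult_ac)
  then have v_fix: "outer v v *v v = v" by (simp add: v(1))
  have AA: "outer (A 0 *v v) (A 0 *v v) = A 0 ** Ab 0"
    unfolding outer_congruence v(2)[symmetric] ct AP_products ..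
  have BB: "outer (B 0 *v v) (B 0 *v v) = B 0 ** Bs 0"
    unfolding outer_congruence v(2)[symmetric] ct B_products ..
  have "\<exists>u w. outer v v + outer u u + outer w w = mat 1 \<and>
    (\<forall>z. (P 0 + cscale z (A 0) + cscale (z\<^sup>2 / 2) (B 0)) *v v =
      veronese_curve n z $ 1 *s v + veronese_curve n z $ 2 *s u + veronese_curve n z $ 3 *s w)"
    using nK
  proof (elim disjE conjE)
    assume n: "n = 1" and K: "K = 4"
    have B0: "B z = 0" for z using curvature_cases K by auto
    have e0: "e 0 = 1" using e_0 n by simp
    have D: "orth_projection (mat 1 - P 0 - A 0 ** Ab 0)"
      unfolding orth_projection_def
      by (simp add: mmult_distrib AP_simps e0 herm ct)
    have "trace (mat 1 - P 0 - A 0 ** Ab 0) = 1"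
      by (simp add: trace_sub trace_I e_trace rank_one e0)
    \<comment> \<open>\<open>B\<close> vanishes here, so the third column is any unit vector that
      completes the frame.\<close>
    from orth_projection_trace_1[OF D this] obtain w where w: "mat 1 - P 0 - A 0 ** Ab 0 = outer w w" .
    have "outer v v + outer (A 0 *v v) (A 0 *v v) + outer w w = mat 1"
      unfolding AA v(2)[symmetric] w[symmetric] by simp
    moreover have "(P 0 + cscale z (A 0) + cscale (z\<^sup>2 / 2) (B 0)) *v v =
      veronese_curve n z $ 1 *s v + veronese_curve n z $ 2 *s (A 0 *v v) + veronese_curve n z $ 3 *s w" for z
      unfolding n veronese_curve_nth B0 matrix_vector_mult_add_rdistrib cscale_mult_vec
      by (simp add: v(2) v_fix)
    ultimately show ?thesis by blast
  next
    assume n: "n = 2" and K: "K = 2"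
    have c1: "c = 1" unfolding c_def using K by simp
    have e0: "e 0 = 2" using e_0 n by simp
    \<comment> \<open>The squared lengths are e = 2 and c e^2 = 4, whence the factors 1 / sqrt 2 and
      1 / 2.\<close>
    define u where "u = (1 / of_real (sqrt 2)) *s (A 0 *v v)"
    define w where "w = (1 / 2) *s (B 0 *v v)"
    have sq: "complex_of_real (sqrt 2) * of_real (sqrt 2) = 2"
      by (simp flip: of_real_mult)
    have "outer v v + outer u u + outer w w = mat 1"
      using frame_resolution[of 0] unfolding c1 e0
      by (simp add: u_def w_def outer_vector_scalar AA BB v(2) sq)
    moreover have "(P 0 + cscale z (A 0) + cscale (z\<^sup>2 / 2) (B 0)) *v v =
      veronese_curve n z $ 1 *s v + veronese_curve n z $ 2 *s u + veronese_curve n z $ 3 *s w" for z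
      unfolding n veronese_curve_nth matrix_vector_mult_add_rdistrib cscale_mult_vec
      by (simp add: v(2) v_fix u_def w_def)
    ultimately show ?thesis by blast
  qed
  then obtain u w where uw: "outer v v + outer u u + outer w w = mat 1"
    "\<And>z. (P 0 + cscale z (A 0) + cscale (z\<^sup>2 / 2) (B 0)) *v v =
      veronese_curve n z $ 1 *s v + veronese_curve n z $ 2 *s u + veronese_curve n z $ 3 *s w"
    by blast
  obtain U where U: "U \<in> unitary_group" "\<And>x. U *v x = x $ 1 *s v + x $ 2 *s u + x $ 3 *s w"
    by (rule unitary_of_frame[OF uw(1)]) (rule that)
  have "P z = U ** veronese_model n z ** ctranspose U" for z
    unfolding P_section[of z] v(2) outer_congruence[symmetric] uw(2)[unfolded v(2)] U(2)[symmetric]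
    unfolding veronese_model_def by (simp add: outer_congruence)
  with U(1) show ?thesis by (rule that)
qed

end

end

section \<open>Affine changes of the coordinate and normalisation of the density\<close>

lemma wirtinger_affine:
  fixes F :: "complex \<Rightarrow> 'n::finite cmat"
  assumes "smooth F"
  shows "d_z (\<lambda>z. F (\<alpha> * z + \<beta>)) = (\<lambda>z. cscale \<alpha> (d_z F (\<alpha> * z + \<beta>)))"
    "d_zbar (\<lambda>z. F (\<alpha> * z + \<beta>)) = (\<lambda>z. cscale (cnj \<alpha>) (d_zbar F (\<alpha> * z + \<beta>)))"
proof -
  have aff: "((\<lambda>z. \<alpha> * z + \<beta>) has_derivative (\<lambda>h. \<alpha> * h)) (at z)" for z
    by (auto intro!: derivative_eq_intros)
  have "((\<lambda>z. F (\<alpha> * z + \<beta>)) has_derivative (\<lambda>h. cscale h (cscale \<alpha> (d_z F (\<alpha> * z + \<beta>))) +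
      cscale (cnj h) (cscale (cnj \<alpha>) (d_zbar F (\<alpha> * z + \<beta>))))) (at z)" for z
    by (rule has_derivative_eq_rhs[OF has_derivative_compose[OF aff has_derivative_wirtinger[OF assms]]])
      (simp add: fun_eq_iff mult.commute)
  then have "d_z (\<lambda>z. F (\<alpha> * z + \<beta>)) = (\<lambda>z. cscale \<alpha> (d_z F (\<alpha> * z + \<beta>))) \<and>
    d_zbar (\<lambda>z. F (\<alpha> * z + \<beta>)) = (\<lambda>z. cscale (cnj \<alpha>) (d_zbar F (\<alpha> * z + \<beta>)))"
    by (rule wirtinger_funI)
  then show "d_z (\<lambda>z. F (\<alpha> * z + \<beta>)) = (\<lambda>z. cscale \<alpha> (d_z F (\<alpha> * z + \<beta>)))"
    "d_zbar (\<lambda>z. F (\<alpha> * z + \<beta>)) = (\<lambda>z. cscale (cnj \<alpha>) (d_zbar F (\<alpha> * z + \<beta>)))" by blast+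
qed

lemma wirtinger_affine_scalar:
  assumes "smooth f"
  shows "dz (\<lambda>z. f (\<alpha> * z + \<beta>)) = (\<lambda>z. \<alpha> * dz f (\<alpha> * z + \<beta>))"
    "dzb (\<lambda>z. f (\<alpha> * z + \<beta>)) = (\<lambda>z. cnj \<alpha> * dzb f (\<alpha> * z + \<beta>))"
proof -
  have aff: "((\<lambda>z. \<alpha> * z + \<beta>) has_derivative (\<lambda>h. \<alpha> * h)) (at z)" for z
    by (auto intro!: derivative_eq_intros)
  have "((\<lambda>z. f (\<alpha> * z + \<beta>)) has_derivative (\<lambda>h. h * (\<alpha> * dz f (\<alpha> * z + \<beta>)) +
      cnj h * (cnj \<alpha> * dzb f (\<alpha> * z + \<beta>)))) (at z)" for z
    by (rule has_derivative_eq_rhs[OF has_derivative_compose[OF aff has_derivative_wirtinger_scalar[OF assms]]])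
      (simp add: fun_eq_iff mult_ac)
  then have "dz (\<lambda>z. f (\<alpha> * z + \<beta>)) = (\<lambda>z. \<alpha> * dz f (\<alpha> * z + \<beta>)) \<and>
    dzb (\<lambda>z. f (\<alpha> * z + \<beta>)) = (\<lambda>z. cnj \<alpha> * dzb f (\<alpha> * z + \<beta>))"
    by (rule wirtinger_funI_scalar)
  then show "dz (\<lambda>z. f (\<alpha> * z + \<beta>)) = (\<lambda>z. \<alpha> * dz f (\<alpha> * z + \<beta>))"
    "dzb (\<lambda>z. f (\<alpha> * z + \<beta>)) = (\<lambda>z. cnj \<alpha> * dzb f (\<alpha> * z + \<beta>))" by blast+
qed

text \<open>This is the Liouville equation under log e = -2 log u, multiplied by u^2;
  differentiating e u^2 = 1 replaces the logarithm.\<close>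

lemma curvature_inverse_sqrt:
  fixes e u :: "complex \<Rightarrow> complex"
  assumes sm: "smooth e" "smooth u" and eu: "\<And>z. e z * (u z * u z) = 1"
    and curv: "\<And>z. e z * dzb (dz e) z - dz e z * dzb e z = - k * e z ^ 3"
  shows "2 * (u z * dzb (dz u) z - dz u z * dzb u z) = k"
proof -
  have ne: "e z \<noteq> 0" "u z \<noteq> 0" for z using eu[of z] by auto
  note smw = smooth_wirtinger(3)[OF sm(1)] smooth_wirtinger(3)[OF sm(2)]
  have "dz (\<lambda>z. e z * (u z * u z)) z = 0" "dzb (\<lambda>z. e z * (u z * u z)) z = 0" for z
    by (simp_all only: eu wirtinger_const)
  then have "dz e z * (u z * u z) + e z * (dz u z * u z + u z * dz u z) = 0"
    "dzb e z * (u z * u z) + e z * (dzb u z * u z + u z * dzb u z) = 0" for z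
    by (simp_all only: wirtinger_mult sm smooth_mult)
  then have "u z * (dz e z * u z + 2 * (e z * dz u z)) = 0" "u z * (dzb e z * u z + 2 * (e z * dzb u z)) = 0" for z
    by (simp_all add: algebra_simps)
  then have 1: "dz e z * u z + 2 * (e z * dz u z) = 0" "dzb e z * u z + 2 * (e z * dzb u z) = 0" for z
    using ne by simp_all
  have "dzb (\<lambda>z. dz e z * u z + 2 * (e z * dz u z)) z = 0"
    by (simp only: 1 wirtinger_const)
  then have 2: "dzb (dz e) z * u z + dz e z * dzb u z + 2 * (dzb e z * dz u z + e z * dzb (dz u) z) = 0"
    by (simp add: wirtinger_add wirtinger_mult wirtinger_const sm smw smooth_mult smooth_const)
  have "(e z)\<^sup>2 * (2 * (u z * dzb (dz u) z - dz u z * dzb u z) - k) = 0"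
    using 1[of z] 2 eu[of z] curv[of z] by algebra
  then show ?thesis using ne(1)[of z] by simp
qed

definition sphere_affine :: "complex \<Rightarrow> complex \<Rightarrow> riemann_sphere \<Rightarrow> riemann_sphere" where
  "sphere_affine \<alpha> \<beta> p = (case p of Fin z \<Rightarrow> Fin (\<alpha> * z + \<beta>) | Infty \<Rightarrow> Infty)"

lemma sphere_affine_simps [simp]:
  "sphere_affine \<alpha> \<beta> (Fin z) = Fin (\<alpha> * z + \<beta>)" "sphere_affine \<alpha> \<beta> Infty = Infty"
  by (simp_all add: sphere_affine_def)

lemma inj_chart_infty: "inj chart_infty"
  by (auto simp: inj_def chart_infty_def split: if_splits)

lemma inv_charts: "inv Fin (Fin z) = z" "inv chart_infty Infty = 0" "z \<noteq> 0 \<Longrightarrow> inv chart_infty (Fin z) = 1 / z"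
proof -
  show "inv Fin (Fin z) = z" by (rule inv_f_f) (simp add: inj_def)
  show "inv chart_infty Infty = 0"
    using inv_f_f[OF inj_chart_infty, of 0] by (simp add: chart_infty_def)
  show "inv chart_infty (Fin z) = 1 / z" if "z \<noteq> 0"
    using inv_f_f[OF inj_chart_infty, of "1 / z"] that by (simp add: chart_infty_def)
qed

lemma range_charts: "Fin z \<in> range Fin" "Infty \<notin> range Fin" "Infty \<in> range chart_infty"
  "Fin z \<in> range chart_infty \<longleftrightarrow> z \<noteq> 0"
proof -
  show "Infty \<in> range chart_infty" by (rule range_eqI[of _ _ 0]) (simp add: chart_infty_def)
  show "Fin z \<in> range chart_infty \<longleftrightarrow> z \<noteq> 0"
  proof
    assume "z \<noteq> 0"
    then show "Fin z \<in> range chart_infty" by (intro range_eqI[of _ _ "1 / z"]) (simp add: chart_infty_def)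
  qed (auto simp: chart_infty_def split: if_splits)
qed auto

lemma sphere_holomorphic_affine:
  assumes "\<alpha> \<noteq> 0" shows "sphere_holomorphic (sphere_affine \<alpha> \<beta>)"
proof -
  let ?g = "sphere_affine \<alpha> \<beta>"
  have 1: "{z. ?g (Fin z) \<in> range Fin} = UNIV" by (auto simp: range_charts)
  have 2: "{z. ?g (Fin z) \<in> range chart_infty} = {z. \<alpha> * z + \<beta> \<noteq> 0}" by (auto simp: range_charts)
  have 3: "{z. ?g (chart_infty z) \<in> range Fin} = {z. z \<noteq> 0}"
    by (auto simp: range_charts chart_infty_def split: if_splits)
  \<comment> \<open>In the chart at infinity the affine map is w -> w / (\<alpha> + \<beta> w), so
    the excluded point is the zero of this denominator.\<close>
  have 4: "{z. ?g (chart_infty z) \<in> range chart_infty} = {z. \<alpha> + \<beta> * z \<noteq> 0}"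
  proof -
    have "?g (chart_infty z) \<in> range chart_infty \<longleftrightarrow> \<alpha> + \<beta> * z \<noteq> 0" for z
    proof (cases "z = 0")
      case True
      then show ?thesis using assms by (simp add: chart_infty_def range_charts)
    next
      case False
      then have "?g (chart_infty z) = Fin ((\<alpha> + \<beta> * z) / z)"
        by (simp add: chart_infty_def field_simps)
      then show ?thesis using False by (simp only: range_charts) simp
    qed
    then show ?thesis by blast
  qed
  have o: "open {z. \<alpha> * z + \<beta> \<noteq> 0}" "open {z::complex. z \<noteq> 0}" "open {z. \<alpha> + \<beta> * z \<noteq> 0}"
    by (intro open_Collect_neq continuous_intros)+
  have "(\<lambda>z. inv Fin (?g (Fin z))) holomorphic_on UNIV"
    by (simp add: inv_charts) (intro holomorphic_intros)
  moreover have "(\<lambda>z. inv chart_infty (?g (Fin z))) holomorphic_on {z. \<alpha> * z + \<beta> \<noteq> 0}"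
  proof (rule holomorphic_transform)
    show "(\<lambda>z. 1 / (\<alpha> * z + \<beta>)) holomorphic_on {z. \<alpha> * z + \<beta> \<noteq> 0}" by (intro holomorphic_intros) auto
  qed (auto simp: inv_charts)
  moreover have "(\<lambda>z. inv Fin (?g (chart_infty z))) holomorphic_on {z. z \<noteq> 0}"
  proof (rule holomorphic_transform)
    show "(\<lambda>z. \<alpha> * (1 / z) + \<beta>) holomorphic_on {z. z \<noteq> 0}" by (intro holomorphic_intros) auto
  qed (auto simp: inv_charts chart_infty_def)
  moreover have "(\<lambda>z. inv chart_infty (?g (chart_infty z))) holomorphic_on {z. \<alpha> + \<beta> * z \<noteq> 0}"
  proof (rule holomorphic_transform)
    show "(\<lambda>z. z / (\<alpha> + \<beta> * z)) holomorphic_on {z. \<alpha> + \<beta> * z \<noteq> 0}" by (intro holomorphic_intros) auto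
    fix z assume z: "z \<in> {z. \<alpha> + \<beta> * z \<noteq> 0}"
    show "z / (\<alpha> + \<beta> * z) = inv chart_infty (?g (chart_infty z))"
    proof (cases "z = 0")
      case False
      then have "?g (chart_infty z) = Fin ((\<alpha> + \<beta> * z) / z)"
        by (simp add: chart_infty_def field_simps)
      with False z show ?thesis by (simp add: inv_charts)
    qed (simp add: chart_infty_def inv_charts)
  qed
  ultimately show ?thesis
    unfolding sphere_holomorphic_def charts_def by (simp only: ball_simps 1 2 3 4 o open_UNIV)
qed

lemma sphere_biholomorphism_affine:
  assumes "\<alpha> \<noteq> 0" shows "sphere_biholomorphism (sphere_affine \<alpha> \<beta>)"
proof -
  let ?g = "sphere_affine \<alpha> \<beta>" and ?h = "sphere_affine (1 / \<alpha>) (- \<beta> / \<alpha>)"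
  have "?g (?h p) = p" "?h (?g p) = p" for p
    using assms by (cases p; simp add: field_simps)+
  then have "?g \<circ> ?h = id" "?h \<circ> ?g = id" by (simp_all add: fun_eq_iff)
  then have "bij ?g" "inv ?g = ?h"
    by (auto intro: o_bij inv_unique_comp)
  then show ?thesis
    unfolding sphere_biholomorphism_def using sphere_holomorphic_affine assms by simp
qed

lemma holo_proj_affine:
  assumes "holo_proj P" "\<alpha> \<noteq> 0"
  shows "holo_proj (\<lambda>z. P (\<alpha> * z + \<beta>))"
proof -
  interpret holo_proj P by fact
  show ?thesis
    by unfold_locales
      (simp_all add: smooth_compose_affine smooth_P herm idem wirtinger_affine hol)
qed

theorem rank_one_classification:
  fixes P :: "riemann_sphere \<Rightarrow> 3 cmat"
  assumes F: "rank_one_holo_proj (P \<circ> Fin) K"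
    and I: "holo_proj (P \<circ> chart_infty)" "\<And>w. d_z (P \<circ> chart_infty) w \<noteq> 0"
  obtains n \<alpha> \<beta> U where "n = 1 \<or> n = 2" "\<alpha> \<noteq> 0" "U \<in> unitary_group"
    "\<And>z. P (Fin (\<alpha> * z + \<beta>)) = U ** veronese_model n z ** ctranspose U"
proof -
  interpret F: rank_one_holo_proj "P \<circ> Fin" K by fact
  interpret I: holo_proj "P \<circ> chart_infty" by fact
  have Fpos: "F.energy z > 0" for z by (rule F.energy_pos[OF F.nondeg])
  have Ipos: "I.energy z > 0" for z by (rule I.energy_pos[OF I(2)])
  define U where "U = (\<lambda>z. inverse (sqrt (F.energy z)))"
  define V where "V = (\<lambda>z. inverse (sqrt (I.energy z)))"
  define u where "u = (\<lambda>z. complex_of_real (U z))"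
  have smU: "smooth U" unfolding U_def by (intro smooth_intros Fpos)
  have smV: "smooth V" unfolding V_def by (intro smooth_intros Ipos)
  have smu: "smooth u" unfolding u_def by (intro smooth_intros smU)
  have Upos: "U z > 0" and Vpos: "V z > 0" for z
    using Fpos[of z] Ipos[of z] by (simp_all add: U_def V_def)
  have UV: "U z = (norm z)\<^sup>2 * V (1 / z)" if z: "z \<noteq> 0" for z
  proof -
    have G: "(P \<circ> Fin) z = (P \<circ> chart_infty) (1 / z)" if "z \<noteq> 0" for z
      using that by (simp add: chart_infty_def)
    have d: "d_z (P \<circ> Fin) z = cscale (- (1 / z\<^sup>2)) (d_z (P \<circ> chart_infty) (1 / z))"
      "d_zbar (P \<circ> Fin) z = cscale (- (1 / (cnj z)\<^sup>2)) (d_zbar (P \<circ> chart_infty) (1 / z))"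
      by (rule d_z_compose_reciprocal[OF I.smooth_P z], erule G)+
    have "complex_of_real (F.energy z) = 1 / z\<^sup>2 * (1 / (cnj z)\<^sup>2) * of_real (I.energy (1 / z))"
      unfolding F.of_real_energy I.of_real_energy d by simp
    also have "1 / z\<^sup>2 * (1 / (cnj z)\<^sup>2) = of_real (1 / ((norm z)\<^sup>2)\<^sup>2)"
      unfolding of_real_divide of_real_power[of "(norm z)\<^sup>2" 2] complex_norm_square
      by (simp add: power_mult_distrib power2_eq_square)
    finally have "F.energy z = 1 / ((norm z)\<^sup>2)\<^sup>2 * I.energy (1 / z)"
      unfolding of_real_mult[symmetric] of_real_eq_iff .
    then have "sqrt (F.energy z) = sqrt (I.energy (1 / z)) / (norm z)\<^sup>2"
      by (simp only: real_sqrt_mult real_sqrt_divide real_sqrt_abs real_sqrt_one) simp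
    then show ?thesis unfolding U_def V_def by (simp add: field_simps)
  qed
  have eu: "F.e z * (u z * u z) = 1" for z
  proof -
    have "F.energy z * (U z * U z) = 1"
      using Fpos[of z] by (simp add: U_def field_simps)
    then show ?thesis unfolding F.e_def u_def by (metis of_real_mult of_real_1)
  qed
  have curv: "F.e z * dzb (dz F.e) z - dz F.e z * dzb F.e z = - of_real (K / 2) * F.e z ^ 3" for z
    using F.curvature[of z] unfolding F.e_def[abs_def] .
  have pde: "u z * dzb (dz u) z - dz u z * dzb u z = of_real (K / 4)" for z
    using curvature_inverse_sqrt[OF F.sm_e smu eu curv, of z] by (simp add: field_simps)
  have K: "K = 4 \<or> K = 2" using F.curvature_cases by auto
  then have "K / 4 > 0" by auto
  then obtain a b c where abc: "a > 0" "c > 0" "a * c - (norm b)\<^sup>2 = K / 4"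
    "\<And>z. u z = of_real a + b * z + cnj b * cnj z + of_real c * (z * cnj z)"
    using quadratic_of_spherical_density[OF smU Upos smV Vpos UV u_def pde] by metis
  \<comment> \<open>Completing the square: with center \<beta> = - cnj b / c the form is c |z -
    \<beta>|^2 + (K/4) / c, and scaling by r = sqrt (K/4) / c makes the two coefficients
    equal.\<close>
  define r where "r = sqrt (K / 4) / c"
  have r: "r \<noteq> 0" "r\<^sup>2 = K / 4 / c\<^sup>2"
    using K abc(2) by (auto simp: r_def power_divide)
  define \<alpha> where "\<alpha> = complex_of_real r"
  define \<beta> where "\<beta> = - cnj b / of_real c"
  have cnj\<alpha>: "cnj \<alpha> = \<alpha>" by (simp add: \<alpha>_def)
  have \<alpha>: "\<alpha> \<noteq> 0" using r by (simp add: \<alpha>_def)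
  have \<alpha>2: "\<alpha> * \<alpha> = of_real (K / 4) / (of_real c)\<^sup>2"
  proof -
    have "\<alpha> * \<alpha> = of_real (r\<^sup>2)" by (simp add: \<alpha>_def power2_eq_square)
    also have "\<dots> = of_real (K / 4) / (of_real c)\<^sup>2" unfolding r(2) by simp
    finally show ?thesis .
  qed
  have c0: "complex_of_real c \<noteq> 0" using abc(2) by simp
  have ac: "of_real a * of_real c - b * cnj b = complex_of_real (K / 4)"
    unfolding abc(3)[symmetric] of_real_diff complex_norm_square by simp
  have u_aff: "u (\<alpha> * z + \<beta>) = of_real (K / 4) / of_real c * sph z" for z
  proof -
    have \<beta>: "of_real c * \<beta> = - cnj b" "of_real c * cnj \<beta> = - b"
      using c0 by (simp_all add: \<beta>_def)
    have "of_real c * u (\<alpha> * z + \<beta>) = of_real (K / 4) * sph z"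
      unfolding abc(4) sph_def complex_cnj_add complex_cnj_mult cnj\<alpha>
    proof -
      have "\<alpha> * \<alpha> * (of_real c)\<^sup>2 = of_real (K / 4)" using c0 by (simp add: \<alpha>2)
      with \<beta> ac show "of_real c * (of_real a + b * (\<alpha> * z + \<beta>) + cnj b * (\<alpha> * cnj z + cnj \<beta>) +
          of_real c * ((\<alpha> * z + \<beta>) * (\<alpha> * cnj z + cnj \<beta>))) = of_real (K / 4) * (1 + z * cnj z)"
        by algebra
    qed
    then show ?thesis using c0 by (simp add: field_simps)
  qed
  define P' where "P' = (\<lambda>z. (P \<circ> Fin) (\<alpha> * z + \<beta>))"
  have hP': "holo_proj P'" unfolding P'_def by (rule holo_proj_affine[OF F.holo_proj_axioms \<alpha>])
  interpret H: holo_proj P' by (rule hP')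
  have dP': "d_z P' = (\<lambda>z. cscale \<alpha> (d_z (P \<circ> Fin) (\<alpha> * z + \<beta>)))"
    "d_zbar P' = (\<lambda>z. cscale \<alpha> (d_zbar (P \<circ> Fin) (\<alpha> * z + \<beta>)))"
    unfolding P'_def using wirtinger_affine[OF F.smooth_P, of \<alpha> \<beta>] by (simp_all add: cnj\<alpha>)
  have en: "complex_of_real (H.energy z) = \<alpha> * \<alpha> * F.e (\<alpha> * z + \<beta>)" for z
    unfolding H.of_real_energy F.e_def F.of_real_energy dP' by simp
  interpret R: rank_one_holo_proj P' K
  proof unfold_locales
    show "trace (P' z) = 1" for z unfolding P'_def by (rule F.rank_one)
    show "d_z P' z \<noteq> 0" for z using F.nondeg[of "\<alpha> * z + \<beta>"] by (simp add: dP' \<alpha>)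
    show "of_real (H.energy z) * dzb (dz (\<lambda>z. of_real (H.energy z))) z
      - dz (\<lambda>z. of_real (H.energy z)) z * dzb (\<lambda>z. of_real (H.energy z)) z
      = - of_real (K / 2) * of_real (H.energy z) ^ 3" for z
    proof -
      note sm = F.sm_e smooth_compose_affine smooth_const smooth_wirtinger(3)[OF F.sm_e]
      have 1: "dz (\<lambda>z. \<alpha> * \<alpha> * F.e (\<alpha> * z + \<beta>)) = (\<lambda>z. \<alpha> * \<alpha> * (\<alpha> * dz F.e (\<alpha> * z + \<beta>)))"
        "dzb (\<lambda>z. \<alpha> * \<alpha> * F.e (\<alpha> * z + \<beta>)) = (\<lambda>z. \<alpha> * \<alpha> * (\<alpha> * dzb F.e (\<alpha> * z + \<beta>)))"
        by (simp_all add: wirtinger_mult wirtinger_const wirtinger_affine_scalar sm cnj\<alpha>)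
      have 2: "dzb (\<lambda>z. \<alpha> * \<alpha> * (\<alpha> * dz F.e (\<alpha> * z + \<beta>))) z = \<alpha> * \<alpha> * (\<alpha> * (\<alpha> * dzb (dz F.e) (\<alpha> * z + \<beta>)))"
        by (simp add: wirtinger_mult wirtinger_const wirtinger_affine_scalar sm smooth_mult cnj\<alpha>)
      show ?thesis unfolding en 1 2 using curv[of "\<alpha> * z + \<beta>"] by algebra
    qed
  qed
  define n :: nat where "n = (if K = 4 then 1 else 2)"
  have nK: "(n = 1 \<and> K = 4) \<or> (n = 2 \<and> K = 2)" using K by (auto simp: n_def)
  have nk: "of_nat n * complex_of_real (K / 4) = 1" using nK by auto
  \<comment> \<open>Since e = 1 / u^2, the rescaled density is \<alpha>^2 / u^2 = (4/K) / sph^2, and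
    n = 4/K.\<close>
  have round: "R.e z * sph z ^ 2 = of_nat n" for z
  proof -
    have "R.e z = \<alpha> * \<alpha> * F.e (\<alpha> * z + \<beta>)" unfolding R.e_def by (rule en)
    moreover have "\<alpha> * \<alpha> * (of_real c)\<^sup>2 = of_real (K / 4)" using c0 by (simp add: \<alpha>2)
    moreover have "of_real c * u (\<alpha> * z + \<beta>) = of_real (K / 4) * sph z"
      using c0 by (simp add: u_aff)
    moreover note eu[of "\<alpha> * z + \<beta>"] nk
    ultimately have "(of_real (K / 4))\<^sup>2 * (R.e z * sph z ^ 2 - of_nat n) = 0"
      by algebra
    then show ?thesis using K by auto
  qed
  obtain W where W: "W \<in> unitary_group" "\<And>z. P' z = W ** veronese_model n z ** ctranspose W"
    by (rule R.rigidity[OF nK round]) (rule that)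
  show ?thesis
    by (rule that[OF _ \<alpha> W(1)]) (use nK W(2) in \<open>auto simp: P'_def\<close>)
qed

section \<open>The Veronese maps on the sphere\<close>

text \<open>A holomorphic subbundle over the whole sphere whose reflection is an immersion: by
  \<open>inj_derivative_F\<close>, nonvanishing of \<open>d_z\<close> is injectivity of the
  differential.\<close>

definition holo_sphere :: "(riemann_sphere \<Rightarrow> 'n::finite cmat) \<Rightarrow> bool" where
  "holo_sphere P \<longleftrightarrow> (\<forall>c\<in>charts. holo_proj (P \<circ> c) \<and> (\<forall>z. d_z (P \<circ> c) z \<noteq> 0))"

lemma holo_proj_congruence:
  assumes "holo_proj P" "U \<in> unitary_group"
  shows "holo_proj (\<lambda>z. U ** P z ** ctranspose U)"
    "d_z (\<lambda>z. U ** P z ** ctranspose U) z = U ** d_z P z ** ctranspose U"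
proof -
  interpret holo_proj P by fact
  note U = unitary_groupD[OF assms(2)]
  have d: "d_z (\<lambda>z. U ** P z ** ctranspose U) = (\<lambda>z. U ** d_z P z ** ctranspose U)"
    by (simp add: wirtinger_mmult wirtinger_const smooth_P smooth_mmult smooth_const)
  then show "d_z (\<lambda>z. U ** P z ** ctranspose U) z = U ** d_z P z ** ctranspose U" by simp
  have prod: "(U ** X ** ctranspose U) ** (U ** Y ** ctranspose U) = U ** (X ** Y) ** ctranspose U" for X Y
    by (simp only: matrix_mul_assoc U(4))
  show "holo_proj (\<lambda>z. U ** P z ** ctranspose U)"
    by unfold_locales
      (intro smooth_intros smooth_P, simp add: herm matrix_mul_assoc, simp only: prod idem,
       simp only: d prod hol mmult_zero)
qed

text \<open>The complement of a holomorphic subbundle is antiholomorphic, and complex conjugation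
  makes it holomorphic again. In C^3 this exchanges ranks 1 and 2.\<close>

lemma holo_proj_dual:
  assumes "holo_proj P"
  shows "holo_proj (\<lambda>z. mat 1 - mconj (P z))"
    "d_z (\<lambda>z. mat 1 - mconj (P z)) z = - mconj (d_zbar P z)"
proof -
  interpret holo_proj P by fact
  have d: "d_z (\<lambda>z. mat 1 - mconj (P z)) = (\<lambda>z. - mconj (d_zbar P z))"
    by (simp add: wirtinger_diff wirtinger_linear wirtinger_const smooth_P smooth_mconj smooth_const)
  then show "d_z (\<lambda>z. mat 1 - mconj (P z)) z = - mconj (d_zbar P z)" by simp
  have ct: "ctranspose (mconj (P z)) = mconj (P z)" for z
    by (simp only: mconj_simps(8)[symmetric] herm)
  have pp: "mconj (P z) ** mconj (P z) = mconj (P z)" "mconj (P z) ** mconj (d_zbar P z) = mconj (d_zbar P z)" for z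
    by (simp_all only: mconj_simps(7)[symmetric] idem P_mult_d_zbar)
  show "holo_proj (\<lambda>z. mat 1 - mconj (P z))"
    by unfold_locales
      (intro smooth_intros smooth_P, simp add: ct, simp add: mmult_distrib pp, simp add: d mmult_distrib pp)
qed

lemma holo_sphere_congruence:
  assumes "holo_sphere P" and U: "U \<in> unitary_group"
  shows "holo_sphere (\<lambda>p. U ** P p ** ctranspose U)"
  unfolding holo_sphere_def
proof (intro ballI conjI allI)
  fix c z assume c: "c \<in> charts"
  then have P: "holo_proj (P \<circ> c)" "d_z (P \<circ> c) z \<noteq> 0" using assms(1) by (auto simp: holo_sphere_def)
  have eq: "(\<lambda>p. U ** P p ** ctranspose U) \<circ> c = (\<lambda>z. U ** (P \<circ> c) z ** ctranspose U)" by auto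
  show "holo_proj ((\<lambda>p. U ** P p ** ctranspose U) \<circ> c)"
    unfolding eq by (rule holo_proj_congruence[OF P(1) U])
  have "ctranspose U ** (U ** d_z (P \<circ> c) z ** ctranspose U) ** U = d_z (P \<circ> c) z"
    by (simp add: matrix_mul_assoc unitary_groupD[OF U])
  then show "d_z ((\<lambda>p. U ** P p ** ctranspose U) \<circ> c) z \<noteq> 0"
    unfolding eq holo_proj_congruence(2)[OF P(1) U] using P(2) by auto
qed

lemma holo_sphere_dual:
  assumes "holo_sphere P"
  shows "holo_sphere (\<lambda>p. mat 1 - mconj (P p))"
  unfolding holo_sphere_def
proof (intro ballI conjI allI)
  fix c z assume c: "c \<in> charts"
  then have P: "holo_proj (P \<circ> c)" "d_z (P \<circ> c) z \<noteq> 0" using assms(1) by (auto simp: holo_sphere_def)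
  interpret holo_proj "P \<circ> c" by (rule P)
  have eq: "(\<lambda>p. mat 1 - mconj (P p)) \<circ> c = (\<lambda>z. mat 1 - mconj ((P \<circ> c) z))" by auto
  show "holo_proj ((\<lambda>p. mat 1 - mconj (P p)) \<circ> c)"
    unfolding eq by (rule holo_proj_dual[OF P(1)])
  show "d_z ((\<lambda>p. mat 1 - mconj (P p)) \<circ> c) z \<noteq> 0"
    unfolding eq holo_proj_dual(2)[OF P(1)] using P(2) by (simp add: d_zbar_eq)
qed

lemma minimal_immersion_holo_sphere:
  assumes P: "holo_sphere P" and Q: "Q \<in> unitary_group"
  shows "minimal_immersion (\<lambda>p. Q ** (cscale 2 (P p) - mat 1))"
proof -
  let ?\<psi> = "\<lambda>p. Q ** (cscale 2 (P p) - mat 1)"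
  have chart: "smooth (?\<psi> \<circ> c) \<and> ?\<psi> (c z) \<in> unitary_group \<and> inj (frechet_derivative (?\<psi> \<circ> c) (at z)) \<and>
      zero_mean_curvature (?\<psi> \<circ> c) z" if "c \<in> charts" for c z
  proof -
    have H: "holo_proj (P \<circ> c)" and nz: "d_z (P \<circ> c) z \<noteq> 0" using P that by (auto simp: holo_sphere_def)
    interpret holo_proj "P \<circ> c" by (rule H)
    have F: "?\<psi> \<circ> c = (\<lambda>z. Q ** reflection z)" by (auto simp: reflection_def)
    show ?thesis
      using smooth_F[OF Q F] F_unitary[OF Q F, of z] inj_derivative_F[OF Q F, of z] zero_mean_curvature_F[OF Q F nz] nz
      by simp
  qed
  have "?\<psi> p \<in> unitary_group" for p
  proof (cases p)
    case (Fin z)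
    then show ?thesis using chart[of Fin z] by (simp add: charts_def)
  next
    case Infty
    then show ?thesis using chart[of chart_infty 0] by (simp add: charts_def chart_infty_def)
  qed
  then show ?thesis
    using chart unfolding minimal_immersion_def immersion_def smooth_to_U_def sphere_smooth_def by blast
qed

text \<open>One parametrisation for both curves, with (p, q) = (1, 0) for n = 1 and (sqrt 2, 1) for
  n = 2, so that lengths and holomorphy are verified once.\<close>

lemma veronese_curve_12:
  assumes "n = 1 \<or> n = 2"
  obtains p q :: real where "p \<noteq> 0" "\<And>z. veronese_curve n z = vector [1, of_real p * z, of_real q * (z * z)]"
    "\<And>z. sph z ^ n = 1 + of_real (p * p) * (z * cnj z) + of_real (q * q) * (z * cnj z) ^ 2"
  using assms
proof (elim disjE)
  assume "n = 1"
  then show ?thesis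
    by (intro that[of 1 0]) (auto simp: vec_eq_iff forall_3 veronese_curve_nth[unfolded One_nat_def] sph_def)
next
  assume "n = 2"
  then show ?thesis
    by (intro that[of "sqrt 2" 1]) (auto simp: vec_eq_iff forall_3 veronese_curve_nth sph_def power2_eq_square algebra_simps)
qed

lemma hinner_veronese_curve:
  assumes "n = 1 \<or> n = 2"
  shows "hinner (veronese_curve n z) (veronese_curve n z) = sph z ^ n"
proof -
  obtain p q :: real where pq: "p \<noteq> 0" "\<And>z. veronese_curve n z = vector [1, of_real p * z, of_real q * (z * z)]"
    "\<And>z. sph z ^ n = 1 + of_real (p * p) * (z * cnj z) + of_real (q * q) * (z * cnj z) ^ 2"
    using veronese_curve_12[OF assms] by metis
  show ?thesis unfolding pq by (simp add: hinner_def sum_3 power2_eq_square algebra_simps)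
qed

lemma veronese_model_holo:
  assumes n: "n = 1 \<or> n = 2"
  shows "holo_proj (veronese_model n)" "d_z (veronese_model n) z \<noteq> 0"
proof -
  obtain p q :: real where pq: "p \<noteq> 0" "\<And>z. veronese_curve n z = vector [1, of_real p * z, of_real q * (z * z)]"
    "\<And>z. sph z ^ n = 1 + of_real (p * p) * (z * cnj z) + of_real (q * q) * (z * cnj z) ^ 2"
    using veronese_curve_12[OF n] by metis
  define e1 :: "complex^3" where "e1 = vector [1, 0, 0]"
  define E where "E = outer e1 e1"
  define C1 where "C1 = outer (vector [0, of_real p, 0]) e1"
  define C2 where "C2 = outer (vector [0, 0, of_real q]) e1"
  \<comment> \<open>The Veronese curve as the first column of a matrix polynomial in z, so that the
    matrix rules for \<open>d_z\<close> apply to it.\<close>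
  define X where "X = (\<lambda>z. E + cscale z C1 + cscale (z * z) C2)"
  define X' where "X' = (\<lambda>z. C1 + cscale (2 * z) C2)"
  define r where "r = (\<lambda>z. complex_of_real (inverse (Re (sph z ^ n))))"
  have e1: "hinner e1 e1 = 1" by (simp add: e1_def hinner_def sum_3)
  have X: "X z = outer (veronese_curve n z) e1" for z
  proof (rule cmat_eqI)
    fix i j :: 3
    show "X z $ i $ j = outer (veronese_curve n z) e1 $ i $ j"
      using exhaust_3[of i] by (elim disjE; simp add: X_def E_def C1_def C2_def pq(2)) (simp_all add: e1_def)
  qed
  have XE: "X z ** E = X z" "X' z ** E = X' z" for z
    unfolding X_def X'_def E_def C1_def C2_def by (simp_all add: mmult_distrib outer_outer e1)
  have XsX: "ctranspose (X z) ** X z = cscale (sph z ^ n) E" for z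
    unfolding X ctranspose_outer outer_outer hinner_veronese_curve[OF n] E_def ..
  have smX: "smooth X" unfolding X_def by (intro smooth_intros)
  note sm = smX smooth_ctranspose smooth_mmult smooth_cscale smooth_const smooth_mult smooth_ident smooth_add
  have dX: "d_z X = X'" "d_zbar X = (\<lambda>z. 0)"
    unfolding X_def X'_def by (simp_all add: wirtinger_add wirtinger_cscale wirtinger_mult wirtinger_const sm)
  have Re_sph: "of_real (Re (sph z ^ n)) = sph z ^ n" for z
    by (simp only: sph_alt of_real_power[symmetric] Re_complex_of_real)
  have smr: "smooth r"
    unfolding r_def
  proof (intro smooth_intros)
    fix z show "Re (sph z ^ n) \<noteq> 0" using Re_sph[of z] by (metis of_real_0 power_not_zero sph_nonzero)
  qed
  have r: "r z * sph z ^ n = 1" for z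
    using Re_sph[of z] unfolding r_def by (metis of_real_inverse left_inverse power_not_zero sph_nonzero)
  have r': "1 / sph z ^ n = r z" for z using r[of z] by (simp add: field_simps)
  have M: "veronese_model n = (\<lambda>z. cscale (r z) (X z ** ctranspose (X z)))"
    unfolding veronese_model_def X ctranspose_outer outer_outer e1 r' by simp
  have dM: "d_z (veronese_model n) = (\<lambda>z. cscale (dz r z) (X z ** ctranspose (X z)) + cscale (r z) (X' z ** ctranspose (X z)))"
    unfolding M by (simp add: wirtinger_cscale wirtinger_mmult wirtinger_linear sm smr dX)
  have XsX': "ctranspose (X z) ** X' z = cscale (dz (\<lambda>z. sph z ^ n) z) E" for z
  proof -
    have "d_z (\<lambda>z. ctranspose (X z) ** X z) z = ctranspose (X z) ** X' z"
      by (simp add: wirtinger_mmult wirtinger_linear sm dX)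
    moreover have "d_z (\<lambda>z. cscale (sph z ^ n) E) z = cscale (dz (\<lambda>z. sph z ^ n) z) E"
      by (simp add: wirtinger_cscale wirtinger_const smooth_power smooth_sph smooth_const)
    ultimately show ?thesis by (simp only: XsX)
  qed
  have dr: "dz r z * sph z ^ n + r z * dz (\<lambda>z. sph z ^ n) z = 0" for z
  proof -
    have "dz (\<lambda>z. r z * sph z ^ n) z = 0" by (simp only: r wirtinger_const)
    then show ?thesis by (simp only: wirtinger_mult smr smooth_power smooth_sph)
  qed
  note assoc = XE[THEN mmult_eq_assoc] XsX[THEN mmult_eq_assoc] XsX'[THEN mmult_eq_assoc]
  have XEs: "E ** ctranspose (X z) = ctranspose (X z)" for z
    unfolding X E_def ctranspose_outer outer_outer e1 by simp
  show "holo_proj (veronese_model n)"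
  proof unfold_locales
    show "smooth (veronese_model n)" unfolding M by (intro smooth_intros smr smX)
    show "ctranspose (veronese_model n z) = veronese_model n z" for z
      unfolding M by (simp add: r_def)
    show "veronese_model n z ** veronese_model n z = veronese_model n z" for z
      unfolding M using r[of z]
      by (simp only: cscale_simps matrix_mul_assoc[symmetric] assoc XEs mult.assoc)
    \<comment> \<open>The bracket is the derivative of r sph^n = 1, hence zero.\<close>
    have "veronese_model n z ** d_z (veronese_model n) z =
      cscale (r z * (dz r z * sph z ^ n + r z * dz (\<lambda>z. sph z ^ n) z)) (X z ** ctranspose (X z))" for z
      unfolding dM unfolding M
      by (simp only: cscale_simps mmult_distrib matrix_mul_assoc[symmetric] assoc XEs)
        (rule cmat_eqI, simp add: algebra_simps)
    then show "veronese_model n z ** d_z (veronese_model n) z = 0" for z by (simp add: dr)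
  qed
  show "d_z (veronese_model n) z \<noteq> 0"
  proof
    assume "d_z (veronese_model n) z = 0"
    then have "d_z (veronese_model n) z ** X z = 0" by simp
    then have "cscale (sph z ^ n) (cscale (dz r z) (X z) + cscale (r z) (X' z)) = 0"
      unfolding dM by (simp only: mmult_distrib cscale_simps matrix_mul_assoc[symmetric] XsX XE cscale_right_distrib mult.commute)
    then have 0: "cscale (dz r z) (X z) + cscale (r z) (X' z) = 0" by simp
    \<comment> \<open>The first coordinate of the curve is constant and forces dz r = 0; the second
      then forces r p = 0.\<close>
    have "X z $ 1 $ 1 = 1" "X' z $ 1 $ 1 = 0" "X' z $ 2 $ 1 = of_real p" "X z $ 2 $ 1 = of_real p * z"
      by (simp_all add: X_def X'_def E_def C1_def C2_def e1_def)
    then have "dz r z = 0" "r z * of_real p = 0"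
      using arg_cong[OF 0, of "\<lambda>Y. Y $ 1 $ 1"] arg_cong[OF 0, of "\<lambda>Y. Y $ 2 $ 1"] by simp_all
    then show False using r[of z] pq(1) by auto
  qed
qed

text \<open>\<open>reversal n\<close> reverses the first \<open>n + 1\<close> coordinates, which is how the Veronese curve transforms
  under \<open>z \<mapsto> 1 / z\<close>.\<close>

definition reversal :: "nat \<Rightarrow> 3 cmat" where
  "reversal n = (if n = 1 then vector [vector [0, 1, 0], vector [1, 0, 0], vector [0, 0, 1]]
    else vector [vector [0, 0, 1], vector [0, 1, 0], vector [1, 0, 0]])"

lemma reversal_unitary: "reversal n \<in> unitary_group" "ctranspose (reversal n) = reversal n"
  by (auto simp: unitary_group_def reversal_def vec_eq_iff forall_3 mmult_nth sum_3 mat_def)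

text \<open>The value at infinity is the reversed value at 0, that is the line of the last
  coordinate of C^(n+1). With it one formula holds on the whole chart at infinity.\<close>

definition veronese_map :: "nat \<Rightarrow> riemann_sphere \<Rightarrow> 3 cmat" where
  "veronese_map n p = (case p of Fin z \<Rightarrow> veronese_model n z
    | Infty \<Rightarrow> reversal n ** veronese_model n 0 ** ctranspose (reversal n))"

lemma veronese_map_Fin: "veronese_map n (Fin z) = veronese_model n z"
  by (simp add: veronese_map_def)

lemma veronese_map_chart_infty:
  assumes n: "n = 1 \<or> n = 2"
  shows "veronese_map n (chart_infty w) = reversal n ** veronese_model n w ** ctranspose (reversal n)"
proof (cases "w = 0")
  case True
  then show ?thesis by (simp add: veronese_map_def chart_infty_def)
next
  case False
  have v: "reversal n *v veronese_curve n w = w ^ n *s veronese_curve n (1 / w)"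
    using n False
    by (elim disjE; simp add: vec_eq_iff forall_3 matrix_vector_mult_def sum_3 reversal_def veronese_curve_nth
        veronese_curve_nth[unfolded One_nat_def] power2_eq_square)
  have s: "sph (1 / w) ^ n * (w ^ n * cnj (w ^ n)) = sph w ^ n"
  proof -
    have "sph (1 / w) * (w * cnj w) = sph w" using False by (simp add: sph_def field_simps)
    then show ?thesis by (simp only: complex_cnj_power flip: power_mult_distrib)
  qed
  have "reversal n ** veronese_model n w ** ctranspose (reversal n) =
      cscale (1 / sph w ^ n * (w ^ n * cnj (w ^ n))) (outer (veronese_curve n (1 / w)) (veronese_curve n (1 / w)))"
    unfolding veronese_model_def
    by (simp add: outer_congruence[symmetric] v outer_vector_scalar)
  also have "1 / sph w ^ n * (w ^ n * cnj (w ^ n)) = 1 / sph (1 / w) ^ n"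
    using s[symmetric] False by (simp add: field_simps)
  finally show ?thesis using False by (simp add: chart_infty_def veronese_map_Fin veronese_model_def)
qed

lemma holo_sphere_veronese_map:
  assumes n: "n = 1 \<or> n = 2" shows "holo_sphere (veronese_map n)"
proof -
  have 1: "veronese_map n \<circ> Fin = veronese_model n" by (auto simp: veronese_map_Fin)
  have 2: "veronese_map n \<circ> chart_infty = (\<lambda>w. reversal n ** veronese_model n w ** ctranspose (reversal n))"
    by (auto simp: veronese_map_chart_infty[OF n])
  have U: "reversal n \<in> unitary_group" by (rule reversal_unitary)
  have "d_z (veronese_map n \<circ> chart_infty) z \<noteq> 0" for z
  proof
    assume "d_z (veronese_map n \<circ> chart_infty) z = 0"
    then have "reversal n ** d_z (veronese_model n) z ** ctranspose (reversal n) = 0"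
      unfolding 2 holo_proj_congruence(2)[OF veronese_model_holo(1)[OF n] U] .
    then have "ctranspose (reversal n) ** (reversal n ** d_z (veronese_model n) z ** ctranspose (reversal n)) ** reversal n = 0"
      by simp
    then show False using veronese_model_holo(2)[OF n, of z]
      by (simp add: matrix_mul_assoc unitary_groupD[OF U])
  qed
  moreover have "holo_proj (veronese_map n \<circ> chart_infty)"
    unfolding 2 by (rule holo_proj_congruence[OF veronese_model_holo(1)[OF n] U])
  ultimately show ?thesis
    using veronese_model_holo[OF n] by (auto simp: holo_sphere_def charts_def 1)
qed

section \<open>Fibres of the Veronese bundles\<close>

lemma hinner_matrix: "hinner (A *v x) y = hinner x (ctranspose A *v y)"
proof -
  have "hinner (A *v x) y = (\<Sum>i\<in>UNIV. \<Sum>j\<in>UNIV. A $ i $ j * x $ j * cnj (y $ i))"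
    by (simp add: hinner_def matrix_vector_mult_def sum_distrib_right)
  also have "\<dots> = (\<Sum>j\<in>UNIV. \<Sum>i\<in>UNIV. A $ i $ j * x $ j * cnj (y $ i))"
    by (rule sum.swap)
  also have "\<dots> = hinner x (ctranspose A *v y)"
    by (simp add: hinner_def matrix_vector_mult_def sum_distrib_left mult_ac)
  finally show ?thesis .
qed

lemma hinner_simps:
  "hinner (x + y) z = hinner x z + hinner y z" "hinner z (x + y) = hinner z x + hinner z y"
  "hinner (x - y) z = hinner x z - hinner y z"
  "hinner (c *s x) y = c * hinner x y" "hinner x (c *s y) = cnj c * hinner x y" "hinner x 0 = 0"
  by (simp_all add: hinner_def sum.distrib sum_subtractf sum_distrib_left algebra_simps)

lemma hinner_self_eq_0: assumes "hinner x x = 0" shows "x = 0"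
proof -
  have "hinner x x = of_real (\<Sum>i\<in>UNIV. (norm (x $ i))\<^sup>2)"
    by (simp only: hinner_def of_real_sum complex_norm_square)
  then have "(\<Sum>i\<in>UNIV. (norm (x $ i))\<^sup>2) = 0" using assms by (metis of_real_eq_0_iff)
  then show ?thesis by (simp add: sum_nonneg_eq_0_iff vec_eq_iff)
qed

text \<open>Subspaces are handled as fixed spaces of their orthogonal projections: sums, complements
  and limits of fibres become statements about matrices.\<close>

definition fixed_space :: "'n::finite cmat \<Rightarrow> (complex^'n) set" where
  "fixed_space Q = {x. Q *v x = x}"

lemma mvec_simps:
  fixes A B :: "'n::finite cmat"
  shows "(A + B) *v x = A *v x + B *v x" "(A - B) *v x = A *v x - B *v x" "A *v (x + y) = A *v x + A *v y"
    "A *v (x - y) = A *v x - A *v y" "mat 1 *v x = x" "A *v (B *v x) = (A ** B) *v x" "0 *v x = (0::complex^'n)"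
  by (simp_all add: matrix_vector_mult_add_rdistrib matrix_vector_mult_diff_rdistrib matrix_vector_right_distrib
      matrix_vector_mult_diff_distrib matrix_vector_mul_assoc)

lemma hperp_fixed_space:
  assumes Q: "orth_projection Q"
  shows "hperp (fixed_space Q) = fixed_space (mat 1 - Q)"
proof -
  have h: "ctranspose Q = Q" "Q ** Q = Q" using Q by (auto simp: orth_projection_def)
  have "(\<forall>y. Q *v y = y \<longrightarrow> hinner x y = 0) \<longleftrightarrow> Q *v x = 0" for x
  proof
    assume *: "\<forall>y. Q *v y = y \<longrightarrow> hinner x y = 0"
    have "hinner x (Q *v (Q *v x)) = 0" by (rule *[rule_format]) (simp add: mvec_simps h)
    then have "hinner (Q *v x) (Q *v x) = 0" by (simp add: hinner_matrix h)
    then show "Q *v x = 0" by (rule hinner_self_eq_0)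
  next
    assume *: "Q *v x = 0"
    show "\<forall>y. Q *v y = y \<longrightarrow> hinner x y = 0"
    proof (intro allI impI)
      fix y assume "Q *v y = y"
      then have "hinner x y = hinner (Q *v x) y" by (simp add: hinner_matrix h)
      then show "hinner x y = 0" by (simp add: * hinner_def)
    qed
  qed
  then show ?thesis by (auto simp: hperp_def fixed_space_def mvec_simps)
qed

lemma orth_proj_fixed_space:
  assumes Q: "orth_projection Q"
  shows "orth_proj (fixed_space Q) = Q"
  unfolding orth_proj_def
proof (rule the_equality)
  have h: "ctranspose Q = Q" "Q ** Q = Q" using Q by (auto simp: orth_projection_def)
  show "\<forall>x. Q *v x \<in> fixed_space Q \<and> x - Q *v x \<in> hperp (fixed_space Q)"
    unfolding hperp_fixed_space[OF Q] by (simp add: fixed_space_def mvec_simps h)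
  fix P assume P: "\<forall>x. P *v x \<in> fixed_space Q \<and> x - P *v x \<in> hperp (fixed_space Q)"
  have "P *v x = Q *v x" for x
  proof -
    have "Q *v (P *v x) = P *v x" "Q *v (x - P *v x) = 0"
      using P[rule_format, of x] unfolding hperp_fixed_space[OF Q] by (simp_all add: fixed_space_def mvec_simps)
    then show ?thesis by (simp add: mvec_simps)
  qed
  then show "P = Q" by (simp add: matrix_eq)
qed

lemma bundle_perp_fixed_space:
  "orth_projection Q \<Longrightarrow> Y p = fixed_space Q \<Longrightarrow> bundle_perp Y p = fixed_space (mat 1 - Q)"
  by (simp add: bundle_perp_def hperp_fixed_space)

lemma bundle_map_fixed_space:
  assumes "orth_projection Q" "Y p = fixed_space Q"
  shows "bundle_map Y p = cscale 2 Q - mat 1"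
  unfolding bundle_map_def bundle_perp_fixed_space[where Y=Y and p=p, OF assms] assms(2)
    orth_proj_fixed_space[OF assms(1)] orth_proj_fixed_space[OF orth_projection_complement[OF assms(1)]]
  by (rule cmat_eqI) simp

lemma bundle_sum_fixed_space:
  assumes "orth_projection Q" "orth_projection R" "Q ** R = 0"
    and X: "X p = fixed_space Q" and Y: "Y p = fixed_space R"
  shows "bundle_sum X Y p = fixed_space (Q + R)" "orth_projection (Q + R)"
proof -
  have h: "ctranspose Q = Q" "Q ** Q = Q" "ctranspose R = R" "R ** R = R"
    using assms by (auto simp: orth_projection_def)
  have RQ: "R ** Q = 0" using arg_cong[OF assms(3), of ctranspose] by (simp add: h)
  show "orth_projection (Q + R)"
    by (simp add: orth_projection_def h mmult_distrib RQ assms(3))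
  have sub: "x + y \<in> fixed_space (Q + R)" if "x \<in> fixed_space Q" "y \<in> fixed_space R" for x y
  proof -
    have 1: "Q *v x = x" "R *v y = y" using that by (auto simp: fixed_space_def)
    have "Q *v (R *v y) = 0" "R *v (Q *v x) = 0" by (simp_all add: mvec_simps assms(3) RQ)
    then show ?thesis by (simp add: 1 fixed_space_def mvec_simps(1,3))
  qed
  have sup: "\<exists>x y. z = x + y \<and> x \<in> fixed_space Q \<and> y \<in> fixed_space R" if "z \<in> fixed_space (Q + R)" for z
    using that by (intro exI[of _ "Q *v z"] exI[of _ "R *v z"])
      (simp add: fixed_space_def mvec_simps h)
  show "bundle_sum X Y p = fixed_space (Q + R)"
    unfolding bundle_sum_def X Y using sub sup by blast
qed

lemma holo_sphere_orth: assumes "holo_sphere P" shows "orth_projection (P p)" "continuous_on UNIV (P \<circ> chart_infty)"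
proof -
  have H: "holo_proj (P \<circ> Fin)" "holo_proj (P \<circ> chart_infty)"
    using assms by (auto simp: holo_sphere_def charts_def)
  from holo_proj.herm[OF this(1)] holo_proj.idem[OF this(1)] holo_proj.herm[OF this(2), of 0] holo_proj.idem[OF this(2), of 0]
  show "orth_projection (P p)" by (cases p) (auto simp: orth_projection_def chart_infty_def)
  show "continuous_on UNIV (P \<circ> chart_infty)" by (rule smooth_continuous[OF holo_proj.smooth_P[OF H(2)]])
qed

text \<open>As \<open>Q\<close> is continuous at infinity, limits of vectors fixed by
  \<open>Q\<close> are fixed by its limit. Conversely, a vector v fixed by the limit is approached
  by the section that projects v to each fibre.\<close>

lemma veronese_fixed_space:
  assumes fin: "\<And>z. veronese_fin n i z = fixed_space (Q (Fin z))"
    and orth: "\<And>z. orth_projection (Q (Fin z))" and cont: "continuous_on UNIV (Q \<circ> chart_infty)"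
  shows "veronese n i p = fixed_space (Q p)"
proof (cases p)
  case (Fin z)
  then show ?thesis by (simp add: fin)
next
  case Infty
  have inf: "((\<lambda>z::complex. 1 / z) \<longlongrightarrow> 0) at_infinity"
    using tendsto_inverse_0[where 'a=complex] unfolding inverse_eq_divide[abs_def] .
  have "isCont (Q \<circ> chart_infty) 0" using cont continuous_on_eq_continuous_at[of UNIV "Q \<circ> chart_infty"] by blast
  from isCont_tendsto_compose[OF this inf]
  have "((\<lambda>z. Q (chart_infty (1 / z))) \<longlongrightarrow> Q Infty) at_infinity" by (simp add: chart_infty_def)
  moreover have "eventually (\<lambda>z. Q (chart_infty (1 / z)) = Q (Fin z)) at_infinity"
    unfolding eventually_at_infinity by (intro exI[of _ 1]) (auto simp: chart_infty_def)
  ultimately have lim: "((\<lambda>z. Q (Fin z)) \<longlongrightarrow> Q Infty) at_infinity"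
    by (rule Lim_transform_eventually)
  have bb: "bounded_bilinear ((*v) :: 3 cmat \<Rightarrow> _)"
    unfolding bilinear_conv_bounded_bilinear[symmetric]
    by (auto simp: bilinear_def scaleR_cmat mvec_simps cscale_mult_vec intro!: linearI)
      (simp_all add: vec_eq_iff matrix_vector_mult_def scaleR_sum_right scaleR_conv_of_real[where 'a=complex])
  have "(\<exists>s. (\<forall>z. s z \<in> fixed_space (Q (Fin z))) \<and> (s \<longlongrightarrow> v) at_infinity) \<longleftrightarrow> Q Infty *v v = v" for v
  proof
    assume "\<exists>s. (\<forall>z. s z \<in> fixed_space (Q (Fin z))) \<and> (s \<longlongrightarrow> v) at_infinity"
    then obtain s where s: "\<And>z. Q (Fin z) *v s z = s z" "(s \<longlongrightarrow> v) at_infinity"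
      by (auto simp: fixed_space_def)
    have "((\<lambda>z. Q (Fin z) *v s z) \<longlongrightarrow> Q Infty *v v) at_infinity"
      by (rule bounded_bilinear.tendsto[OF bb lim s(2)])
    then have "(s \<longlongrightarrow> Q Infty *v v) at_infinity" by (simp only: s(1))
    then show "Q Infty *v v = v" by (rule tendsto_unique[OF trivial_limit_at_infinity _ s(2)])
  next
    assume v: "Q Infty *v v = v"
    have "((\<lambda>z. Q (Fin z) *v v) \<longlongrightarrow> Q Infty *v v) at_infinity"
      by (rule bounded_bilinear.tendsto[OF bb lim tendsto_const])
    moreover have "Q (Fin z) *v v \<in> fixed_space (Q (Fin z))" for z
      using orth[of z] by (simp add: fixed_space_def mvec_simps orth_projection_def)
    ultimately show "\<exists>s. (\<forall>z. s z \<in> fixed_space (Q (Fin z))) \<and> (s \<longlongrightarrow> v) at_infinity"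
      unfolding v by (intro exI[of _ "\<lambda>z. Q (Fin z) *v v"]) simp
  qed
  then show ?thesis unfolding Infty veronese.simps fin by (auto simp: fixed_space_def)
qed

section \<open>Osculating spaces and the fibres over finite points\<close>

lemma outer_mult_vec: "outer v w *v x = hinner x w *s v"
  by (simp add: vec_eq_iff matrix_vector_mult_def hinner_def sum_distrib_left sum_distrib_right mult_ac)

lemma veronese_model_mult_vec:
  "veronese_model n z *v x = (hinner x (veronese_curve n z) / sph z ^ n) *s veronese_curve n z"
  by (simp add: veronese_model_def cscale_mult_vec outer_mult_vec vector_smult_assoc)

lemma veronese_curve_nonzero: "n = 1 \<or> n = 2 \<Longrightarrow> veronese_curve n z \<noteq> 0"
  using hinner_veronese_curve[of n z] by (auto simp: hinner_simps)

lemma veronese_model_eq_0: 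
  "n = 1 \<or> n = 2 \<Longrightarrow> veronese_model n z *v x = 0 \<longleftrightarrow> hinner x (veronese_curve n z) = 0"
  using veronese_curve_nonzero[of n z] by (simp add: veronese_model_mult_vec)

lemmas orth_veronese_map = holo_sphere_orth(1)[OF holo_sphere_veronese_map]
  and continuous_veronese_map = holo_sphere_orth(2)[OF holo_sphere_veronese_map]

lemma osculating_0: "osculating n 0 z = {0}"
  by (simp add: osculating_def)

lemma osculating_1: "osculating n 1 z = range (\<lambda>c. c *s veronese_curve n z)"
proof -
  have "{veronese_deriv n j z |j. j < 1} = {veronese_curve n z}"
    by (auto simp: veronese_deriv_def)
  then show ?thesis by (simp add: osculating_def vec.span_singleton)
qed

lemma veronese_deriv_1:
  "veronese_deriv 1 1 z = vector [0, 1, 0]" "veronese_deriv 2 1 z = vector [0, of_real (sqrt 2), 2 * z]"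
  by (auto simp: vec_eq_iff forall_3 veronese_deriv_def veronese_curve_nth veronese_curve_nth[unfolded One_nat_def]
      intro!: DERIV_imp_deriv derivative_eq_intros)

lemma osculating_2: "osculating n 2 z = {a *s veronese_curve n z + b *s veronese_deriv n 1 z |a b. True}"
proof -
  have "{veronese_deriv n j z |j. j < 2} = (\<lambda>j. veronese_deriv n j z) ` {0, 1}"
    by (auto simp: less_2_cases_iff)
  also have "\<dots> = {veronese_curve n z, veronese_deriv n 1 z}"
    by (simp add: veronese_deriv_def)
  finally have "{veronese_deriv n j z |j. j < 2} = {veronese_curve n z, veronese_deriv n 1 z}" .
  then have "osculating n 2 z = {x. \<exists>k. x - k *s veronese_curve n z \<in> range (\<lambda>c. c *s veronese_deriv n 1 z)}"
    unfolding osculating_def vec.span_insert[symmetric] vec.span_singleton[symmetric] by (simp only: vec.span_insert)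
  also have "\<dots> = {a *s veronese_curve n z + b *s veronese_deriv n 1 z |a b. True}"
    by (auto simp: image_iff diff_eq_eq) (metis add.commute)+
  finally show ?thesis .
qed

lemma veronese_fin_0:
  assumes n: "n = 1 \<or> n = 2"
  shows "veronese_fin n 0 z = fixed_space (veronese_model n z)"
proof -
  have "veronese_model n z *v x = x \<longleftrightarrow> x \<in> range (\<lambda>c. c *s veronese_curve n z)" for x
  proof
    assume "veronese_model n z *v x = x"
    then show "x \<in> range (\<lambda>c. c *s veronese_curve n z)"
      unfolding veronese_model_mult_vec by (metis rangeI)
  qed (auto simp: veronese_model_mult_vec hinner_simps hinner_veronese_curve[OF n])
  moreover have "hperp {0 :: complex^3} = UNIV" by (auto simp: hperp_def hinner_simps)
  ultimately show ?thesis
    unfolding veronese_fin_def osculating_0 One_nat_def[symmetric] osculating_1 by (auto simp: fixed_space_def)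
qed

lemma hperp_osculating_1:
  assumes n: "n = 1 \<or> n = 2"
  shows "hperp (osculating n 1 z) = {x. veronese_model n z *v x = 0}"
  unfolding veronese_model_eq_0[OF n] osculating_1 hperp_def
  by (auto simp: hinner_simps)

text \<open>The projection onto C^2 inside C^3, which is every fibre of V_0^1 + V_1^1.\<close>

definition plane :: "3 cmat" where
  "plane = vector [vector [1, 0, 0], vector [0, 1, 0], vector [0, 0, 0]]"

lemma orth_plane: "orth_projection plane"
  by (auto simp: orth_projection_def plane_def vec_eq_iff forall_3 mmult_nth sum_3)

lemma plane_mult_vec: "plane *v x = vector [x $ 1, x $ 2, 0]"
  by (simp add: plane_def vec_eq_iff forall_3 matrix_vector_mult_def sum_3)

lemma plane_model: "plane ** veronese_model 1 z = veronese_model 1 z"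
proof -
  have "plane *v veronese_curve 1 z = veronese_curve 1 z"
    by (simp add: plane_mult_vec vec_eq_iff forall_3 veronese_curve_nth[unfolded One_nat_def])
  then show ?thesis by (simp add: veronese_model_def mmult_outer)
qed

lemma plane_map: "plane ** veronese_map 1 p = veronese_map 1 p" "veronese_map 1 p ** plane = veronese_map 1 p"
proof -
  have comm: "plane ** reversal 1 = reversal 1 ** plane"
    by (auto simp: plane_def reversal_def vec_eq_iff forall_3 mmult_nth sum_3)
  show 1: "plane ** veronese_map 1 p = veronese_map 1 p"
  proof (cases p)
    case (Fin z)
    show ?thesis unfolding Fin veronese_map_Fin by (rule plane_model)
  next
    case Infty
    have "plane ** (reversal 1 ** veronese_model 1 0 ** Y) = reversal 1 ** veronese_model 1 0 ** Y" for Y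
    proof -
      have "plane ** (reversal 1 ** veronese_model 1 0 ** Y) = reversal 1 ** (plane ** veronese_model 1 0) ** Y"
        by (simp only: matrix_mul_assoc comm)
      then show ?thesis by (simp only: plane_model)
    qed
    then show ?thesis unfolding Infty veronese_map_def riemann_sphere.case .
  qed
  have "ctranspose (veronese_map 1 p) = veronese_map 1 p" "ctranspose plane = plane"
    using orth_veronese_map[of 1 p] orth_plane by (auto simp: orth_projection_def)
  then show "veronese_map 1 p ** plane = veronese_map 1 p"
    using arg_cong[OF 1, of ctranspose] by simp
qed

lemma veronese_fin_1_1: "veronese_fin 1 1 z = fixed_space (plane - veronese_model 1 z)"
proof -
  define M where "M = veronese_model 1 z"
  have M: "M ** plane = M" "M ** M = M" "plane ** M = M" "plane ** plane = plane"
    using plane_map[of "Fin z"] orth_veronese_map[OF disjI1[OF refl], of "Fin z"] orth_plane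
    by (auto simp: veronese_map_Fin orth_projection_def M_def)
  have osc: "x \<in> osculating 1 2 z \<longleftrightarrow> plane *v x = x" for x
  proof
    assume "x \<in> osculating 1 2 z"
    then show "plane *v x = x"
      unfolding osculating_2
      by (auto simp: plane_mult_vec veronese_deriv_1[unfolded One_nat_def] vec_eq_iff forall_3
          veronese_curve_nth[unfolded One_nat_def])
  next
    assume *: "plane *v x = x"
    then have "x $ 3 = 0" by (simp add: plane_mult_vec vec_eq_iff forall_3)
    then have "x = (x $ 1) *s veronese_curve 1 z + (x $ 2 - x $ 1 * z) *s veronese_deriv 1 1 z"
      by (simp add: veronese_deriv_1[unfolded One_nat_def] vec_eq_iff forall_3 veronese_curve_nth[unfolded One_nat_def])
    then show "x \<in> osculating 1 2 z" unfolding osculating_2 by blast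
  qed
  have "plane *v x = x \<and> M *v x = 0 \<longleftrightarrow> (plane - M) *v x = x" for x
  proof
    assume "(plane - M) *v x = x"
    then have 1: "plane *v x - M *v x = x" by (simp add: mvec_simps)
    have "M *v (plane *v x - M *v x) = 0" "plane *v (plane *v x - M *v x) = plane *v x - M *v x"
      by (simp_all add: mvec_simps M)
    then show "plane *v x = x \<and> M *v x = 0" unfolding 1 by simp
  qed (simp add: mvec_simps)
  then show ?thesis
    unfolding veronese_fin_def hperp_osculating_1[OF disjI1[OF refl]] M_def[symmetric] using osc
    by (auto simp: fixed_space_def numeral_2_eq_2)
qed

text \<open>The bilinear form with this matrix takes the value (z - w)^2 on the points f(z), f(w) of
  the Veronese curve in C^3. It vanishes to second order at w = z, so the flipped conjugate of f is
  orthogonal to f and to its derivative.\<close>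

definition flip :: "3 cmat" where
  "flip = vector [vector [0, 0, 1], vector [0, -1, 0], vector [1, 0, 0]]"

lemma flip_unitary: "flip \<in> unitary_group" "ctranspose flip = flip" "mconj flip = flip"
  by (auto simp: unitary_group_def flip_def vec_eq_iff forall_3 mmult_nth sum_3 mat_def)

text \<open>The projection onto \<open>V\<^sub>0 \<oplus> V\<^sub>1\<close>, obtained as the complement of \<open>V\<^sub>2\<close>, which is \<open>flip\<close> applied to the
  conjugate of \<open>V\<^sub>0\<close>.\<close>

definition second_osculating :: "riemann_sphere \<Rightarrow> 3 cmat" where
  "second_osculating p = mat 1 - mconj (flip ** veronese_map 2 p ** ctranspose flip)"

lemma holo_sphere_second_osculating: "holo_sphere second_osculating"
  unfolding second_osculating_def[abs_def]
  by (intro holo_sphere_dual holo_sphere_congruence holo_sphere_veronese_map flip_unitary) simp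

lemma second_osculating_Fin:
  defines "w z \<equiv> vector [(cnj z)\<^sup>2, - of_real (sqrt 2) * cnj z, 1] :: complex^3"
  shows "second_osculating (Fin z) *v x = x \<longleftrightarrow> hinner x (w z) = 0"
    "second_osculating (Fin z) ** veronese_model 2 z = veronese_model 2 z"
proof -
  have "mconj (outer v v) = outer (\<chi> i. cnj (v $ i)) (\<chi> i. cnj (v $ i))" for v :: "complex^3"
    by (rule cmat_eqI) simp
  moreover have "(\<chi> i. cnj ((flip *v veronese_curve 2 z) $ i)) = w z"
    by (simp add: w_def vec_eq_iff forall_3 flip_def matrix_vector_mult_def sum_3 veronese_curve_nth)
  ultimately have S: "second_osculating (Fin z) = mat 1 - cscale (1 / sph z ^ 2) (outer (w z) (w z))"
    unfolding second_osculating_def veronese_map_Fin veronese_model_def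
    by (simp add: outer_congruence[symmetric])
  have "w z \<noteq> 0" by (simp add: w_def vec_eq_iff forall_3)
  then show "second_osculating (Fin z) *v x = x \<longleftrightarrow> hinner x (w z) = 0"
    unfolding S by (simp add: mvec_simps cscale_mult_vec outer_mult_vec vector_smult_assoc)
  have "complex_of_real (sqrt 2) * of_real (sqrt 2) = 2" by (simp flip: of_real_mult)
  then have "hinner (veronese_curve 2 z) (w z) = 0"
    by (simp add: hinner_def sum_3 w_def veronese_curve_nth power2_eq_square algebra_simps)
  then show "second_osculating (Fin z) ** veronese_model 2 z = veronese_model 2 z"
    unfolding S veronese_model_def by (simp add: mmult_distrib outer_outer)
qed

lemma veronese_fin_2_1: "veronese_fin 2 1 z = fixed_space (second_osculating (Fin z) - veronese_model 2 z)"
proof -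
  let ?M = "veronese_model 2 z" and ?S = "second_osculating (Fin z)"
  have SM: "?S ** ?M = ?M" by (rule second_osculating_Fin)
  have orth: "orth_projection ?S" "orth_projection ?M"
    using holo_sphere_orth(1)[OF holo_sphere_second_osculating] orth_veronese_map[of 2 "Fin z"]
    by (auto simp: veronese_map_Fin)
  then have M: "?M ** ?S = ?M" "?M ** ?M = ?M" "?S ** ?S = ?S"
    using arg_cong[OF SM, of ctranspose] by (auto simp: orth_projection_def)
  have sq: "complex_of_real (sqrt 2) * of_real (sqrt 2) = 2" "complex_of_real (sqrt 2) \<noteq> 0"
    by (simp_all flip: of_real_mult)
  have osc: "x \<in> osculating 2 2 z \<longleftrightarrow> ?S *v x = x" for x
  proof
    assume "x \<in> osculating 2 2 z"
    then obtain a b where "x = a *s veronese_curve 2 z + b *s veronese_deriv 2 1 z"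
      unfolding osculating_2 by blast
    \<comment> \<open>The orthogonality relation with sqrt 2 abstracted to \<open>s\<close>; it has
      the factor 2 - s^2.\<close>
    moreover have "a * z\<^sup>2 - s * z * (a * (s * z) + b * s) + (a * z\<^sup>2 + b * (2 * z)) = 0" if "s * s = 2" for s :: complex
    proof -
      have "a * z\<^sup>2 - s * z * (a * (s * z) + b * s) + (a * z\<^sup>2 + b * (2 * z)) = (a * z\<^sup>2 + b * z) * (2 - s * s)"
        by (simp add: algebra_simps power2_eq_square)
      then show ?thesis using that by simp
    qed
    note this[OF sq(1)]
    ultimately show "?S *v x = x"
      unfolding second_osculating_Fin
      by (simp add: hinner_def sum_3 veronese_curve_nth veronese_deriv_1[unfolded One_nat_def] algebra_simps)
  next
    assume "?S *v x = x"
    then have *: "x $ 1 * z\<^sup>2 - of_real (sqrt 2) * z * x $ 2 + x $ 3 = 0"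
      unfolding second_osculating_Fin by (simp add: hinner_def sum_3 algebra_simps)
    \<comment> \<open>The coefficient is read off from the second coordinate; the relation just
      obtained then gives the third.\<close>
    define b where "b = x $ 2 / of_real (sqrt 2) - x $ 1 * z"
    have b: "of_real (sqrt 2) * b = x $ 2 - of_real (sqrt 2) * z * x $ 1"
      using sq(2) by (simp add: b_def field_simps)
    have "x $ 3 = x $ 1 * z\<^sup>2 + b * (2 * z)"
      using * b sq(1) by algebra
    then have "x = (x $ 1) *s veronese_curve 2 z + b *s veronese_deriv 2 1 z"
      using b by (simp add: veronese_deriv_1[unfolded One_nat_def] vec_eq_iff forall_3 veronese_curve_nth algebra_simps)
    then show "x \<in> osculating 2 2 z" unfolding osculating_2 by blast
  qed
  have "?S *v x = x \<and> ?M *v x = 0 \<longleftrightarrow> (?S - ?M) *v x = x" for x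
  proof
    assume "(?S - ?M) *v x = x"
    then have 1: "?S *v x - ?M *v x = x" by (simp add: mvec_simps)
    have "?M *v (?S *v x - ?M *v x) = 0" "?S *v (?S *v x - ?M *v x) = ?S *v x - ?M *v x"
      by (simp_all add: mvec_simps M SM)
    then show "?S *v x = x \<and> ?M *v x = 0" unfolding 1 by simp
  qed (simp add: mvec_simps)
  then show ?thesis
    unfolding veronese_fin_def hperp_osculating_1[OF disjI2[OF refl]] using osc
    by (auto simp: fixed_space_def numeral_2_eq_2)
qed

lemma second_osculating_map: "second_osculating p ** veronese_map 2 p = veronese_map 2 p"
proof (cases p)
  case (Fin z)
  then show ?thesis by (simp add: veronese_map_Fin second_osculating_Fin)
next
  case Infty
  show ?thesis
    unfolding Infty by (auto simp: second_osculating_def veronese_map_def veronese_model_def reversal_def flip_def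
      vec_eq_iff forall_3 mmult_nth sum_3 mat_def veronese_curve_nth)
qed

lemma veronese_0: "n = 1 \<or> n = 2 \<Longrightarrow> veronese n 0 p = fixed_space (veronese_map n p)"
  by (rule veronese_fixed_space)
    (simp_all only: veronese_fin_0 veronese_map_Fin orth_veronese_map continuous_veronese_map flip: veronese_map_Fin)

lemma bundle_map_1: "bundle_map (veronese 2 0) = (\<lambda>p. mat 1 ** (cscale 2 (veronese_map 2 p) - mat 1))"
  unfolding matrix_mul_lid
  by (rule ext) (rule bundle_map_fixed_space; simp add: orth_veronese_map veronese_0)

lemma veronese_2_1: "veronese 2 1 p = fixed_space (second_osculating p - veronese_map 2 p)"
  "orth_projection (second_osculating p - veronese_map 2 p)"
proof -
  show orth: "orth_projection (second_osculating p - veronese_map 2 p)" for p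
    by (rule orth_projection_diff[OF holo_sphere_orth(1)[OF holo_sphere_second_osculating]
      orth_veronese_map second_osculating_map]) simp
  have cont: "continuous_on UNIV ((\<lambda>p. second_osculating p - veronese_map 2 p) \<circ> chart_infty)"
    using continuous_on_diff[OF holo_sphere_orth(2)[OF holo_sphere_second_osculating] continuous_veronese_map[of 2]]
    by (simp add: o_def)
  show "veronese 2 1 p = fixed_space (second_osculating p - veronese_map 2 p)"
    by (rule veronese_fixed_space[OF _ orth cont]) (simp only: veronese_fin_2_1 veronese_map_Fin)
qed

lemma bundle_map_2: "bundle_map (bundle_sum (veronese 2 0) (veronese 2 1)) =
   (\<lambda>p. mat 1 ** (cscale 2 (second_osculating p) - mat 1))"
proof
  fix p
  have o: "orth_projection (veronese_map 2 p)" by (simp add: orth_veronese_map)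
  have "ctranspose (second_osculating p ** veronese_map 2 p) = ctranspose (veronese_map 2 p)"
    by (simp only: second_osculating_map)
  then have "veronese_map 2 p ** second_osculating p = veronese_map 2 p"
    using o holo_sphere_orth(1)[OF holo_sphere_second_osculating, of p] by (simp add: orth_projection_def)
  then have "veronese_map 2 p ** (second_osculating p - veronese_map 2 p) = 0"
    using o by (simp add: mmult_distrib orth_projection_def)
  note s = bundle_sum_fixed_space[where X="veronese 2 0" and Y="veronese 2 1" and p=p,
      OF o veronese_2_1(2)[of p] this veronese_0[OF disjI2[OF refl], of p] veronese_2_1(1)[of p]]
  have eq: "veronese_map 2 p + (second_osculating p - veronese_map 2 p) = second_osculating p" by simp
  show "bundle_map (bundle_sum (veronese 2 0) (veronese 2 1)) p = mat 1 ** (cscale 2 (second_osculating p) - mat 1)"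
    unfolding matrix_mul_lid
    by (rule bundle_map_fixed_space[where Y="bundle_sum (veronese 2 0) (veronese 2 1)"]) (use s in \<open>simp_all only: eq\<close>)
qed

lemma veronese_1_1: "veronese 1 1 p = fixed_space (plane - veronese_map 1 p)"
  "orth_projection (plane - veronese_map 1 p)"
proof -
  show orth: "orth_projection (plane - veronese_map 1 p)" for p
    by (rule orth_projection_diff[OF orth_plane orth_veronese_map plane_map(1)]) simp
  have cont: "continuous_on UNIV ((\<lambda>p. plane - veronese_map 1 p) \<circ> chart_infty)"
    using continuous_on_diff[OF continuous_on_const[of _ plane] continuous_veronese_map[of 1]]
    by (simp add: o_def)
  show "veronese 1 1 p = fixed_space (plane - veronese_map 1 p)"
    by (rule veronese_fixed_space[OF _ orth cont]) (simp only: veronese_fin_1_1 veronese_map_Fin)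
qed

text \<open>It changes the sign of the third coordinate, which moves the constant line from the -1
  to the +1 eigenspace. Hence the third model is a left translate of the reflection in
  V_0^1.\<close>

definition mirror :: "3 cmat" where
  "mirror = cscale 2 plane - mat 1"

lemma mirror_unitary: "mirror \<in> unitary_group"
  using orth_plane by (simp add: mirror_def unitary_group_def orth_projection_def mmult_distrib)
   (rule cmat_eqI, simp)

lemma bundle_map_3: "bundle_map (bundle_sum (veronese 1 0) (bundle_perp (bundle_sum (veronese 1 0) (veronese 1 1)))) =
   (\<lambda>p. mirror ** (cscale 2 (veronese_map 1 p) - mat 1))"
proof
  fix p
  have o: "orth_projection (veronese_map 1 p)" by (simp add: orth_veronese_map)
  have z: "veronese_map 1 p ** (plane - veronese_map 1 p) = 0"
    using o unfolding mmult_distrib plane_map by (simp add: orth_projection_def)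
  note v = veronese_0[OF disjI1[OF refl], of p]
  note s1 = bundle_sum_fixed_space[where X="veronese 1 0" and Y="veronese 1 1" and p=p,
      OF o veronese_1_1(2)[of p] z v veronese_1_1(1)[of p]]
  have eq: "veronese_map 1 p + (plane - veronese_map 1 p) = plane" by simp
  note s2 = bundle_perp_fixed_space[where Y="bundle_sum (veronese 1 0) (veronese 1 1)" and p=p, OF s1(2,1)[unfolded eq]]
  have z2: "veronese_map 1 p ** (mat 1 - plane) = 0"
    unfolding mmult_distrib plane_map by simp
  note s3 = bundle_sum_fixed_space[where X="veronese 1 0" and p=p
      and Y="bundle_perp (bundle_sum (veronese 1 0) (veronese 1 1))", OF o orth_projection_complement[OF orth_plane] z2 v s2]
  have "bundle_map (bundle_sum (veronese 1 0) (bundle_perp (bundle_sum (veronese 1 0) (veronese 1 1)))) p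
      = cscale 2 (veronese_map 1 p + (mat 1 - plane)) - mat 1"
    by (rule bundle_map_fixed_space[where p=p and
      Y="bundle_sum (veronese 1 0) (bundle_perp (bundle_sum (veronese 1 0) (veronese 1 1)))", OF s3(2,1)])
  also have "\<dots> = mirror ** (cscale 2 (veronese_map 1 p) - mat 1)"
    unfolding mirror_def by (simp only: mmult_distrib cscale_simps plane_map matrix_mul_lid matrix_mul_rid)
      (rule cmat_eqI, simp add: algebra_simps)
  finally show "bundle_map (bundle_sum (veronese 1 0) (bundle_perp (bundle_sum (veronese 1 0) (veronese 1 1)))) p
      = mirror ** (cscale 2 (veronese_map 1 p) - mat 1)" .
qed

section \<open>Uniton number one\<close>

text \<open>Unitarity on the circle is an identity of trigonometric polynomials in the loop
  parameter. Its first Fourier coefficient says that \<open>A1\<close> times the adjoint of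
  \<open>A0\<close> vanishes, and \<open>A1 = mat 1 - A0\<close> turns this into the projection
  equations.\<close>

lemma linear_loop_projection:
  fixes A0 A1 :: "'n::finite cmat"
  assumes unit: "\<And>\<zeta>. norm \<zeta> = 1 \<Longrightarrow> A0 + cscale \<zeta> A1 \<in> unitary_group" and one: "A0 + A1 = mat 1"
  shows "orth_projection A0"
proof -
  define S where "S = A0 ** ctranspose A0 + A1 ** ctranspose A1"
  define N where "N = A1 ** ctranspose A0"
  have eq: "S + cscale \<zeta> N + cscale (cnj \<zeta>) (ctranspose N) = mat 1" if "norm \<zeta> = 1" for \<zeta>
  proof -
    have "\<zeta> * cnj \<zeta> = 1" using that by (metis complex_norm_square of_real_1 one_power2)
    then have "(A0 + cscale \<zeta> A1) ** ctranspose (A0 + cscale \<zeta> A1) = S + cscale \<zeta> N + cscale (cnj \<zeta>) (ctranspose N)"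
      by (simp add: mmult_distrib cscale_right_distrib S_def N_def mult.commute add_ac)
    then show ?thesis using unitary_groupD(1)[OF unit[OF that]] by simp
  qed
  have "N = 0"
  proof (rule cmat_eqI)
    fix i j
    define d where "d = (mat 1 :: 'n cmat) $ i $ j"
    \<comment> \<open>The three points 1, -1 and i of the circle suffice to separate the Fourier
      coefficients.\<close>
    have "S $ i $ j + N $ i $ j + cnj (N $ j $ i) = d" "S $ i $ j - N $ i $ j - cnj (N $ j $ i) = d"
      "S $ i $ j + \<i> * N $ i $ j - \<i> * cnj (N $ j $ i) = d"
      using arg_cong[OF eq[of 1], of "\<lambda>X. X $ i $ j"] arg_cong[OF eq[of "-1"], of "\<lambda>X. X $ i $ j"]
        arg_cong[OF eq[of \<i>], of "\<lambda>X. X $ i $ j"]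
      by (simp_all add: d_def)
    moreover have "n = 0" if "s + n + m = d" "s - n - m = d" "s + \<i> * n - \<i> * m = d" for s n m :: complex
    proof -
      have "2 * s = 2 * d" using arg_cong2[OF that(1,2), of "(+)"] by (simp add: algebra_simps)
      then have "s = d" by simp
      with that(1) have "m = - n" by (simp add: eq_neg_iff_add_eq_0 add.commute add.assoc)
      with that(3) \<open>s = d\<close> have "2 * \<i> * n = 0" by simp
      then show ?thesis by simp
    qed
    ultimately show "N $ i $ j = (0 :: 'n cmat) $ i $ j" by auto
  qed
  moreover have "A1 = mat 1 - A0" using one by (simp add: algebra_simps)
  ultimately have 1: "ctranspose A0 = A0 ** ctranspose A0"
    by (simp add: N_def mmult_distrib)
  then have "ctranspose (ctranspose A0) = ctranspose (A0 ** ctranspose A0)" by (rule arg_cong)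
  then have "A0 = A0 ** ctranspose A0" by simp
  with 1 have "ctranspose A0 = A0" by simp
  with 1 show ?thesis by (simp add: orth_projection_def)
qed

text \<open>The loop parameter -1 expresses \<open>A_z F\<close> through \<open>p\<close>;
  comparison with the parameter i then forces \<open>p\<close> times \<open>d_z p\<close> to vanish.
  Consequently \<open>F\<close> times the reflection in \<open>p\<close> has zero
  differential.\<close>

lemma one_uniton_chart:
  fixes F p :: "complex \<Rightarrow> 'n::finite cmat"
  assumes smF: "smooth F" and F: "\<And>z. F z \<in> unitary_group"
    and smp: "smooth p" and p: "\<And>z. orth_projection (p z)"
    and eqz: "\<And>z \<zeta>. norm \<zeta> = 1 \<Longrightarrow> matrix_inv (p z + cscale \<zeta> (mat 1 - p z)) **
        d_z (\<lambda>u. p u + cscale \<zeta> (mat 1 - p u)) z = cscale (1 - inverse \<zeta>) (A_z F z)"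
    and eqzb: "\<And>z \<zeta>. norm \<zeta> = 1 \<Longrightarrow> matrix_inv (p z + cscale \<zeta> (mat 1 - p z)) **
        d_zbar (\<lambda>u. p u + cscale \<zeta> (mat 1 - p u)) z = cscale (1 - \<zeta>) (A_zbar F z)"
  shows "holo_proj p" "F z = F w ** (cscale 2 (p w) - mat 1) ** (cscale 2 (p z) - mat 1)"
proof -
  have h: "ctranspose (p z) = p z" "p z ** p z = p z" for z using p by (auto simp: orth_projection_def)
  define R where "R = (\<lambda>z. cscale 2 (p z) - mat 1)"
  have RR: "R z ** R z = mat 1" for z
    unfolding R_def by (simp add: mmult_distrib h) (rule cmat_eqI, simp)
  have d: "d_z (\<lambda>u. p u + cscale \<zeta> (mat 1 - p u)) z = cscale (1 - \<zeta>) (d_z p z)"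
    "d_zbar (\<lambda>u. p u + cscale \<zeta> (mat 1 - p u)) z = cscale (1 - \<zeta>) (d_zbar p z)" for \<zeta> z
    by (simp_all add: wirtinger_add wirtinger_diff wirtinger_cscale wirtinger_const smp smooth_cscale smooth_const smooth_diff)
      (rule cmat_eqI, simp add: algebra_simps)+
  have Rm: "p z + cscale (-1) (mat 1 - p z) = R z" for z
    unfolding R_def by (rule cmat_eqI) simp
  have invR: "matrix_inv (R z) = R z" for z by (rule matrix_inv_eqI) (rule RR)+
  have inv_i: "matrix_inv (p z + cscale \<i> (mat 1 - p z)) = p z + cscale (- \<i>) (mat 1 - p z)" for z
    by (rule matrix_inv_eqI; simp add: mmult_distrib h cscale_right_diff; rule cmat_eqI; simp add: algebra_simps)
  \<comment> \<open>At -1 both 1 - \<zeta> and 1 - inverse \<zeta> equal 2, and the loop is the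
    reflection \<open>R\<close>, which is its own inverse.\<close>
  have Az: "A_z F z = R z ** d_z p z" "A_zbar F z = R z ** d_zbar p z" for z
    using eqz[of "-1" z] eqzb[of "-1" z] unfolding d unfolding Rm invR by (simp_all add: cscale_cancel)
  have hol: "p z ** d_z p z = 0" for z
  proof -
    have 1: "cscale (1 - \<i>) ((p z + cscale (- \<i>) (mat 1 - p z)) ** d_z p z) = cscale (1 + \<i>) (R z ** d_z p z)"
      using eqz[of \<i> z] unfolding d inv_i Az by simp
    define X where "X = p z ** d_z p z"
    define Y where "Y = d_z p z"
    have 2: "cscale (1 - \<i>) (X + cscale (- \<i>) (Y - X)) = cscale (1 + \<i>) (cscale 2 X - Y)"
      using 1 unfolding R_def by (simp only: mmult_distrib cscale_simps matrix_mul_lid X_def Y_def)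
    have "X = 0"
    proof (rule cmat_eqI)
      fix i j
      have "(1 - \<i>) * (X $ i $ j - \<i> * (Y $ i $ j - X $ i $ j)) = (1 + \<i>) * (2 * X $ i $ j - Y $ i $ j)"
        using arg_cong[OF 2, of "\<lambda>Z. Z $ i $ j"] by simp
      then have "2 * \<i> * X $ i $ j = 0" by (simp add: algebra_simps)
      then show "X $ i $ j = (0 :: 'n cmat) $ i $ j" by simp
    qed
    then show ?thesis by (simp add: X_def)
  qed
  show hp: "holo_proj p" by unfold_locales (rule smp h hol)+
  interpret holo_proj p by (rule hp)
  have "R = reflection" by (auto simp: R_def reflection_def)
  note R = \<open>R = reflection\<close>
  have invF: "matrix_inv (F z) = ctranspose (F z)" for z
    by (rule matrix_inv_eqI; rule unitary_groupD[OF F])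
  have dF: "d_z F z = cscale 2 (F z ** (R z ** d_z p z))" "d_zbar F z = cscale 2 (F z ** (R z ** d_zbar p z))" for z
  proof -
    have FF: "cscale (1/2) (ctranspose (F z) ** d_z F z) = R z ** d_z p z"
      "cscale (1/2) (ctranspose (F z) ** d_zbar F z) = R z ** d_zbar p z"
      using Az[of z] unfolding A_z_def A_zbar_def invF by auto
    have "cscale 2 (F z ** (R z ** d_z p z)) = (F z ** ctranspose (F z)) ** d_z F z"
      "cscale 2 (F z ** (R z ** d_zbar p z)) = (F z ** ctranspose (F z)) ** d_zbar F z"
      by (simp_all add: matrix_mul_assoc flip: FF)
    then show "d_z F z = cscale 2 (F z ** (R z ** d_z p z))" "d_zbar F z = cscale 2 (F z ** (R z ** d_zbar p z))"
      unfolding unitary_groupD(1)[OF F] by simp_all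
  qed
  have prods: "R z ** d_z p z = - d_z p z" "d_z p z ** R z = d_z p z"
    "R z ** d_zbar p z = d_zbar p z" "d_zbar p z ** R z = - d_zbar p z" for z
    unfolding R_def by (simp_all add: mmult_distrib hol hol' d_z_mult_P P_mult_d_zbar) (rule cmat_eqI, simp)+
  have smR: "smooth R" unfolding R by (rule smooth_reflection)
  have FR: "F z ** R z = F w ** R w" for z w
  proof (rule d_z_d_zbar_eq_0_imp_const[of "\<lambda>z. F z ** R z"])
    show "smooth (\<lambda>z. F z ** R z)" by (intro smooth_intros smF smR)
    have dR: "d_z R = (\<lambda>z. cscale 2 (d_z p z))" "d_zbar R = (\<lambda>z. cscale 2 (d_zbar p z))"
      unfolding R by (rule d_reflection)+
    fix z
    have "d_z (\<lambda>z. F z ** R z) z = cscale 2 (F z ** (R z ** d_z p z)) ** R z + F z ** cscale 2 (d_z p z)"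
      by (simp only: wirtinger_mmult smF smR dF dR)
    also have "\<dots> = 0"
      by (simp only: prods cscale_simps mmult_minus matrix_mul_assoc[symmetric] prods) (rule cmat_eqI, simp)
    finally show "d_z (\<lambda>z. F z ** R z) z = 0" .
    have "d_zbar (\<lambda>z. F z ** R z) z = cscale 2 (F z ** (R z ** d_zbar p z)) ** R z + F z ** cscale 2 (d_zbar p z)"
      by (simp only: wirtinger_mmult smF smR dF dR)
    also have "\<dots> = 0"
      by (simp only: prods cscale_simps mmult_minus matrix_mul_assoc[symmetric] prods) (rule cmat_eqI, simp)
    finally show "d_zbar (\<lambda>z. F z ** R z) z = 0" .
  qed
  have "(F z ** R z) ** R z = F w ** R w ** R z" unfolding FR[of z w] ..
  then have "F z = F w ** R w ** R z"
    by (simp only: matrix_mul_assoc[symmetric] RR matrix_mul_rid)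
  then show "F z = F w ** (cscale 2 (p w) - mat 1) ** (cscale 2 (p z) - mat 1)" by (simp only: R_def)
qed

lemma charts_cover: "\<exists>c\<in>charts. \<exists>z. p = c z"
proof (cases p)
  case (Fin z)
  then show ?thesis by (auto simp: charts_def)
next
  case Infty
  then have "p = chart_infty 0" by (simp add: chart_infty_def)
  then show ?thesis unfolding charts_def by blast
qed

lemma one_uniton_form:
  fixes \<psi> :: "riemann_sphere \<Rightarrow> 'n::finite cmat"
  assumes imm: "immersion \<psi>" and ext: "polynomial_extended_solution \<psi> 1"
  obtains P Q where "holo_sphere P" "Q \<in> unitary_group" "\<And>p. \<psi> p = Q ** (cscale 2 (P p) - mat 1)"
proof -
  obtain \<Psi> A where es: "extended_solution \<psi> \<Psi>" and smA: "\<And>i. i \<le> 1 \<Longrightarrow> sphere_smooth (A i)"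
    and \<Psi>: "\<And>p \<zeta>. norm \<zeta> = 1 \<Longrightarrow> \<Psi> p \<zeta> = (\<Sum>i\<le>(1::nat). cscale (\<zeta> ^ i) (A i p))"
    using ext unfolding polynomial_extended_solution_def by blast
  define P where "P = A 0"
  have \<Psi>': "\<Psi> p \<zeta> = P p + cscale \<zeta> (A 1 p)" if "norm \<zeta> = 1" for p \<zeta>
    using \<Psi>[OF that] by (simp add: P_def)
  have one: "P p + A 1 p = mat 1" for p
    using es \<Psi>'[of 1 p] by (simp add: extended_solution_def smooth_to_loops_def)
  then have A1: "A 1 p = mat 1 - P p" for p by (metis add_diff_cancel_left')
  have orth: "orth_projection (P p)" for p
  proof (rule linear_loop_projection[OF _ one])
    fix \<zeta> :: complex assume "norm \<zeta> = 1"
    then show "P p + cscale \<zeta> (A 1 p) \<in> unitary_group"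
      using es \<Psi>'[of \<zeta> p] by (metis extended_solution_def smooth_to_loops_def)
  qed
  have U: "\<psi> p \<in> unitary_group" for p
    using imm unfolding immersion_def smooth_to_U_def by auto
  have chart: "holo_proj (P \<circ> c)" "\<psi> (c z) = \<psi> (c w) ** (cscale 2 (P (c w)) - mat 1) ** (cscale 2 (P (c z)) - mat 1)"
    if c: "c \<in> charts" for c z w
  proof -
    have 1: "smooth (\<psi> \<circ> c)" "smooth (P \<circ> c)"
      using imm smA[of 0] c by (auto simp: immersion_def smooth_to_U_def sphere_smooth_def P_def)
    have 2: "(\<psi> \<circ> c) z \<in> unitary_group" "orth_projection ((P \<circ> c) z)" for z
      using U orth by auto
    have 3: "matrix_inv ((P \<circ> c) z + cscale \<zeta> (mat 1 - (P \<circ> c) z)) **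
        d_z (\<lambda>u. (P \<circ> c) u + cscale \<zeta> (mat 1 - (P \<circ> c) u)) z = cscale (1 - inverse \<zeta>) (A_z (\<psi> \<circ> c) z)"
      "matrix_inv ((P \<circ> c) z + cscale \<zeta> (mat 1 - (P \<circ> c) z)) **
        d_zbar (\<lambda>u. (P \<circ> c) u + cscale \<zeta> (mat 1 - (P \<circ> c) u)) z = cscale (1 - \<zeta>) (A_zbar (\<psi> \<circ> c) z)"
      if "norm \<zeta> = 1" for z \<zeta>
    proof -
      have "matrix_inv (\<Psi> (c z) \<zeta>) ** d_z (\<lambda>u. \<Psi> (c u) \<zeta>) z = cscale (1 - inverse \<zeta>) (A_z (\<psi> \<circ> c) z) \<and>
          matrix_inv (\<Psi> (c z) \<zeta>) ** d_zbar (\<lambda>u. \<Psi> (c u) \<zeta>) z = cscale (1 - \<zeta>) (A_zbar (\<psi> \<circ> c) z)"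
        using es c that unfolding extended_solution_def by blast
      then show "matrix_inv ((P \<circ> c) z + cscale \<zeta> (mat 1 - (P \<circ> c) z)) **
          d_z (\<lambda>u. (P \<circ> c) u + cscale \<zeta> (mat 1 - (P \<circ> c) u)) z = cscale (1 - inverse \<zeta>) (A_z (\<psi> \<circ> c) z)"
        "matrix_inv ((P \<circ> c) z + cscale \<zeta> (mat 1 - (P \<circ> c) z)) **
          d_zbar (\<lambda>u. (P \<circ> c) u + cscale \<zeta> (mat 1 - (P \<circ> c) u)) z = cscale (1 - \<zeta>) (A_zbar (\<psi> \<circ> c) z)"
        unfolding \<Psi>'[OF that] A1 o_apply by blast+
    qed
    show "holo_proj (P \<circ> c)"
      by (rule one_uniton_chart(1)[OF 1(1) 2(1) 1(2) 2(2) 3])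
    show "\<psi> (c z) = \<psi> (c w) ** (cscale 2 (P (c w)) - mat 1) ** (cscale 2 (P (c z)) - mat 1)"
      using one_uniton_chart(2)[OF 1(1) 2(1) 1(2) 2(2) 3, of z w] by simp
  qed
  \<comment> \<open>The point with coordinate 1 is the same in both charts, so both charts produce
    the same constant \<open>Q\<close>.\<close>
  define Q where "Q = \<psi> (Fin 1) ** (cscale 2 (P (Fin 1)) - mat 1)"
  have ci: "chart_infty 1 = Fin 1" by (simp add: chart_infty_def)
  have form: "\<psi> (c z) = Q ** (cscale 2 (P (c z)) - mat 1)" if "c \<in> charts" for c z
    using that chart(2)[OF that, of z 1] by (auto simp: charts_def Q_def ci)
  have Q: "Q \<in> unitary_group"
  proof -
    interpret holo_proj "P \<circ> Fin" by (rule chart) (simp add: charts_def)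
    have "cscale 2 (P (Fin 1)) - mat 1 \<in> unitary_group" using reflection_unitary[of 1] by (simp add: reflection_def)
    then show ?thesis unfolding Q_def by (intro unitary_group_mult U)
  qed
  have "d_z (P \<circ> c) z \<noteq> 0" if c: "c \<in> charts" for c z
  proof -
    interpret holo_proj "P \<circ> c" by (rule chart(1)[OF c])
    have F: "\<psi> \<circ> c = (\<lambda>z. Q ** reflection z)" using form[OF c] by (auto simp: reflection_def)
    show ?thesis using inj_derivative_F[OF Q F, of z] imm c by (simp add: immersion_def)
  qed
  with chart(1) have "holo_sphere P" by (simp add: holo_sphere_def)
  moreover have "\<psi> p = Q ** (cscale 2 (P p) - mat 1)" for p
    using charts_cover[of p] form by auto
  ultimately show ?thesis using Q by (intro that)
qed

section \<open>Reduction to the rank-one classification\<close>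

lemma curvature_holo_proj:
  assumes P: "holo_proj P" and nz: "\<And>z. d_z P z \<noteq> 0" and Q: "Q \<in> unitary_group"
    and F: "F = (\<lambda>z. Q ** (cscale 2 (P z) - mat 1))"
    and K: "\<And>z. gauss_curvature (induced_metric F) z = K"
  shows "of_real (holo_proj.energy P z) * dzb (dz (\<lambda>z. of_real (holo_proj.energy P z))) z
      - dz (\<lambda>z. of_real (holo_proj.energy P z)) z * dzb (\<lambda>z. of_real (holo_proj.energy P z)) z
      = - of_real (K / 2) * of_real (holo_proj.energy P z) ^ 3"
proof -
  interpret holo_proj P by (rule P)
  have F': "F = (\<lambda>z. Q ** reflection z)" by (simp add: F reflection_def)
  have im: "induced_metric F = (\<lambda>z. mat (energy z))"
    by (rule ext) (rule induced_metric_F[OF Q F'])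
  have pos: "energy z > 0" for z by (rule energy_pos[OF nz])
  have g: "2 * energy z ^ 3 * K = (partial 1 energy z)\<^sup>2 + (partial 2 energy z)\<^sup>2
      - energy z * (partial 1 (partial 1 energy) z + partial 2 (partial 2 energy) z)"
    using gauss_curvature_conformal[OF smooth_energy pos, of z] K[of z] unfolding im by simp
  let ?e = "\<lambda>z. complex_of_real (energy z)"
  have "4 * (?e z * dzb (dz ?e) z - dz ?e z * dzb ?e z) = of_real (- (2 * energy z ^ 3 * K))"
    unfolding laplace_of_real[OF smooth_energy refl[of ?e]] g by simp
  also have "\<dots> = 4 * (- of_real (K / 2) * of_real (energy z) ^ 3)" by simp
  finally show ?thesis by (simp only: mult_cancel_left) simp
qed

lemma trace_holo_proj_const:
  assumes "holo_proj P" shows "trace (P z) = trace (P w)"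
proof -
  interpret holo_proj P by fact
  have t: "trace (d_z P z) = 0" for z
  proof -
    have "trace (d_z P z) = trace (d_z P z ** P z)" by (simp only: d_z_mult_P)
    also have "\<dots> = trace (P z ** d_z P z)" by (rule trace_mul_sym)
    finally show ?thesis by (simp only: hol trace_zero)
  qed
  show ?thesis
  proof (rule dz_dzb_eq_0_imp_const[of "\<lambda>z. trace (P z)"])
    show "smooth (\<lambda>z. trace (P z))" by (intro smooth_intros smooth_P)
    show "dz (\<lambda>z. trace (P z)) z = 0" "dzb (\<lambda>z. trace (P z)) z = 0" for z
      by (simp_all add: wirtinger_linear smooth_P t d_zbar_eq trace_cnj)
  qed
qed

text \<open>Ranks 0 and 3 would make \<open>P\<close> constant, against the immersion
  condition.\<close>

lemma trace_holo_sphere: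
  fixes P :: "riemann_sphere \<Rightarrow> 3 cmat"
  assumes P: "holo_sphere P"
  shows "(\<forall>z. trace (P (Fin z)) = 1) \<or> (\<forall>z. trace (P (Fin z)) = 2)"
proof -
  have H: "holo_proj (P \<circ> Fin)" "\<And>z. d_z (P \<circ> Fin) z \<noteq> 0" using P by (auto simp: holo_sphere_def charts_def)
  have orth: "orth_projection (P p)" for p by (rule holo_sphere_orth(1)[OF P])
  have const: "trace (P (Fin z)) = trace (P (Fin 0))" for z
    using trace_holo_proj_const[OF H(1), of z 0] by simp
  have "Re (trace (P (Fin 0))) \<le> 3"
    using orth_projection_trace_nonneg[OF orth_projection_complement[OF orth[of "Fin 0"]]] by (simp add: trace_sub trace_I)
  then obtain k where k: "k < 4" "trace (P (Fin 0)) = of_nat k"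
    using orth_projection_trace_nat[OF orth[of "Fin 0"], of 4] by auto
  have tk: "trace (P (Fin z)) = of_nat k" for z by (rule trans[OF const k(2)])
  have "k \<noteq> 0"
  proof
    assume "k = 0"
    then have "P (Fin z) = 0" for z
      by (intro orth_projection_trace_eq_0 orth) (simp add: tk)
    then have "(P \<circ> Fin) = (\<lambda>z. 0)" by (simp add: fun_eq_iff)
    then show False using H(2)[of 0] by (simp add: wirtinger_const)
  qed
  moreover have "k \<noteq> 3"
  proof
    assume "k = 3"
    then have "mat 1 - P (Fin z) = 0" for z
      by (intro orth_projection_trace_eq_0 orth_projection_complement orth)
        (simp add: trace_sub trace_I tk)
    then have "(P \<circ> Fin) = (\<lambda>z. mat 1)" by (auto simp: fun_eq_iff)
    then show False using H(2)[of 0] by (simp add: wirtinger_const)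
  qed
  ultimately have "k = 1 \<or> k = 2" using k(1) by auto
  then show ?thesis using tk by auto
qed

lemma isCont_eq_at:
  fixes f g :: "complex \<Rightarrow> 'a::t2_space"
  assumes "isCont f 0" "isCont g 0" "eventually (\<lambda>w. f w = g w) (at 0)"
  shows "f 0 = g 0"
proof (rule tendsto_unique[of "at (0::complex)"])
  show "(f \<longlongrightarrow> f 0) (at 0)" using assms(1) by (simp add: isCont_def)
  then show "(f \<longlongrightarrow> g 0) (at 0)" using assms(2,3) unfolding isCont_def
    by (simp add: tendsto_cong)
qed simp

text \<open>The classification concerns the finite plane; at infinity the equality follows because
  both sides are continuous in the chart there.\<close>

lemma rank_one_sphere:
  fixes P :: "riemann_sphere \<Rightarrow> 3 cmat"
  assumes P: "holo_sphere P" and F: "rank_one_holo_proj (P \<circ> Fin) K"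
  obtains n g U where "n = 1 \<or> n = 2" "sphere_biholomorphism g" "U \<in> unitary_group"
    "\<And>p. P (g p) = U ** veronese_map n p ** ctranspose U"
proof -
  have I: "holo_proj (P \<circ> chart_infty)" "\<And>w. d_z (P \<circ> chart_infty) w \<noteq> 0"
    using P by (auto simp: holo_sphere_def charts_def)
  obtain n \<alpha> \<beta> U where n: "n = 1 \<or> n = 2" and \<alpha>: "\<alpha> \<noteq> 0" and U: "U \<in> unitary_group"
    and fin: "\<And>z. P (Fin (\<alpha> * z + \<beta>)) = U ** veronese_model n z ** ctranspose U"
    by (rule rank_one_classification[OF F I]) (rule that)
  let ?g = "sphere_affine \<alpha> \<beta>"
  have fin': "P (?g (Fin z)) = U ** veronese_map n (Fin z) ** ctranspose U" for z
    by (simp add: veronese_map_Fin fin)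
  have inf: "P (?g Infty) = U ** veronese_map n Infty ** ctranspose U"
  proof -
    define f where "f = (\<lambda>w. (P \<circ> chart_infty) (w / (\<alpha> + \<beta> * w)))"
    define h where "h = (\<lambda>w. U ** (veronese_map n \<circ> chart_infty) w ** ctranspose U)"
    have A: "isCont (P \<circ> chart_infty) (0 / (\<alpha> + \<beta> * 0))"
      using holo_sphere_orth(2)[OF P] continuous_on_eq_continuous_at[of UNIV "P \<circ> chart_infty"] by blast
    have B: "((\<lambda>w. w / (\<alpha> + \<beta> * w)) \<longlongrightarrow> 0 / (\<alpha> + \<beta> * 0)) (at 0)"
      by (intro tendsto_intros) (use \<alpha> in simp)
    have "isCont f 0"
      unfolding f_def isCont_def using isCont_tendsto_compose[OF A B] by simp
    moreover have "isCont h 0"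
    proof -
      have "smooth (veronese_map n \<circ> chart_infty)"
        using holo_sphere_veronese_map[OF n] holo_proj.smooth_P unfolding holo_sphere_def charts_def by blast
      then have "smooth h" unfolding h_def by (intro smooth_intros)
      then show ?thesis using smooth_continuous continuous_on_eq_continuous_at[of UNIV h] by blast
    qed
    moreover have "eventually (\<lambda>w. f w = h w) (at 0)"
    proof -
      have "((\<lambda>w. \<alpha> + \<beta> * w) \<longlongrightarrow> \<alpha> + \<beta> * 0) (at 0)" by (intro tendsto_intros)
      then have "eventually (\<lambda>w. \<alpha> + \<beta> * w \<noteq> 0) (at 0)"
        by (rule tendsto_imp_eventually_ne) (use \<alpha> in simp)
      moreover have "eventually (\<lambda>w::complex. w \<noteq> 0) (at 0)" by (simp add: eventually_at_filter)
      ultimately show ?thesis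
      proof eventually_elim
        case (elim w)
        have "chart_infty (w / (\<alpha> + \<beta> * w)) = ?g (chart_infty w)"
          using elim by (simp add: chart_infty_def field_simps)
        moreover have "chart_infty w = Fin (1 / w)" using elim by (simp add: chart_infty_def)
        ultimately show ?case unfolding f_def h_def o_def using fin'[of "1 / w"] by (simp only:)
      qed
    qed
    ultimately have "f 0 = h 0" by (rule isCont_eq_at)
    then show ?thesis by (simp add: f_def h_def chart_infty_def)
  qed
  show ?thesis
  proof (rule that[OF n sphere_biholomorphism_affine[OF \<alpha>] U])
    show "P (?g p) = U ** veronese_map n p ** ctranspose U" for p
      by (cases p) (simp_all only: fin' inf)
  qed
qed

text \<open>Conjugate complements induce the same conformal factor, so the curvature equation
  carries over to them unchanged.\<close>

lemma dual_energy:
  assumes "holo_proj P"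
  shows "holo_proj.energy (\<lambda>z. mat 1 - mconj (P z)) = holo_proj.energy P"
proof
  fix z
  interpret holo_proj P by fact
  interpret D: holo_proj "\<lambda>z. mat 1 - mconj (P z)" by (rule holo_proj_dual[OF assms])
  have "ctranspose (mconj (d_zbar P z)) = mconj (d_z P z)"
    unfolding mconj_simps(8)[symmetric] ctranspose_d_zbar ..
  then have "complex_of_real (D.energy z) = trace (mconj (d_zbar P z ** d_z P z))"
    unfolding D.of_real_energy D.d_zbar_eq holo_proj_dual(2)[OF assms] by simp
  also have "\<dots> = of_real (energy z)" unfolding trace_cnj trace_mul_sym[of "d_zbar P z"] of_real_energy[symmetric] by simp
  finally show "D.energy z = energy z" by simp
qed

lemma unitarily_congruentI:
  assumes "Q \<in> unitary_group" "W \<in> unitary_group" "V \<in> unitary_group" "sphere_biholomorphism g"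
    and "\<And>p. \<psi> (g p) = Q ** X p" "\<And>p. \<phi> p = W ** X p ** V"
  shows "unitarily_congruent \<psi> \<phi>"
proof -
  have "\<phi> p = W ** ctranspose Q ** \<psi> (g p) ** V" for p
    by (simp add: assms(5,6) matrix_mul_assoc unitary_groupD[OF assms(1)])
  moreover have "W ** ctranspose Q \<in> unitary_group"
    using assms by (intro unitary_group_mult unitary_group_ctranspose)
  ultimately show ?thesis
    using assms(3,4) unfolding unitarily_congruent_def by blast
qed

definition quarter_turn :: "3 cmat" where
  "quarter_turn = vector [vector [0, -1, 0], vector [1, 0, 0], vector [0, 0, 1]]"

lemma quarter_turn_unitary: "quarter_turn \<in> unitary_group"
  by (auto simp: unitary_group_def quarter_turn_def vec_eq_iff forall_3 mmult_nth sum_3 mat_def)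

text \<open>For a rank one projection of \<open>\<complex>\<^sup>2\<close>, the quarter turn intertwines complex conjugation with taking
  the complement.\<close>

lemma quarter_turn_map:
  "quarter_turn ** mconj (veronese_map 1 p) ** ctranspose quarter_turn = plane - veronese_map 1 p"
proof (cases p)
  case (Fin z)
  have s: "1 + z * cnj z \<noteq> 0" using sph_nonzero[of z] by (simp add: sph_def)
  show ?thesis
    unfolding Fin veronese_map_Fin veronese_model_def
    using s cnj_sph[of z] unfolding sph_def
    by (auto simp: vec_eq_iff forall_3 mmult_nth sum_3 quarter_turn_def plane_def
        veronese_curve_nth[unfolded One_nat_def] field_simps)
next
  case Infty
  show ?thesis
    unfolding Infty by (auto simp: veronese_map_def veronese_model_def reversal_def quarter_turn_def plane_def
      vec_eq_iff forall_3 mmult_nth sum_3 veronese_curve_nth[unfolded One_nat_def])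
qed

theorem theorem5p1:
  fixes \<psi> :: "riemann_sphere \<Rightarrow> complex^3^3"
  assumes "minimal_immersion \<psi>"
    and "constant_curvature \<psi>"
    and "has_uniton_number \<psi> 1"
  shows "let \<phi>1 = bundle_map (veronese 2 0);
             \<phi>2 = bundle_map (bundle_sum (veronese 2 0) (veronese 2 1));
             \<phi>3 = bundle_map (bundle_sum (veronese 1 0)
                    (bundle_perp (bundle_sum (veronese 1 0) (veronese 1 1))))
         in (minimal_immersion \<phi>1 \<and> minimal_immersion \<phi>2 \<and> minimal_immersion \<phi>3) \<and>
            (unitarily_congruent \<psi> \<phi>1 \<or> unitarily_congruent \<psi> \<phi>2 \<or> unitarily_congruent \<psi> \<phi>3)"
proof -
  define \<phi>1 where "\<phi>1 = bundle_map (veronese 2 0)"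
  define \<phi>2 where "\<phi>2 = bundle_map (bundle_sum (veronese 2 0) (veronese 2 1))"
  define \<phi>3 where "\<phi>3 = bundle_map (bundle_sum (veronese 1 0) (bundle_perp (bundle_sum (veronese 1 0) (veronese 1 1))))"
  note \<phi> = \<phi>1_def[unfolded bundle_map_1] \<phi>2_def[unfolded bundle_map_2] \<phi>3_def[unfolded bundle_map_3]
  have min: "minimal_immersion \<phi>1" "minimal_immersion \<phi>2" "minimal_immersion \<phi>3"
    unfolding \<phi> by (intro minimal_immersion_holo_sphere holo_sphere_veronese_map holo_sphere_second_osculating
      unitary_group_one mirror_unitary; simp)+
  have "immersion \<psi>" "polynomial_extended_solution \<psi> 1"
    using assms(1,3) by (auto simp: minimal_immersion_def has_uniton_number_def)
  then obtain P Q where P: "holo_sphere P" and Q: "Q \<in> unitary_group"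
    and \<psi>: "\<And>p. \<psi> p = Q ** (cscale 2 (P p) - mat 1)"
    by (rule one_uniton_form) (rule that)
  have H: "holo_proj (P \<circ> Fin)" "\<And>z. d_z (P \<circ> Fin) z \<noteq> 0" using P by (auto simp: holo_sphere_def charts_def)
  obtain K where K: "\<And>z. gauss_curvature (induced_metric (\<psi> \<circ> Fin)) z = K"
    using assms(2) unfolding constant_curvature_def charts_def by blast
  have F: "\<psi> \<circ> Fin = (\<lambda>z. Q ** (cscale 2 ((P \<circ> Fin) z) - mat 1))" by (auto simp: \<psi>)
  note curv = curvature_holo_proj[OF H Q F K]
  have "unitarily_congruent \<psi> \<phi>1 \<or> unitarily_congruent \<psi> \<phi>2 \<or> unitarily_congruent \<psi> \<phi>3"
    using trace_holo_sphere[OF P]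
  proof
    assume tr: "\<forall>z. trace (P (Fin z)) = 1"
    have R: "rank_one_holo_proj (P \<circ> Fin) K"
      by (intro rank_one_holo_proj.intro rank_one_holo_proj_axioms.intro H curv) (simp add: tr)
    obtain n g U where n: "n = 1 \<or> n = 2" and g: "sphere_biholomorphism g" and U: "U \<in> unitary_group"
      and Pg: "\<And>p. P (g p) = U ** veronese_map n p ** ctranspose U"
      by (rule rank_one_sphere[OF P R]) (rule that)
    have V: "cscale 2 (veronese_map n p) - mat 1 = ctranspose U ** (cscale 2 (P (g p)) - mat 1) ** U" for p
      unfolding Pg by (simp add: mmult_distrib matrix_mul_assoc unitary_groupD[OF U])
    show ?thesis using n
    proof
      assume n: "n = 1"
      have "unitarily_congruent \<psi> \<phi>3"
        by (rule unitarily_congruentI[OF Q unitary_group_mult[OF mirror_unitary unitary_group_ctranspose[OF U]] U g \<psi>])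
          (simp only: \<phi> V[unfolded n] matrix_mul_assoc)
      then show ?thesis by blast
    next
      assume n: "n = 2"
      have "unitarily_congruent \<psi> \<phi>1"
        by (rule unitarily_congruentI[OF Q unitary_group_ctranspose[OF U] U g \<psi>])
          (simp only: \<phi> V[unfolded n] matrix_mul_assoc matrix_mul_lid)
      then show ?thesis by blast
    qed
  next
    assume tr: "\<forall>z. trace (P (Fin z)) = 2"
    let ?P = "\<lambda>p. mat 1 - mconj (P p)"
    have D: "holo_sphere ?P" by (rule holo_sphere_dual[OF P])
    have HD: "holo_proj (?P \<circ> Fin)" "\<And>z. d_z (?P \<circ> Fin) z \<noteq> 0" using D by (auto simp: holo_sphere_def charts_def)
    have en: "holo_proj.energy (?P \<circ> Fin) = holo_proj.energy (P \<circ> Fin)"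
      using dual_energy[OF H(1)] by (simp add: o_def)
    have R: "rank_one_holo_proj (?P \<circ> Fin) K"
      by (intro rank_one_holo_proj.intro rank_one_holo_proj_axioms.intro HD curv[folded en])
        (simp add: tr trace_sub trace_I trace_cnj)
    obtain n g U where n: "n = 1 \<or> n = 2" and g: "sphere_biholomorphism g" and U: "U \<in> unitary_group"
      and Pg: "\<And>p. ?P (g p) = U ** veronese_map n p ** ctranspose U"
      by (rule rank_one_sphere[OF D R]) (rule that)
    define V where "V = mconj U"
    have V: "V \<in> unitary_group" unfolding V_def by (rule unitary_group_mconj[OF U])
    \<comment> \<open>Undoing the duality: \<open>P\<close> is the complement of the conjugate of
      its rank-one partner, so the reflection changes sign and \<open>U\<close> is replaced by its
      conjugate \<open>V\<close>.\<close>
    have X: "mat 1 - cscale 2 (mconj (veronese_map n p)) = ctranspose V ** (cscale 2 (P (g p)) - mat 1) ** V" for p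
    proof -
      have "mconj (?P (g p)) = V ** mconj (veronese_map n p) ** ctranspose V"
        unfolding Pg V_def by simp
      then have "P (g p) = mat 1 - V ** mconj (veronese_map n p) ** ctranspose V"
        by (simp add: algebra_simps)
      then have "cscale 2 (P (g p)) - mat 1 = mat 1 - cscale 2 (V ** mconj (veronese_map n p) ** ctranspose V)"
        by (simp only:) (rule cmat_eqI, simp)
      then show ?thesis by (simp add: mmult_distrib matrix_mul_assoc unitary_groupD[OF V])
    qed
    show ?thesis using n
    proof
      \<comment> \<open>The quarter turn carries the conjugate of V_0^1 to its complement V_1^1 in
        C^2, so this case leads back to the third model.\<close>
      assume n: "n = 1"
      have "unitarily_congruent \<psi> \<phi>3"
      proof (rule unitarily_congruentI[OF Q unitary_group_mult[OF quarter_turn_unitary unitary_group_ctranspose[OF V]]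
          unitary_group_mult[OF V unitary_group_ctranspose[OF quarter_turn_unitary]] g \<psi>])
        fix p
        have "\<phi>3 p = mat 1 - cscale 2 (plane - veronese_map 1 p)"
          unfolding \<phi> mirror_def by (simp only: mmult_distrib cscale_simps plane_map matrix_mul_lid matrix_mul_rid)
            (rule cmat_eqI, simp add: algebra_simps)
        also have "\<dots> = quarter_turn ** (mat 1 - cscale 2 (mconj (veronese_map 1 p))) ** ctranspose quarter_turn"
          unfolding quarter_turn_map[symmetric]
          by (simp add: mmult_distrib unitary_groupD[OF quarter_turn_unitary])
        finally show "\<phi>3 p = quarter_turn ** ctranspose V ** (cscale 2 (P (g p)) - mat 1) ** (V ** ctranspose quarter_turn)"
          by (simp only: X[unfolded n] matrix_mul_assoc)
      qed
      then show ?thesis by blast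
    next
      \<comment> \<open>\<open>flip\<close> carries the conjugate of V_0^2 to V_2^2, whose
        complement is V_0^2 + V_1^2.\<close>
      assume n: "n = 2"
      have "unitarily_congruent \<psi> \<phi>2"
      proof (rule unitarily_congruentI[OF Q unitary_group_mult[OF flip_unitary(1) unitary_group_ctranspose[OF V]]
          unitary_group_mult[OF V unitary_group_ctranspose[OF flip_unitary(1)]] g \<psi>])
        fix p
        have "\<phi>2 p = mat 1 - cscale 2 (flip ** mconj (veronese_map 2 p) ** ctranspose flip)"
          unfolding \<phi> second_osculating_def by (simp add: flip_unitary) (rule cmat_eqI, simp)
        also have "\<dots> = flip ** (mat 1 - cscale 2 (mconj (veronese_map 2 p))) ** ctranspose flip"
          by (simp only: mmult_distrib cscale_simps matrix_mul_rid unitary_groupD[OF flip_unitary(1)])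
        finally show "\<phi>2 p = flip ** ctranspose V ** (cscale 2 (P (g p)) - mat 1) ** (V ** ctranspose flip)"
          by (simp only: X[unfolded n] matrix_mul_assoc)
      qed
      then show ?thesis by blast
    qed
  qed
  then show ?thesis
    unfolding Let_def \<phi>1_def[symmetric] \<phi>2_def[symmetric] \<phi>3_def[symmetric] using min by blast
qed

end
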